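(* For every $i\in\{1,\dots,12\}$ and every $\varepsilon>0$ there exists an admissible tuple $\alpha$ with $|\alpha-A_i|<\varepsilon$ such that the form $\Lambda'_{walsh,\mathbf P,\mathbf Q}$ is of restricted type $\alpha$ uniformly in $\mathbf P,\mathbf Q$, i.e. with an implicit constant independent of the finite collections $\mathbf P,\mathbf Q$ of quartiles.
   Context: Walsh functions: $w_0:=\chi_{[0,1)}$, $w_{2l}(x):=w_l(2x)+w_l(2x-1)$, $w_{2l+1}(x):=w_l(2x)-w_l(2x-1)$ for integers $l\ge0$. A tile is $P=I_P\times\omega_P=[2^{-k}n,2^{-k}(n+1))\times[2^kl,2^k(l+1))$ ($k,n\in\mathbb Z$, $l\ge0$), with $\phi_P(x):=2^{k/2}w_l(2^kx-n)$. A quartile is $P=I_P\times\omega_P=[2^{-k}n,2^{-k}(n+1))\times[2^{k+2}l,2^{k+2}(l+1))$ with sub-tiles $P_i:=I_P\times[2^k(4l+i-1),2^k(4l+i))$, $i=1,2,3$. $\langle f,g\rangle=\int f\bar g$. For a tile $P$ and finite collection $\mathbf Q$ of quartiles, $B_{walsh,P,\mathbf Q}(f_1,f_2):=\sum_{Q\in\mathbf Q:\omega_{Q_3}\subseteq\omega_P}|I_Q|^{-1/2}\langle f_1,\phi_{Q_1}\rangle\langle f_2,\phi_{Q_2}\rangle\phi_{Q_3}$. For finite collections $\mathbf P,\mathbf Q$ of quartiles, $$\Lambda'_{walsh,\mathbf P,\mathbf Q}(f_1,f_2,f_3,f_4):=\int_{\mathbb R}\sum_{P\in\mathbf P}|I_P|^{-1/2}\langle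 B_{walsh,P_1,\mathbf Q}(f_1,f_2),\phi_{P_1}\rangle\langle f_3,\phi_{P_2}\rangle\phi_{P_3}(x)\,f_4(x)\,dx.$$ A tuple $\alpha=(\alpha_1,\dots,\alpha_4)$ is admissible if $-\infty<\alpha_i<1$ for all $i$, $\sum_i\alpha_i=1$, and at most one index $j$ has $\alpha_j<0$ (such an index is called bad; others are good). A subset $E'\subseteq E$ is a major subset if $|E'|\ge\frac12|E|$. $X(E)$ denotes the set of functions supported on $E$ with $\|f\|_\infty\le1$. A 4-linear form $\Lambda$ is of restricted type $\alpha$ ($\alpha$ admissible) if for all sets $E_1,\dots,E_4\subseteq\mathbb R$ of finite measure there is a major subset $E'_j$ of $E_j$ for each bad index $j$ (with $E'_i:=E_i$ for good $i$) such that $|\Lambda(f_1,f_2,f_3,f_4)|\lesssim|E_1|^{\alpha_1}|E_2|^{\alpha_2}|E_3|^{\alpha_3}|E_4|^{\alpha_4}$ for all $f_i\in X(E'_i)$. The points are $A_1=(1,\frac12,1,-\frac32)$, $A_2=(\frac12,1,1,-\frac32)$, $A_3=(\frac12,1,-\frac32,1)$, $A_4=(1,\frac12,-\frac32,1)$, $A_5=(1,-\frac12,0,\frac12)$, $A_6=(1,-\frac12,\frac12,0)$, $A_7=(\frac12,-\frac12,0,1)$, $A_8=(\frac12,-\frac12,1,0)$, $A_9=(-\frac12,1,0,\frac12)$, $A_{10}=(-\frac12,1,\frac12,0)$, $A_{11}=(-\frac12,\frac12,1,0)$, $A_{12}=(-\frac12,\frac12,0,1)$. *)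

theory Defs
  imports "HOL-Analysis.Analysis"
begin

fun walsh :: "nat \<Rightarrow> real \<Rightarrow> real" where
  "walsh l x =
     (if l = 0 then indicator {0..<1} x
      else if even l then walsh (l div 2) (2 * x) + walsh (l div 2) (2 * x - 1)
      else walsh (l div 2) (2 * x) - walsh (l div 2) (2 * x - 1))"

text \<open>A tile (k,n,l) is I x omega = [2^-k n, 2^-k (n+1)) x [2^k l, 2^k (l+1)).
  A quartile (k,n,l) is [2^-k n, 2^-k (n+1)) x [2^(k+2) l, 2^(k+2) (l+1)).
  Both are encoded by their parameter triple (k,n,l).\<close>

type_synonym tile = "int \<times> int \<times> nat"
type_synonym quartile = "int \<times> int \<times> nat"

definition tile_I :: "tile \<Rightarrow> real set" where
  "tile_I P = (case P of (k, n, l) \<Rightarrow>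
     {2 powr (- real_of_int k) * real_of_int n ..< 2 powr (- real_of_int k) * (real_of_int n + 1)})"

definition tile_omega :: "tile \<Rightarrow> real set" where
  "tile_omega P = (case P of (k, n, l) \<Rightarrow>
     {2 powr (real_of_int k) * real l ..< 2 powr (real_of_int k) * (real l + 1)})"

definition phi :: "tile \<Rightarrow> real \<Rightarrow> real" where
  "phi P x = (case P of (k, n, l) \<Rightarrow>
     2 powr (real_of_int k / 2) * walsh l (2 powr (real_of_int k) * x - real_of_int n))"

definition quartile_I :: "quartile \<Rightarrow> real set" where
  "quartile_I Q = (case Q of (k, n, l) \<Rightarrow>
     {2 powr (- real_of_int k) * real_of_int n ..< 2 powr (- real_of_int k) * (real_of_int n + 1)})"

definition quartile_omega :: "quartile \<Rightarrow> real set" where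
  "quartile_omega Q = (case Q of (k, n, l) \<Rightarrow>
     {2 powr (real_of_int k + 2) * real l ..< 2 powr (real_of_int k + 2) * (real l + 1)})"

definition subtile :: "quartile \<Rightarrow> nat \<Rightarrow> tile" where
  "subtile Q i = (case Q of (k, n, l) \<Rightarrow> (k, n, 4 * l + i - 1))"

definition winner :: "(real \<Rightarrow> complex) \<Rightarrow> (real \<Rightarrow> complex) \<Rightarrow> complex" where
  "winner f g = (LINT x|lebesgue. f x * cnj (g x))"

definition B_walsh :: "tile \<Rightarrow> quartile set \<Rightarrow> (real \<Rightarrow> complex) \<Rightarrow> (real \<Rightarrow> complex)
    \<Rightarrow> real \<Rightarrow> complex" where
  "B_walsh P Qs f1 f2 = (\<lambda>x. \<Sum>Q\<in>{Q\<in>Qs. tile_omega (subtile Q 3) \<subseteq> tile_omega P}.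
      complex_of_real (measure lebesgue (quartile_I Q) powr (-1/2))
      * winner f1 (\<lambda>y. complex_of_real (phi (subtile Q 1) y))
      * winner f2 (\<lambda>y. complex_of_real (phi (subtile Q 2) y))
      * complex_of_real (phi (subtile Q 3) x))"

definition Lambda' :: "quartile set \<Rightarrow> quartile set \<Rightarrow> (real \<Rightarrow> complex) \<Rightarrow> (real \<Rightarrow> complex)
    \<Rightarrow> (real \<Rightarrow> complex) \<Rightarrow> (real \<Rightarrow> complex) \<Rightarrow> complex" where
  "Lambda' Ps Qs f1 f2 f3 f4 = (LINT x|lebesgue.
      (\<Sum>P\<in>Ps. complex_of_real (measure lebesgue (quartile_I P) powr (-1/2))
         * winner (B_walsh (subtile P 1) Qs f1 f2) (\<lambda>y. complex_of_real (phi (subtile P 1) y))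
         * winner f3 (\<lambda>y. complex_of_real (phi (subtile P 2) y))
         * complex_of_real (phi (subtile P 3) x)) * f4 x)"

definition admissible :: "(nat \<Rightarrow> real) \<Rightarrow> bool" where
  "admissible \<alpha> \<longleftrightarrow> (\<forall>i\<in>{1..4}. \<alpha> i < 1) \<and> (\<Sum>i=1..4. \<alpha> i) = 1
     \<and> card {j\<in>{1..4::nat}. \<alpha> j < 0} \<le> 1"

definition major_subset :: "real set \<Rightarrow> real set \<Rightarrow> bool" where
  "major_subset E' E \<longleftrightarrow> E' \<subseteq> E \<and> E' \<in> sets lebesgue
     \<and> measure lebesgue E' \<ge> measure lebesgue E / 2"

definition Xset :: "real set \<Rightarrow> (real \<Rightarrow> complex) set" where
  "Xset E = {f. f \<in> borel_measurable lebesgue \<and> (\<forall>x. x \<notin> E \<longrightarrow> f x = 0) \<and> (\<forall>x. norm (f x) \<le> 1)}"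

definition restricted_type_with_const ::
  "(nat \<Rightarrow> real) \<Rightarrow> real \<Rightarrow> ((real \<Rightarrow> complex) \<Rightarrow> (real \<Rightarrow> complex) \<Rightarrow> (real \<Rightarrow> complex)
     \<Rightarrow> (real \<Rightarrow> complex) \<Rightarrow> complex) \<Rightarrow> bool" where
  "restricted_type_with_const \<alpha> C \<Lambda> \<longleftrightarrow>
    (\<forall>E :: nat \<Rightarrow> real set. (\<forall>i\<in>{1..4}. E i \<in> sets lebesgue \<and> emeasure lebesgue (E i) < \<infinity>) \<longrightarrow>
      (\<exists>E' :: nat \<Rightarrow> real set.
         (\<forall>i\<in>{1..4}. if \<alpha> i < 0 then major_subset (E' i) (E i) else E' i = E i) \<and>
         (\<forall>f1 f2 f3 f4. f1 \<in> Xset (E' 1) \<longrightarrow> f2 \<in> Xset (E' 2) \<longrightarrow> f3 \<in> Xset (E' 3)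
             \<longrightarrow> f4 \<in> Xset (E' 4) \<longrightarrow>
            norm (\<Lambda> f1 f2 f3 f4) \<le> C * (\<Prod>i=1..4. measure lebesgue (E i) powr \<alpha> i))))"

definition Apt :: "nat \<Rightarrow> nat \<Rightarrow> real" where
  "Apt i = (\<lambda>j. [[1, 1/2, 1, -3/2], [1/2, 1, 1, -3/2], [1/2, 1, -3/2, 1], [1, 1/2, -3/2, 1],
                 [1, -1/2, 0, 1/2], [1, -1/2, 1/2, 0], [1/2, -1/2, 0, 1], [1/2, -1/2, 1, 0],
                 [-1/2, 1, 0, 1/2], [-1/2, 1, 1/2, 0], [-1/2, 1/2, 1, 0], [-1/2, 1/2, 0, 1]]
                 ! (i - 1) ! (j - 1))"

definition tuple_dist :: "(nat \<Rightarrow> real) \<Rightarrow> (nat \<Rightarrow> real) \<Rightarrow> real" where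
  "tuple_dist \<alpha> \<beta> = sqrt (\<Sum>j=1..4. (\<alpha> j - \<beta> j)\<^sup>2)"

end

theory Submission
  imports Defs
begin

text \<open>
  All estimates rest on the size--energy inequality for sums over quartiles: repeatedly removing
  trees whose lacunary sums are large leaves collections of small size, and the removed trees have
  controlled total length since their sub-tiles are pairwise disjoint. Energies of Walsh coefficients
  are bounded by Bessel's inequality and sizes by densities. For the composed form, the energy of
  the coefficients of the inner operator is obtained by dualizing back to the size--energy inequality;
  this is possible because a tile of one disjoint family meets the tiles of another disjoint family only
  on one side (longer in time, or shorter), so that the truncated Gram matrix is still a contraction.
  Near \<open>A 1\<close> to \<open>A 6\<close>, \<open>A 9\<close> and \<open>A 10\<close> no more is needed: the coefficients of the inner
  operator enter through their energy only. Near \<open>A 7\<close>, \<open>A 8\<close>, \<open>A 11\<close> and \<open>A 12\<close> the roles of the two collections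
  are exchanged, and the size of the dual coefficients is bounded by an \<open>L log L\<close> estimate for a
  paraproduct: on a tree they are the coefficients of a single function.
\<close>

section \<open>Dyadic tiles and trees\<close>

text \<open>The truncation in the inner operator keeps only pairs with I_P contained in I_Q
  (\<open>K_nonzero\<close>), and this asymmetry decides which densities are available. Removing an
  exceptional set from \<open>E 3\<close> or \<open>E 4\<close> discards quartiles P, and with them
  every Q whose time interval lies in the set, so both collections are thinned. Removing it from
  \<open>E 1\<close> or \<open>E 2\<close> thins only the collection of the Q: a P may sit inside
  the exceptional set below a surviving Q. With a bad index 1 or 2 the densities of
  \<open>E 3\<close> and \<open>E 4\<close> above the P are therefore out of reach, which is why
  four of the points require a size bound for the dual coefficients in terms of densities above the
  Q. In the energy argument a coefficient without pointwise control enters the size--energy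
  inequality with size exponent 0: its size may be any finite number and only its energy counts. The
  size exponents of the other two stay in [\<delta>, 1 - \<delta>], so that the sum over levels is a
  convergent geometric series. The points are the limits as \<delta> tends to 0.\<close>

abbreviation (input) kk :: "int \<times> int \<times> nat \<Rightarrow> int" where "kk p \<equiv> fst p"
abbreviation (input) nn :: "int \<times> int \<times> nat \<Rightarrow> int" where "nn p \<equiv> fst (snd p)"
abbreviation (input) ll :: "int \<times> int \<times> nat \<Rightarrow> nat" where "ll p \<equiv> snd (snd p)"

text \<open>\<open>dsub k n k' n'\<close> is the inclusion of the dyadic interval \<open>(k, n)\<close> in \<open>(k', n')\<close>, and \<open>fsub r p\<close> the
  inclusion of the frequency interval of \<open>r\<close> in that of \<open>p\<close>; both are expressed through the integer parameters.\<close>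

definition dsub :: "int \<Rightarrow> int \<Rightarrow> int \<Rightarrow> int \<Rightarrow> bool" where
  "dsub k n k' n' \<longleftrightarrow> k' \<le> k \<and> n div 2 ^ nat (k - k') = n'"

definition fsub :: "tile \<Rightarrow> tile \<Rightarrow> bool" where
  "fsub r p \<longleftrightarrow> kk r \<le> kk p \<and> ll r div 2 ^ nat (kk p - kk r) = ll p"

text \<open>Fefferman's order on dyadic tiles of area one: the smaller tile is shorter in time and
  wider in frequency, hence the exchanged arguments of \<open>fsub\<close>. Two such tiles meet
  exactly if they are comparable.\<close>

definition tile_le :: "tile \<Rightarrow> tile \<Rightarrow> bool" where
  "tile_le p r \<longleftrightarrow> dsub (kk p) (nn p) (kk r) (nn r) \<and> fsub r p"

definition len :: "tile \<Rightarrow> real" where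
  "len t = 2 powr (- real_of_int (kk t))"

definition fulltree :: "tile \<Rightarrow> quartile set" where
  "fulltree t = {P. \<exists>i\<in>{1..4}. tile_le (subtile P i) t}"

lemma len_pos [simp]: "len t > 0" by (simp add: len_def)

lemma subtile_simps [simp]:
  "fst (subtile P i) = fst P" "fst (snd (subtile P i)) = fst (snd P)"
  "snd (snd (subtile P i)) = 4 * snd (snd P) + i - 1"
  by (cases P; simp add: subtile_def)+

lemma len_subtile [simp]: "len (subtile P i) = len P" by (simp add: len_def)

lemma subtile_inj: "i \<ge> 1 \<Longrightarrow> subtile P i = subtile Q i \<longleftrightarrow> P = Q"
  by (auto simp: prod_eq_iff)

lemma nat_diff_split: "c \<le> b \<Longrightarrow> b \<le> a \<Longrightarrow> nat (a - c) = nat (a - b) + nat (b - c)" for a b c :: int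
  by linarith

lemma nat_diff_split': "c \<le> b \<Longrightarrow> b \<le> a \<Longrightarrow> nat (a - c) = nat (b - c) + nat (a - b)" for a b c :: int
  by linarith

lemma dsub_refl [simp]: "dsub k n k n" by (simp add: dsub_def)

lemma dsub_trans: "dsub k n k' n' \<Longrightarrow> dsub k' n' k'' n'' \<Longrightarrow> dsub k n k'' n''"
  unfolding dsub_def using nat_diff_split[of k'' k' k]
  by (auto simp: power_add zdiv_zmult2_eq)

lemma dsub_mid: "dsub k n k'' n'' \<Longrightarrow> k'' \<le> k' \<Longrightarrow> k' \<le> k \<Longrightarrow> dsub k n k' n' \<Longrightarrow> dsub k' n' k'' n''"
  unfolding dsub_def using nat_diff_split[of k'' k' k]
  by (auto simp: power_add zdiv_zmult2_eq)

lemma fsub_refl [simp]: "fsub r r" by (simp add: fsub_def)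

lemma fsub_trans: "fsub r q \<Longrightarrow> fsub q p \<Longrightarrow> fsub r p"
  unfolding fsub_def using nat_diff_split'[of "kk r" "kk q" "kk p"]
  by (auto simp: power_add div_mult2_eq)

lemma fsub_mid: "fsub r p \<Longrightarrow> fsub r q \<Longrightarrow> kk q \<le> kk p \<Longrightarrow> fsub q p"
  unfolding fsub_def using nat_diff_split'[of "kk r" "kk q" "kk p"]
  by (auto simp: power_add div_mult2_eq)

lemma tile_le_refl [simp]: "tile_le p p" by (simp add: tile_le_def)

lemma tile_le_trans: "tile_le p q \<Longrightarrow> tile_le q r \<Longrightarrow> tile_le p r"
  unfolding tile_le_def by (meson dsub_trans fsub_trans)

lemma div4: "1 \<le> i \<Longrightarrow> i \<le> 4 \<Longrightarrow> (4 * l + i - 1) div 4 = (l::nat)" by auto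

text \<open>The four sub-tiles exhaust the quartile, so division by 4 forgets which of them contains
  the frequency interval of the top. This is why the index 4, which carries no function of the
  forms, takes part in trees.\<close>

lemma fulltree_iff:
  "P \<in> fulltree t \<longleftrightarrow> dsub (kk P) (nn P) (kk t) (nn t) \<and>
     ll t div 2 ^ nat (kk P - kk t) div 4 = ll P"
proof -
  have "(\<exists>i\<in>{1..4}. x = 4 * ll P + i - 1) \<longleftrightarrow> x div 4 = ll P" for x
  proof
    assume "x div 4 = ll P"
    then have "x = 4 * ll P + (x mod 4 + 1) - 1" "x mod 4 + 1 \<in> {1..4}"
      using div_mult_mod_eq[of x 4] by auto
    then show "\<exists>i\<in>{1..4}. x = 4 * ll P + i - 1" by blast
  qed (auto)
  then show ?thesis
    unfolding fulltree_def tile_le_def fsub_def by (auto simp: dsub_def)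
qed

text \<open>Once sub-tile intervals of the two quartiles are nested, so are the dyadic frequency
  intervals of the quartiles themselves; in integers, division by 4 commutes with division by a
  power of 2.\<close>

lemma fsub_subtile_fulltree:
  assumes ij: "i \<in> {1..4}" "j \<in> {1..4}" and le: "fsub (subtile P' j) (subtile P j)"
    and t: "fsub t (subtile P' i)"
  shows "ll t div 2 ^ nat (kk P - kk t) div 4 = ll P"
proof -
  have *: "nat (kk P - kk t) = nat (kk P' - kk t) + nat (kk P - kk P')"
    using le t by (auto simp: fsub_def)
  let ?d = "nat (kk P - kk P')"
  have "ll t div 2 ^ nat (kk P - kk t) div 4 = (4 * ll P' + i - 1) div 2 ^ ?d div 4"
    using t by (auto simp: * fsub_def power_add div_mult2_eq)
  also have "\<dots> = (4 * ll P' + i - 1) div 4 div 2 ^ ?d"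
    by (metis div_mult2_eq mult.commute)
  also have "\<dots> = (4 * ll P' + j - 1) div 4 div 2 ^ ?d"
    using ij div4[of i "ll P'"] div4[of j "ll P'"] by simp
  also have "\<dots> = (4 * ll P' + j - 1) div 2 ^ ?d div 4"
    by (metis div_mult2_eq mult.commute)
  also have "\<dots> = (4 * ll P + j - 1) div 4" using le by (auto simp: fsub_def)
  also have "\<dots> = ll P" using ij div4[of j "ll P"] by simp
  finally show ?thesis .
qed

lemma tile_le_fulltree:
  assumes "i \<in> {1..4}" "j \<in> {1..4}" "tile_le (subtile P j) (subtile P' j)" "tile_le (subtile P' i) t"
  shows "P \<in> fulltree t"
  using assms fsub_subtile_fulltree[of i j P' P t] dsub_trans[of "kk P" "nn P" "kk P'" "nn P'" "kk t" "nn t"]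
  by (auto simp: fulltree_iff tile_le_def)

section \<open>Frequency positions of sub-tiles\<close>

definition lo :: "tile \<Rightarrow> real" where "lo t = 2 powr (real_of_int (kk t)) * real (ll t)"
definition hi :: "tile \<Rightarrow> real" where "hi t = 2 powr (real_of_int (kk t)) * (real (ll t) + 1)"

lemma powr_diff_nat: "k' \<le> k \<Longrightarrow> 2 powr (real_of_int k) = 2 powr (real_of_int k') * 2 ^ nat (k - k')"
  by (simp add: powr_realpow[symmetric] powr_add[symmetric])

lemma fsub_lohi: assumes "fsub r p" shows "lo p \<le> lo r" "hi r \<le> hi p" "lo r < hi r"
proof -
  let ?d = "nat (kk p - kk r)"
  have k: "kk r \<le> kk p" and l: "ll r div 2 ^ ?d = ll p" using assms by (auto simp: fsub_def)
  have "ll p * 2 ^ ?d \<le> ll r" "ll r < (ll p + 1) * 2 ^ ?d"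
    using div_times_less_eq_dividend[of "ll r" "2 ^ ?d"] dividend_less_div_times[of "2 ^ ?d" "ll r"]
    unfolding l by auto
  then have "ll p * 2 ^ ?d \<le> ll r" "ll r + 1 \<le> (ll p + 1) * 2 ^ ?d" by auto
  then have "real (ll p * 2 ^ ?d) \<le> real (ll r)" "real (ll r + 1) \<le> real ((ll p + 1) * 2 ^ ?d)"
    by (metis of_nat_le_iff)+
  then have "real (ll p) * 2 ^ ?d \<le> real (ll r)" "real (ll r) + 1 \<le> (real (ll p) + 1) * 2 ^ ?d"
    by (auto simp: algebra_simps)
  then have "2 powr kk r * (real (ll p) * 2 ^ ?d) \<le> 2 powr kk r * real (ll r)"
      "2 powr kk r * (real (ll r) + 1) \<le> 2 powr kk r * ((real (ll p) + 1) * 2 ^ ?d)"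
    by (auto intro!: mult_left_mono)
  then show "lo p \<le> lo r" "hi r \<le> hi p" unfolding lo_def hi_def powr_diff_nat[OF k]
    by (simp_all add: algebra_simps)
  show "lo r < hi r" by (simp add: lo_def hi_def)
qed

text \<open>For d >= 2 the whole frequency interval of the longer quartile falls into sub-tile j of
  the shorter one, hence to one side of its sub-tile i. For d = 1 parity leaves only j = 1, where
  the claim is direct.\<close>

lemma sibling_order_aux:
  fixes l l' :: nat
  assumes "(4 * l' + j - 1) div 2 ^ d = 4 * l + j - 1" "d \<ge> 1" "1 \<le> j" "j \<le> 3" "1 \<le> i" "i \<le> 4"
  shows "i > j \<Longrightarrow> 4 * l' + i \<le> 2 ^ d * (4 * l + i - 1)"
    and "i < j \<Longrightarrow> 2 ^ d * (4 * l + i) \<le> 4 * l' + i - 1"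
proof -
  consider "d = 1" | e where "d = e + 2"
    using assms(2) by (metis One_nat_def Suc_1 add.commute le_Suc_ex le_antisym not_less_eq_eq)
  then have "(i > j \<longrightarrow> 4 * l' + i \<le> 2 ^ d * (4 * l + i - 1)) \<and> (i < j \<longrightarrow> 2 ^ d * (4 * l + i) \<le> 4 * l' + i - 1)"
  proof cases
    case 1
    have "j = 1 \<or> j = 2 \<or> j = 3" using assms by auto
    then show ?thesis using assms(1) 1 assms(5,6) by (elim disjE) (auto, presburger+)
  next
    case 2
    define q where "q = (2::nat) ^ e"
    have pd: "2 ^ d = 4 * q" by (simp add: 2 q_def)
    have q0: "q \<ge> 1" by (simp add: q_def)
    have a: "(4 * l + j - 1) * (4 * q) \<le> 4 * l' + j - 1"
      using assms(1) unfolding pd by (metis div_times_less_eq_dividend)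
    have b: "4 * l' + j - 1 < (4 * l + j) * (4 * q)"
    proof -
      have "4 * l' + j - 1 < 4 * q + (4 * l' + j - 1) div (4 * q) * (4 * q)"
        by (rule dividend_less_div_times) (use q0 in simp)
      also have "\<dots> = 4 * q + (4 * l + j - 1) * (4 * q)" using assms(1) by (simp add: pd)
      also have "\<dots> = (4 * l + j - 1 + 1) * (4 * q)" by (simp only: distrib_right mult_1 add.commute)
      finally show ?thesis using assms(3) by simp
    qed
    have a': "(4 * l + j - 1) * q \<le> l'"
    proof (rule ccontr)
      assume "\<not> ?thesis"
      then have "l' + 1 \<le> (4 * l + j - 1) * q" by simp
      then have "4 * l' + 4 \<le> (4 * l + j - 1) * (4 * q)" by simp
      then show False using a assms(4) by linarith
    qed
    have b': "l' + 1 \<le> (4 * l + j) * q"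
    proof (rule ccontr)
      assume "\<not> ?thesis"
      then have "(4 * l + j) * q \<le> l'" by simp
      then have "(4 * l + j) * (4 * q) \<le> 4 * l'" by simp
      then show False using b assms(3) by linarith
    qed
    have "i > j \<Longrightarrow> 4 * l' + i \<le> 4 * q * (4 * l + i - 1)"
    proof -
      assume "i > j"
      then have "(4 * l + j) * q \<le> (4 * l + i - 1) * q" by (intro mult_right_mono) auto
      then have "l' + 1 \<le> (4 * l + i - 1) * q" using b' by linarith
      then show ?thesis using assms(6) by (simp add: algebra_simps)
    qed
    moreover have "i < j \<Longrightarrow> 4 * q * (4 * l + i) \<le> 4 * l' + i - 1"
    proof -
      assume "i < j"
      then have "(4 * l + i) * q \<le> (4 * l + j - 1) * q" by (intro mult_right_mono) auto
      then have "(4 * l + i) * q \<le> l'" using a' by linarith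
      then show ?thesis using assms(5) by (simp add: algebra_simps)
    qed
    ultimately show ?thesis by (simp add: pd)
  qed
  then show "i > j \<Longrightarrow> 4 * l' + i \<le> 2 ^ d * (4 * l + i - 1)"
    and "i < j \<Longrightarrow> 2 ^ d * (4 * l + i) \<le> 4 * l' + i - 1" by auto
qed

text \<open>The order of the tops in frequency is decided by the sign of i - j alone. This is what
  makes a greedy choice of extreme tops produce disjoint sub-tiles.\<close>

lemma tile_le_order:
  assumes ij: "i \<in> {1..4}" "j \<in> {1..3}" "i \<noteq> j" and PP: "P \<noteq> P'"
    and le: "tile_le (subtile P j) (subtile P' j)" and t: "fsub t (subtile P i)" "fsub t' (subtile P' i)"
  shows "if i > j then lo t' < lo t else lo t < lo t'"
proof -
  let ?d = "nat (kk P - kk P')"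
  have k: "kk P' \<le> kk P" and n: "nn P div 2 ^ ?d = nn P'"
    and l: "(4 * ll P' + j - 1) div 2 ^ ?d = 4 * ll P + j - 1"
    using le by (auto simp: tile_le_def dsub_def fsub_def)
  have d: "?d \<ge> 1"
  proof (rule ccontr)
    assume "\<not> ?thesis"
    then have d0: "?d = 0" by simp
    with k have kk: "kk P = kk P'" by simp
    have "nn P = nn P'" using n by (simp add: d0)
    moreover have "ll P = ll P'" using l ij by (simp add: d0)
    ultimately show False using PP kk by (simp add: prod_eq_iff)
  qed
  note aux = sibling_order_aux[OF l d, of i]
  have kp: "2 powr real_of_int (kk P) = 2 powr real_of_int (kk P') * 2 ^ ?d" by (rule powr_diff_nat[OF k])
  show ?thesis
  proof (cases "i > j")
    case True
    have "4 * ll P' + i \<le> 2 ^ ?d * (4 * ll P + i - 1)" using aux(1) True ij by auto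
    then have "real (4 * ll P' + i) \<le> real (2 ^ ?d * (4 * ll P + i - 1))" by (metis of_nat_le_iff)
    then have "2 powr kk P' * real (4 * ll P' + i) \<le> 2 powr kk P' * real (2 ^ ?d * (4 * ll P + i - 1))"
      by (intro mult_left_mono) auto
    moreover have "real (4 * ll P + i - 1) = real (4 * ll P) + real i - 1"
      "real (4 * ll P' + i - 1) = real (4 * ll P') + real i - 1" using ij by (auto simp: of_nat_diff)
    ultimately have "hi (subtile P' i) \<le> lo (subtile P i)" unfolding hi_def lo_def subtile_simps kp
      by (simp add: mult.assoc add.assoc)
    then show ?thesis using fsub_lohi[OF t(1)] fsub_lohi[OF t(2)] True by auto
  next
    case False
    with ij have ilt: "i < j" by auto
    have "2 ^ ?d * (4 * ll P + i) \<le> 4 * ll P' + i - 1" using aux(2) ilt ij by auto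
    then have "real (2 ^ ?d * (4 * ll P + i)) \<le> real (4 * ll P' + i - 1)" by (metis of_nat_le_iff)
    then have "2 powr kk P' * real (2 ^ ?d * (4 * ll P + i)) \<le> 2 powr kk P' * real (4 * ll P' + i - 1)"
      by (intro mult_left_mono) auto
    moreover have "real (4 * ll P + i - 1) = real (4 * ll P) + real i - 1"
      "real (4 * ll P' + i - 1) = real (4 * ll P') + real i - 1" using ij by (auto simp: of_nat_diff)
    ultimately have "hi (subtile P i) \<le> lo (subtile P' i)" unfolding hi_def lo_def subtile_simps kp
      by (simp add: mult.assoc add.assoc)
    then show ?thesis using fsub_lohi[OF t(1)] fsub_lohi[OF t(2)] False by auto
  qed
qed

section \<open>Antichains and greedy selection of trees\<close>

definition antichain :: "nat \<Rightarrow> quartile set \<Rightarrow> bool" where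
  "antichain j D \<longleftrightarrow> (\<forall>x\<in>D. \<forall>y\<in>D. x \<noteq> y \<longrightarrow> \<not> tile_le (subtile x j) (subtile y j))"

definition itree :: "nat \<Rightarrow> tile \<Rightarrow> quartile set" where
  "itree i t = {P. tile_le (subtile P i) t}"

text \<open>Two comparable j sub-tiles in the tree would place the common top strictly to one side
  of itself.\<close>

lemma itree_antichain:
  assumes "i \<in> {1..4}" "j \<in> {1..3}" "i \<noteq> j" shows "antichain j (itree i t)"
  unfolding antichain_def
proof (intro ballI impI notI)
  fix x y assume "x \<in> itree i t" "y \<in> itree i t" "x \<noteq> y" "tile_le (subtile x j) (subtile y j)"
  then show False using tile_le_order[OF assms, of x y t t] by (auto simp: itree_def tile_le_def split: if_splits)
qed

lemma antichain_subset: "antichain j D \<Longrightarrow> D' \<subseteq> D \<Longrightarrow> antichain j D'"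
  unfolding antichain_def by blast

lemma itree_fulltree: "i \<in> {1..4} \<Longrightarrow> itree i t \<subseteq> fulltree t"
  by (auto simp: itree_def fulltree_def)

text \<open>A heavy tree with extreme top is taken; its full tree is removed, but only its i-part is
  charged, to D. If a quartile charged later were below an earlier one, it would have been removed
  with the full tree; an earlier one below a later one contradicts the extremal choice. The last
  conjunct is the invariant behind the second case: all tops concerned are heavy for the original
  collection.\<close>

lemma tree_selection_aux:
  fixes a :: "quartile \<Rightarrow> real" and lam :: real
  assumes ij: "i \<in> {1..4}" "j \<in> {1..3}" "i \<noteq> j" and "finite TT" "lam > 0" and fin: "finite PP"
  shows "\<exists>PP' T D. PP' \<subseteq> PP \<and> T \<subseteq> TT \<and> D \<subseteq> PP \<and> antichain j D
     \<and> (\<forall>t\<in>TT. (\<Sum>P\<in>PP' \<inter> itree i t. (a P)\<^sup>2) \<le> lam\<^sup>2 * len t)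
     \<and> PP - PP' \<subseteq> (\<Union>t\<in>T. fulltree t)
     \<and> lam\<^sup>2 * (\<Sum>t\<in>T. len t) \<le> (\<Sum>P\<in>D. (a P)\<^sup>2)
     \<and> (\<forall>P\<in>D. \<exists>t\<in>TT. P \<in> itree i t \<and> (\<Sum>P\<in>PP \<inter> itree i t. (a P)\<^sup>2) > lam\<^sup>2 * len t)"
  using fin
proof (induction PP rule: finite_psubset_induct)
  case (psubset PP)
  define heavy where "heavy t \<longleftrightarrow> (\<Sum>P\<in>PP \<inter> itree i t. (a P)\<^sup>2) > lam\<^sup>2 * len t" for t
  show ?case
  proof (cases "\<exists>t\<in>TT. heavy t")
    case False
    then have "\<forall>t\<in>TT. (\<Sum>P\<in>PP \<inter> itree i t. (a P)\<^sup>2) \<le> lam\<^sup>2 * len t" by (auto simp: heavy_def not_less)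
    then show ?thesis
      by (intro exI[of _ PP] exI[of _ "{}"] conjI) (auto simp: antichain_def)
  next
    case True
    \<comment> \<open>The largest lower frequency end is taken if i < j, the smallest if i > j,
      matching the two cases of \<open>tile_le_order\<close>.\<close>
    define key where "key t = (if i > j then - lo t else lo t)" for t
    define H where "H = {t\<in>TT. heavy t}"
    have H: "finite H" "H \<noteq> {}" using True \<open>finite TT\<close> by (auto simp: H_def)
    define t where "t = arg_min_on (\<lambda>t. - key t) H"
    have tH: "t \<in> H" and tmax: "\<And>s. s \<in> H \<Longrightarrow> key s \<le> key t"
      using arg_min_if_finite[OF H, of "\<lambda>t. - key t"] by (auto simp: t_def not_less)
    have tTT: "t \<in> TT" and ht: "heavy t" using tH by (auto simp: H_def)
    let ?P1 = "PP - fulltree t" and ?I = "PP \<inter> itree i t"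
    have "?I \<noteq> {}" using ht less_imp_le[OF len_pos[of t]] by (auto simp: heavy_def not_less)
        (metis mult_nonneg_nonneg not_less zero_le_power2)
    then have "?P1 \<subset> PP" using itree_fulltree[OF ij(1), of t] by auto
    from psubset.IH[OF this] obtain PP' T D where
      1: "PP' \<subseteq> ?P1" "T \<subseteq> TT" "D \<subseteq> ?P1" "antichain j D"
      "\<forall>t\<in>TT. (\<Sum>P\<in>PP' \<inter> itree i t. (a P)\<^sup>2) \<le> lam\<^sup>2 * len t"
      "?P1 - PP' \<subseteq> (\<Union>t\<in>T. fulltree t)" "lam\<^sup>2 * (\<Sum>t\<in>T. len t) \<le> (\<Sum>P\<in>D. (a P)\<^sup>2)"
      and 2: "\<forall>P\<in>D. \<exists>t'\<in>TT. P \<in> itree i t' \<and> (\<Sum>P\<in>?P1 \<inter> itree i t'. (a P)\<^sup>2) > lam\<^sup>2 * len t'"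
      by blast
    \<comment> \<open>Heavy for the remaining collection implies heavy for PP, so the tops found
      later competed in the choice of t.\<close>
    have 3: "\<exists>t'\<in>TT. P \<in> itree i t' \<and> heavy t'" if PD: "P \<in> D" for P
    proof -
      obtain t' where t': "t' \<in> TT" "P \<in> itree i t'" "(\<Sum>P\<in>?P1 \<inter> itree i t'. (a P)\<^sup>2) > lam\<^sup>2 * len t'"
        using 2 PD by blast
      have "(\<Sum>P\<in>?P1 \<inter> itree i t'. (a P)\<^sup>2) \<le> (\<Sum>P\<in>PP \<inter> itree i t'. (a P)\<^sup>2)"
        using psubset.hyps by (intro sum_mono2) auto
      then show ?thesis using t' by (auto simp: heavy_def)
    qed
    have disj: "D \<inter> ?I = {}" using 1(3) itree_fulltree[OF ij(1), of t] by auto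
    have finD: "finite D" using 1(3) psubset.hyps finite_subset by auto
    have finT: "finite T" using 1(2) \<open>finite TT\<close> finite_subset by auto
    have anti: "antichain j (D \<union> ?I)" unfolding antichain_def
    proof (intro ballI impI notI)
      fix x y assume x: "x \<in> D \<union> ?I" and y: "y \<in> D \<union> ?I" and xy: "x \<noteq> y"
        and le: "tile_le (subtile x j) (subtile y j)"
      show False
      proof (cases "x \<in> D")
        case xD: True
        show False
        proof (cases "y \<in> D")
          case True with xD le xy 1(4) show False by (auto simp: antichain_def)
        next
          case False
          then have "tile_le (subtile y i) t" using y by (auto simp: itree_def)
          then have "x \<in> fulltree t" using tile_le_fulltree[OF ij(1) _ le] ij(2) by auto
          then show False using xD 1(3) by auto
        qed
      next
        case False
        then have xt: "tile_le (subtile x i) t" using x by (auto simp: itree_def)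
        obtain t' where t': "t' \<in> H" "tile_le (subtile y i) t'"
        proof (cases "y \<in> D")
          case True
          from 3[OF this] show ?thesis using that by (auto simp: H_def itree_def)
        next
          case False
          then show ?thesis using y that tH by (auto simp: itree_def)
        qed
        have "key t' \<le> key t" using tmax t' by auto
        moreover have "key t < key t'"
          using tile_le_order[OF ij xy le, of t t'] xt t' by (auto simp: tile_le_def key_def split: if_splits)
        ultimately show False by simp
      qed
    qed
    have "lam\<^sup>2 * (\<Sum>t\<in>insert t T. len t) \<le> lam\<^sup>2 * (len t + (\<Sum>t\<in>T. len t))"
      using finT by (intro mult_left_mono) (auto simp: sum.insert_if less_imp_le)
    also have "\<dots> \<le> (\<Sum>P\<in>?I. (a P)\<^sup>2) + (\<Sum>P\<in>D. (a P)\<^sup>2)"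
      using ht 1(7) by (simp add: heavy_def algebra_simps)
    also have "\<dots> = (\<Sum>P\<in>D \<union> ?I. (a P)\<^sup>2)"
      using disj finD psubset.hyps by (simp add: sum.union_disjoint)
    finally have cost: "lam\<^sup>2 * (\<Sum>t\<in>insert t T. len t) \<le> (\<Sum>P\<in>D \<union> ?I. (a P)\<^sup>2)" .
    have 4: "\<forall>P\<in>D \<union> ?I. \<exists>t\<in>TT. P \<in> itree i t \<and> (\<Sum>P\<in>PP \<inter> itree i t. (a P)\<^sup>2) > lam\<^sup>2 * len t"
      using 3 tTT ht unfolding heavy_def by blast
    show ?thesis
      by (rule exI[of _ PP'], rule exI[of _ "insert t T"], rule exI[of _ "D \<union> ?I"])
        (use 1 cost 4 anti tTT in auto)
  qed
qed

text \<open>The usual size, with tops restricted to TT; finiteness of TT lets an extreme top exist.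
  Trees with i = j are left out because their j sub-tiles may overlap.\<close>

definition size_le :: "tile set \<Rightarrow> quartile set \<Rightarrow> nat \<Rightarrow> (quartile \<Rightarrow> real) \<Rightarrow> real \<Rightarrow> bool" where
  "size_le TT PP j a S \<longleftrightarrow>
     (\<forall>i\<in>{1..4} - {j}. \<forall>t\<in>TT. (\<Sum>P\<in>PP \<inter> itree i t. (a P)\<^sup>2) \<le> S\<^sup>2 * len t)"

text \<open>The energy is measured on disjoint j sub-tiles; for Walsh coefficients this is what
  Bessel's inequality bounds.\<close>

definition energy_le :: "quartile set \<Rightarrow> nat \<Rightarrow> (quartile \<Rightarrow> real) \<Rightarrow> real \<Rightarrow> bool" where
  "energy_le PP j a E \<longleftrightarrow> (\<forall>D\<subseteq>PP. antichain j D \<longrightarrow> (\<Sum>P\<in>D. (a P)\<^sup>2) \<le> E\<^sup>2)"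

lemma size_le_subset: "size_le TT PP j a S \<Longrightarrow> PP' \<subseteq> PP \<Longrightarrow> finite PP \<Longrightarrow> size_le TT PP' j a S"
  unfolding size_le_def
  by (meson Int_mono finite_Int order_refl order_trans sum_mono2 zero_le_power2)

lemma energy_le_subset: "energy_le PP j a S \<Longrightarrow> PP' \<subseteq> PP \<Longrightarrow> energy_le PP' j a S"
  unfolding energy_le_def by auto

section \<open>Tree selection\<close>

lemma sum_mult_le_sqrt:
  fixes a b :: "'a \<Rightarrow> real"
  assumes "\<And>x. x \<in> A \<Longrightarrow> a x \<ge> 0" "\<And>x. x \<in> A \<Longrightarrow> b x \<ge> 0"
    and "(\<Sum>x\<in>A. (a x)\<^sup>2) \<le> X\<^sup>2" "(\<Sum>x\<in>A. (b x)\<^sup>2) \<le> Y\<^sup>2" "X \<ge> 0" "Y \<ge> 0"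
  shows "(\<Sum>x\<in>A. a x * b x) \<le> X * Y"
proof -
  have "(\<Sum>x\<in>A. \<bar>a x\<bar> * \<bar>b x\<bar>) \<le> L2_set a A * L2_set b A" by (rule L2_set_mult_ineq)
  also have "\<dots> \<le> X * Y" unfolding L2_set_def using assms
    by (intro mult_mono) (auto intro: real_le_lsqrt sum_nonneg)
  finally have "(\<Sum>x\<in>A. \<bar>a x\<bar> * \<bar>b x\<bar>) \<le> X * Y" .
  moreover have "(\<Sum>x\<in>A. \<bar>a x\<bar> * \<bar>b x\<bar>) = (\<Sum>x\<in>A. a x * b x)"
    using assms(1,2) by (intro sum.cong) auto
  ultimately show ?thesis by simp
qed

text \<open>The factor |I_P|^(-1/2) of the forms.\<close>

definition wt :: "quartile \<Rightarrow> real" where "wt P = 2 powr (real_of_int (kk P) / 2)"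

lemma wt_pos [simp]: "wt P > 0" by (simp add: wt_def)

lemma wt_sq: "(wt P)\<^sup>2 = 1 / len P"
  by (simp add: wt_def len_def powr_minus power2_eq_square powr_add[symmetric] field_simps)

lemma size_le_single:
  assumes s: "size_le TT PP j a S" and "finite PP" "P \<in> PP" "S \<ge> 0" "a P \<ge> 0" "j \<in> {1..3}"
    and TT: "\<And>i. i \<in> {1..4} \<Longrightarrow> subtile P i \<in> TT"
  shows "a P * wt P \<le> S"
proof -
  \<comment> \<open>Since j <= 3, the fourth sub-tile of P itself is always the top of a tree that
    counts for j.\<close>
  define i :: nat where "i = 4"
  have i: "i \<in> {1..4} - {j}" using assms(6) by (auto simp: i_def)
  have "(a P)\<^sup>2 \<le> (\<Sum>P\<in>PP \<inter> itree i (subtile P i). (a P)\<^sup>2)"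
    using assms(2,3) by (intro member_le_sum) (auto simp: itree_def)
  also have "\<dots> \<le> S\<^sup>2 * len (subtile P i)"
  proof -
    have "i \<in> {1..4}" using i by simp
    then have "subtile P i \<in> TT" by (rule TT)
    then show ?thesis by (rule s[unfolded size_le_def, rule_format, OF i])
  qed
  finally have "(a P * wt P)\<^sup>2 \<le> S\<^sup>2" by (simp add: power_mult_distrib wt_sq field_simps)
  then show ?thesis using assms(4) by (rule power2_le_imp_le)
qed

text \<open>The coefficient whose index may be i is bounded tile by tile. The other two are lacunary
  on the tree and are summed by Cauchy-Schwarz, each giving a factor
  \<open>sqrt (len t)\<close>.\<close>

lemma lacunary_tree_estimate:
  assumes fin: "finite PP" and i: "i \<in> {1..4}" and j: "j \<in> {1..3}" "j2 \<in> {1..4} - {i}" "j3 \<in> {1..4} - {i}"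
    and t: "t \<in> TT" and TT: "\<And>P i. P \<in> PP \<Longrightarrow> i \<in> {1..4} \<Longrightarrow> subtile P i \<in> TT"
    and nn: "\<And>P. a P \<ge> 0" "\<And>P. b P \<ge> 0" "\<And>P. c P \<ge> 0" "A \<ge> 0" "B \<ge> 0" "C \<ge> 0"
    and s: "size_le TT PP j a A" "size_le TT PP j2 b B" "size_le TT PP j3 c C"
  shows "(\<Sum>P\<in>PP \<inter> itree i t. wt P * a P * b P * c P) \<le> len t * (A * B * C)"
proof -
  have i2: "i \<in> {1..4} - {j2}" and i3: "i \<in> {1..4} - {j3}" using i j by blast+
  have "(\<Sum>P\<in>PP \<inter> itree i t. wt P * a P * b P * c P) \<le> (\<Sum>P\<in>PP \<inter> itree i t. A * (b P * c P))"
  proof (rule sum_mono)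
    fix P assume P: "P \<in> PP \<inter> itree i t"
    have "a P * wt P \<le> A" by (rule size_le_single[OF s(1) fin _ nn(4) nn(1) j(1) TT]) (use P in auto)
    then have "a P * wt P * (b P * c P) \<le> A * (b P * c P)" using nn by (intro mult_right_mono) auto
    then show "wt P * a P * b P * c P \<le> A * (b P * c P)" by (simp add: mult_ac)
  qed
  also have "(\<Sum>P\<in>PP \<inter> itree i t. A * (b P * c P)) = A * (\<Sum>P\<in>PP \<inter> itree i t. b P * c P)" by (simp add: sum_distrib_left)
  also have "\<dots> \<le> A * ((B * sqrt (len t)) * (C * sqrt (len t)))"
  proof (intro mult_left_mono sum_mult_le_sqrt)
    show "(\<Sum>P\<in>PP \<inter> itree i t. (b P)\<^sup>2) \<le> (B * sqrt (len t))\<^sup>2"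
      using s(2)[unfolded size_le_def, rule_format, OF i2 t] by (simp add: power_mult_distrib less_imp_le)
    show "(\<Sum>P\<in>PP \<inter> itree i t. (c P)\<^sup>2) \<le> (C * sqrt (len t))\<^sup>2"
      using s(3)[unfolded size_le_def, rule_format, OF i3 t] by (simp add: power_mult_distrib less_imp_le)
  qed (use nn in \<open>auto simp: less_imp_le\<close>)
  also have "\<dots> = len t * (A * B * C)"
    using real_sqrt_pow2[OF less_imp_le[OF len_pos[of t]]] by (simp add: power2_eq_square mult_ac)
  finally show ?thesis .
qed

lemma fulltree_Un: "fulltree t = itree 1 t \<union> itree 2 t \<union> itree 3 t \<union> itree 4 t"
proof -
  have "{1..4} = {1::nat,2,3,4}" by auto
  then show ?thesis by (auto simp: fulltree_def itree_def)
qed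

text \<open>On the i-th of the four parts of the tree only coefficient i can fail to be lacunary;
  for i = 4 all three are lacunary.\<close>

lemma tree_estimate:
  fixes a :: "nat \<Rightarrow> quartile \<Rightarrow> real"
  assumes fin: "finite PP" and t: "t \<in> TT" and TT: "\<And>P i. P \<in> PP \<Longrightarrow> i \<in> {1..4} \<Longrightarrow> subtile P i \<in> TT"
    and nn: "\<And>j P. a j P \<ge> 0" "\<And>j. S j \<ge> 0"
    and s: "\<And>j. j \<in> {1..3} \<Longrightarrow> size_le TT PP j (a j) (S j)"
  shows "(\<Sum>P\<in>PP \<inter> fulltree t. wt P * a 1 P * a 2 P * a 3 P) \<le> 4 * len t * (S 1 * S 2 * S 3)"
proof -
  let ?f = "\<lambda>P. wt P * a 1 P * a 2 P * a 3 P"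
  have s': "size_le TT PP 1 (a 1) (S 1)" "size_le TT PP 2 (a 2) (S 2)" "size_le TT PP 3 (a 3) (S 3)"
    using s by auto
  have f0: "?f P \<ge> 0" for P using nn by (auto simp: less_imp_le)
  have un: "sum ?f (A \<union> B) \<le> sum ?f A + sum ?f B" if "finite A" "finite B" for A B
    using that f0 by (subst sum.union_inter[symmetric]) (auto intro: sum_nonneg)
  have 1: "sum ?f (PP \<inter> itree 1 t) \<le> len t * (S 1 * S 2 * S 3)"
    by (rule lacunary_tree_estimate[OF fin _ _ _ _ t TT _ _ _ _ _ _ s'(1,2,3)]) (use nn in auto)
  have 4: "sum ?f (PP \<inter> itree 4 t) \<le> len t * (S 1 * S 2 * S 3)"
    by (rule lacunary_tree_estimate[OF fin _ _ _ _ t TT _ _ _ _ _ _ s'(1,2,3)]) (use nn in auto)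
  have 2: "(\<Sum>P\<in>PP \<inter> itree 2 t. wt P * a 2 P * a 1 P * a 3 P) \<le> len t * (S 2 * S 1 * S 3)"
    by (rule lacunary_tree_estimate[OF fin _ _ _ _ t TT _ _ _ _ _ _ s'(2,1,3)]) (use nn in auto)
  have 3: "(\<Sum>P\<in>PP \<inter> itree 3 t. wt P * a 3 P * a 1 P * a 2 P) \<le> len t * (S 3 * S 1 * S 2)"
    by (rule lacunary_tree_estimate[OF fin _ _ _ _ t TT _ _ _ _ _ _ s'(3,1,2)]) (use nn in auto)
  have e2: "(\<Sum>P\<in>PP \<inter> itree 2 t. wt P * a 2 P * a 1 P * a 3 P) = sum ?f (PP \<inter> itree 2 t)"
    by (intro sum.cong) (auto simp: mult_ac)
  have e3: "(\<Sum>P\<in>PP \<inter> itree 3 t. wt P * a 3 P * a 1 P * a 2 P) = sum ?f (PP \<inter> itree 3 t)"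
    by (intro sum.cong) (auto simp: mult_ac)
  have "sum ?f (PP \<inter> fulltree t) = sum ?f (((PP \<inter> itree 1 t \<union> PP \<inter> itree 2 t) \<union> PP \<inter> itree 3 t) \<union> PP \<inter> itree 4 t)"
    by (simp add: fulltree_Un Int_Un_distrib)
  also have "\<dots> \<le> ((sum ?f (PP \<inter> itree 1 t) + sum ?f (PP \<inter> itree 2 t)) + sum ?f (PP \<inter> itree 3 t)) + sum ?f (PP \<inter> itree 4 t)"
    by (intro un[THEN order_trans] add_mono order_refl) (use fin in auto)
  also have "\<dots> \<le> 4 * len t * (S 1 * S 2 * S 3)"
    using 1 2 3 4 unfolding e2 e3 by (simp add: mult_ac)
  finally show ?thesis .
qed

lemma forest_estimate:
  fixes a :: "nat \<Rightarrow> quartile \<Rightarrow> real"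
  assumes fin: "finite PP" and TT: "\<And>P i. P \<in> PP \<Longrightarrow> i \<in> {1..4} \<Longrightarrow> subtile P i \<in> TT"
    and nn: "\<And>j P. a j P \<ge> 0" "\<And>j. S j \<ge> 0"
    and s: "\<And>j. j \<in> {1..3} \<Longrightarrow> size_le TT PP j (a j) (S j)"
    and T: "T \<subseteq> TT" "finite T" "PP' \<subseteq> PP" "PP' \<subseteq> (\<Union>t\<in>T. fulltree t)"
  shows "(\<Sum>P\<in>PP'. wt P * a 1 P * a 2 P * a 3 P) \<le> 4 * (\<Sum>t\<in>T. len t) * (S 1 * S 2 * S 3)"
proof -
  let ?f = "\<lambda>P. wt P * a 1 P * a 2 P * a 3 P"
  have f0: "?f P \<ge> 0" for P using nn by (auto simp: less_imp_le)
  have "sum ?f PP' \<le> sum ?f (\<Union>t\<in>T. PP \<inter> fulltree t)"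
    using T fin f0 by (intro sum_mono2) auto
  also have "\<dots> \<le> (\<Sum>t\<in>T. sum ?f (PP \<inter> fulltree t))"
    using T(2)
  proof (induction T rule: finite_induct)
    case (insert t T)
    have "sum ?f (\<Union>t\<in>insert t T. PP \<inter> fulltree t) \<le> sum ?f (PP \<inter> fulltree t) + sum ?f (\<Union>t\<in>T. PP \<inter> fulltree t)"
      using fin f0 insert.hyps by (simp, subst sum.union_inter[symmetric]) (auto intro: sum_nonneg)
    then show ?case using insert by simp
  qed simp
  also have "\<dots> \<le> (\<Sum>t\<in>T. 4 * len t * (S 1 * S 2 * S 3))"
    using T by (intro sum_mono tree_estimate[OF fin _ TT nn s]) auto
  finally show ?thesis by (simp add: sum_distrib_left sum_distrib_right mult_ac)
qed

text \<open>The threshold is normalized by the energy, which makes the total length of the tops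
  independent of the coefficients.\<close>

lemma tree_selection:
  assumes "i \<in> {1..4}" "j \<in> {1..3}" "i \<noteq> j" "finite TT" "E > 0" "x > 0" "finite PP"
    and e: "energy_le PP j a E"
  shows "\<exists>PP' T. PP' \<subseteq> PP \<and> T \<subseteq> TT \<and> PP - PP' \<subseteq> (\<Union>t\<in>T. fulltree t) \<and> (\<Sum>t\<in>T. len t) \<le> 1 / x\<^sup>2
     \<and> (\<forall>t\<in>TT. (\<Sum>P\<in>PP' \<inter> itree i t. (a P)\<^sup>2) \<le> (x * E)\<^sup>2 * len t)"
proof -
  have "x * E > 0" using assms by simp
  from tree_selection_aux[OF assms(1-4) this \<open>finite PP\<close>, of a] obtain PP' T D where
    1: "PP' \<subseteq> PP" "T \<subseteq> TT" "D \<subseteq> PP" "antichain j D"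
    "\<forall>t\<in>TT. (\<Sum>P\<in>PP' \<inter> itree i t. (a P)\<^sup>2) \<le> (x * E)\<^sup>2 * len t"
     "PP - PP' \<subseteq> (\<Union>t\<in>T. fulltree t)" "(x * E)\<^sup>2 * (\<Sum>t\<in>T. len t) \<le> (\<Sum>P\<in>D. (a P)\<^sup>2)" by blast
  have "(x * E)\<^sup>2 * (\<Sum>t\<in>T. len t) \<le> E\<^sup>2" using e[unfolded energy_le_def, rule_format, OF 1(3,4)] 1(7) by linarith
  then have "(\<Sum>t\<in>T. len t) \<le> 1 / x\<^sup>2" using assms(5,6) by (simp add: field_simps power_mult_distrib)
  then show ?thesis using 1(1,2,5,6) by (intro exI[of _ PP'] exI[of _ T]) auto
qed

lemma tree_selection_list:
  fixes a :: "nat \<Rightarrow> quartile \<Rightarrow> real"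
  assumes "finite TT" "\<And>j. E j > 0" "x > 0" "finite PP"
    and e: "\<And>j. j \<in> {1..3} \<Longrightarrow> energy_le PP j (a j) (E j)"
    and ps: "\<And>i j. (i,j) \<in> set ps \<Longrightarrow> i \<in> {1..4} \<and> j \<in> {1..3} \<and> i \<noteq> j"
  shows "\<exists>PP' T. PP' \<subseteq> PP \<and> T \<subseteq> TT \<and> PP - PP' \<subseteq> (\<Union>t\<in>T. fulltree t) \<and> (\<Sum>t\<in>T. len t) \<le> length ps / x\<^sup>2
     \<and> (\<forall>(i,j)\<in>set ps. \<forall>t\<in>TT. (\<Sum>P\<in>PP' \<inter> itree i t. (a j P)\<^sup>2) \<le> (x * E j)\<^sup>2 * len t)"
  using ps
proof (induction ps)
  case Nil
  show ?case by (rule exI[of _ PP], rule exI[of _ "{}"]) auto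
next
  case (Cons ij ps)
  obtain i j where ij: "ij = (i,j)" by (cases ij)
  have "i \<in> {1..4} \<and> j \<in> {1..3} \<and> i \<noteq> j" if "(i,j) \<in> set ps" for i j
    using Cons.prems[of i j] that by simp
  from Cons.IH[OF this] obtain PP' T where
     1: "PP' \<subseteq> PP" "T \<subseteq> TT" "PP - PP' \<subseteq> (\<Union>t\<in>T. fulltree t)" "(\<Sum>t\<in>T. len t) \<le> length ps / x\<^sup>2"
     "\<forall>(i,j)\<in>set ps. \<forall>t\<in>TT. (\<Sum>P\<in>PP' \<inter> itree i t. (a j P)\<^sup>2) \<le> (x * E j)\<^sup>2 * len t"
    by auto
  have ij': "i \<in> {1..4}" "j \<in> {1..3}" "i \<noteq> j" using Cons.prems[of i j] ij by auto
  have fP: "finite PP'" using 1 assms finite_subset by blast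
  have e': "energy_le PP' j (a j) (E j)" using energy_le_subset[OF e 1(1)] ij' by blast
  from tree_selection[OF ij' assms(1,2,3) fP e'] obtain PP'' T' where
    2: "PP'' \<subseteq> PP'" "T' \<subseteq> TT" "PP' - PP'' \<subseteq> (\<Union>t\<in>T'. fulltree t)" "(\<Sum>t\<in>T'. len t) \<le> 1 / x\<^sup>2"
     "\<forall>t\<in>TT. (\<Sum>P\<in>PP'' \<inter> itree i t. (a j P)\<^sup>2) \<le> (x * E j)\<^sup>2 * len t" by blast
  have fT: "finite T" "finite T'" using 1 2 assms finite_subset by blast+
  have "(\<Sum>t\<in>T \<union> T'. len t) \<le> (\<Sum>t\<in>T. len t) + (\<Sum>t\<in>T'. len t)"
    using fT by (subst sum.union_inter[symmetric]) (auto intro!: sum_nonneg simp: less_imp_le)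
  also have "\<dots> \<le> length (ij # ps) / x\<^sup>2" using 1(4) 2(4) by (simp add: add_divide_distrib)
  finally have cost: "(\<Sum>t\<in>T \<union> T'. len t) \<le> length (ij # ps) / x\<^sup>2" .
  have old: "(\<Sum>P\<in>PP'' \<inter> itree i t. (a j P)\<^sup>2) \<le> (x * E j)\<^sup>2 * len t" if "(i,j) \<in> set ps" "t \<in> TT" for i j t
  proof -
    have "(\<Sum>P\<in>PP'' \<inter> itree i t. (a j P)\<^sup>2) \<le> (\<Sum>P\<in>PP' \<inter> itree i t. (a j P)\<^sup>2)"
      using fP 2(1) by (intro sum_mono2) auto
    also have "\<dots> \<le> (x * E j)\<^sup>2 * len t" using 1(5) that by auto
    finally show ?thesis .
  qed
  have sz: "\<forall>(i,j)\<in>set (ij # ps). \<forall>t\<in>TT. (\<Sum>P\<in>PP'' \<inter> itree i t. (a j P)\<^sup>2) \<le> (x * E j)\<^sup>2 * len t"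
    using old 2(5) ij by auto
  show ?case
    by (rule exI[of _ PP''], rule exI[of _ "T \<union> T'"]) (use 1 2 cost sz in auto)
qed

lemma tree_selection_all:
  fixes a :: "nat \<Rightarrow> quartile \<Rightarrow> real"
  assumes "finite TT" "\<And>j. E j > 0" "x > 0" "finite PP"
    and e: "\<And>j. j \<in> {1..3} \<Longrightarrow> energy_le PP j (a j) (E j)"
  shows "\<exists>PP' T. PP' \<subseteq> PP \<and> T \<subseteq> TT \<and> PP - PP' \<subseteq> (\<Union>t\<in>T. fulltree t) \<and> (\<Sum>t\<in>T. len t) \<le> 9 / x\<^sup>2
     \<and> (\<forall>j\<in>{1..3}. size_le TT PP' j (a j) (x * E j))"
proof -
  \<comment> \<open>For each of the three j there are three i in {1..4} - {j}, and each selection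
    costs 1 / x^2; hence the 9 of the conclusion.\<close>
  define ps :: "(nat \<times> nat) list" where "ps = [(2,1),(3,1),(4,1),(1,2),(3,2),(4,2),(1,3),(2,3),(4,3)]"
  have ps: "(i,j) \<in> set ps \<longleftrightarrow> j \<in> {1..3} \<and> i \<in> {1..4} - {j}" for i j
  proof -
    have "{1..3} = {1,2,3::nat}" "{1..4} = {1,2,3,4::nat}" by auto
    then show ?thesis unfolding ps_def by auto
  qed
  have l: "length ps = 9" by (simp add: ps_def)
  have ps': "i \<in> {1..4} \<and> j \<in> {1..3} \<and> i \<noteq> j" if "(i,j) \<in> set ps" for i j
    using that unfolding ps by auto
  have ex: "\<exists>PP' T. PP' \<subseteq> PP \<and> T \<subseteq> TT \<and> PP - PP' \<subseteq> (\<Union>t\<in>T. fulltree t)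
     \<and> (\<Sum>t\<in>T. len t) \<le> length ps / x\<^sup>2
     \<and> (\<forall>(i,j)\<in>set ps. \<forall>t\<in>TT. (\<Sum>P\<in>PP' \<inter> itree i t. (a j P)\<^sup>2) \<le> (x * E j)\<^sup>2 * len t)"
    by (rule tree_selection_list[where a=a, OF assms(1-4)]) (fact e, fact ps')
  obtain PP' T where 1: "PP' \<subseteq> PP" "T \<subseteq> TT" "PP - PP' \<subseteq> (\<Union>t\<in>T. fulltree t)"
     "(\<Sum>t\<in>T. len t) \<le> length ps / x\<^sup>2"
     "\<forall>(i,j)\<in>set ps. \<forall>t\<in>TT. (\<Sum>P\<in>PP' \<inter> itree i t. (a j P)\<^sup>2) \<le> (x * E j)\<^sup>2 * len t"
    using ex by (elim exE conjE) (rule that)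
  have "size_le TT PP' j (a j) (x * E j)" if "j \<in> {1..3}" for j
    unfolding size_le_def
  proof (intro ballI)
    fix i t assume it: "i \<in> {1..4} - {j}" "t \<in> TT"
    have "(i,j) \<in> set ps" unfolding ps using it that by simp
    from bspec[OF 1(5) this] it(2) show "(\<Sum>P\<in>PP' \<inter> itree i t. (a j P)\<^sup>2) \<le> (x * E j)\<^sup>2 * len t"
      by simp
  qed
  then show ?thesis using 1(1-4) l by (intro exI[of _ PP'] exI[of _ T]) auto
qed

section \<open>The size--energy estimate\<close>

lemma prod_three: "(\<Prod>j\<in>{1..3::nat}. f j) = f 1 * f 2 * (f 3 :: 'a :: comm_monoid_mult)"
proof -
  have "{1..3} = {1,2,3::nat}" by auto
  then show ?thesis by (simp add: mult.assoc)
qed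

lemma min_le_powr_mult:
  fixes s y k :: real assumes "0 < s" "0 < y" "0 \<le> k" "k \<le> 1"
  shows "min s y \<le> s powr k * y powr (1 - k)"
proof -
  have "min s y = min s y powr k * min s y powr (1 - k)"
    using assms by (simp add: powr_add[symmetric])
  also have "\<dots> \<le> s powr k * y powr (1 - k)"
    using assms by (intro mult_mono powr_mono2) auto
  finally show ?thesis .
qed

lemma size_le_min:
  "size_le TT PP j a (min S S') \<longleftrightarrow> size_le TT PP j a S \<and> size_le TT PP j a S'" if "S \<ge> 0" "S' \<ge> 0"
proof (cases "S \<le> S'")
  case True
  then have "size_le TT PP j a S \<Longrightarrow> size_le TT PP j a S'"
    unfolding size_le_def using that
    by (meson len_pos less_imp_le mult_right_mono order_trans power_mono)
  then show ?thesis using True by (auto simp: min_def)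
next
  case False
  then have "size_le TT PP j a S' \<Longrightarrow> size_le TT PP j a S"
    unfolding size_le_def using that
    by (meson len_pos less_imp_le mult_right_mono order_trans power_mono linear)
  then show ?thesis using False by (auto simp: min_def)
qed

locale trilinear_sum =
  fixes TT :: "tile set" and a :: "nat \<Rightarrow> quartile \<Rightarrow> real" and S E :: "nat \<Rightarrow> real"
  assumes finTT: "finite TT" and nn: "\<And>j P. a j P \<ge> 0" and S: "\<And>j. S j > 0" and E: "\<And>j. E j > 0"
begin

text \<open>\<open>G x\<close> bounds the product of the three sizes at level x. The trees removed
  on the way to level x / 2 have total length O(1 / x^2), so this level contributes a multiple of G
  x / x^2.\<close>

definition G :: "real \<Rightarrow> real" where "G x = (\<Prod>j\<in>{1..3}. min (S j) (x * E j))"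

abbreviation form :: "quartile set \<Rightarrow> real" where
  "form PP \<equiv> (\<Sum>P\<in>PP. wt P * a 1 P * a 2 P * a 3 P)"

lemma level_step:
  assumes "finite PP" "\<And>P i. P \<in> PP \<Longrightarrow> i \<in> {1..4} \<Longrightarrow> subtile P i \<in> TT" "x > 0"
    and "\<And>j. j \<in> {1..3} \<Longrightarrow> energy_le PP j (a j) (E j)"
    and s: "\<And>j. j \<in> {1..3} \<Longrightarrow> size_le TT PP j (a j) (min (S j) (2 * x * E j))"
  shows "\<exists>PP'\<subseteq>PP. (\<forall>j\<in>{1..3}. size_le TT PP' j (a j) (min (S j) (x * E j))) \<and>
    form PP \<le> form PP' + 144 * (G (2 * x) / (2 * x)\<^sup>2)"
proof -
  obtain PP' T where 1: "PP' \<subseteq> PP" "T \<subseteq> TT" "PP - PP' \<subseteq> (\<Union>t\<in>T. fulltree t)" "(\<Sum>t\<in>T. len t) \<le> 9 / x\<^sup>2"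
     "\<forall>j\<in>{1..3}. size_le TT PP' j (a j) (x * E j)"
    using tree_selection_all[where a=a and E=E and TT=TT and PP=PP and x=x] finTT E assms by blast
  have finT: "finite T" using 1 finTT finite_subset by blast
  let ?S = "\<lambda>j. min (S j) (2 * x * E j)"
  have S0: "?S j \<ge> 0" for j using S E \<open>x > 0\<close> by (simp add: less_imp_le)
  have "form (PP - PP') \<le> 4 * (\<Sum>t\<in>T. len t) * (?S 1 * ?S 2 * ?S 3)"
    by (rule forest_estimate[where a=a and S="?S", OF \<open>finite PP\<close> assms(2) nn S0 s 1(2) finT _ 1(3)]) auto
  also have "\<dots> \<le> 4 * (9 / x\<^sup>2) * (?S 1 * ?S 2 * ?S 3)"
    using 1(4) S0 by (intro mult_right_mono mult_left_mono mult_nonneg_nonneg) auto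
  \<comment> \<open>The 144 consists of 4 from the forest estimate, 9 from the selections and 4 from
    the passage between x and 2 x in the denominator.\<close>
  also have "\<dots> = 144 * (G (2 * x) / (2 * x)\<^sup>2)"
    unfolding G_def prod_three by (simp add: field_simps)
  finally have A: "form (PP - PP') \<le> 144 * (G (2 * x) / (2 * x)\<^sup>2)" .
  have B: "form PP = form PP' + form (PP - PP')"
    using 1(1) assms(1) by (subst sum.subset_diff[OF 1(1)]) auto
  have "\<forall>j\<in>{1..3}. size_le TT PP' j (a j) (min (S j) (x * E j))"
  proof
    fix j :: nat assume j: "j \<in> {1..3}"
    have "size_le TT PP j (a j) (S j)" using s[OF j] size_le_min[of "S j" "2 * x * E j"] S E assms(3)
      by (simp add: less_imp_le)
    then show "size_le TT PP' j (a j) (min (S j) (x * E j))"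
      using size_le_subset[OF _ 1(1) assms(1)] 1(5) j size_le_min[of "S j" "x * E j"] S E assms(3)
      by (simp add: less_imp_le)
  qed
  then show ?thesis using A B 1(1) by (intro exI[of _ PP']) auto
qed

lemma level_iterate:
  assumes "finite PP" "\<And>P i. P \<in> PP \<Longrightarrow> i \<in> {1..4} \<Longrightarrow> subtile P i \<in> TT" "x > 0"
    and e: "\<And>j. j \<in> {1..3} \<Longrightarrow> energy_le PP j (a j) (E j)"
    and s: "\<And>j. j \<in> {1..3} \<Longrightarrow> size_le TT PP j (a j) (min (S j) (x * E j))"
  shows "\<exists>PP'\<subseteq>PP. (\<forall>j\<in>{1..3}. size_le TT PP' j (a j) (min (S j) (x / 2 ^ N * E j))) \<and>
    form PP \<le> form PP' + 144 * (\<Sum>p<N. G (x / 2 ^ p) / (x / 2 ^ p)\<^sup>2)"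
proof (induction N)
  case 0
  show ?case using s by (intro exI[of _ PP]) auto
next
  case (Suc N)
  then obtain PP' where 1: "PP' \<subseteq> PP" "\<forall>j\<in>{1..3}. size_le TT PP' j (a j) (min (S j) (x / 2 ^ N * E j))"
    "form PP \<le> form PP' + 144 * (\<Sum>p<N. G (x / 2 ^ p) / (x / 2 ^ p)\<^sup>2)" by (elim exE conjE) (rule that)
  define y where "y = x / 2 ^ Suc N"
  have y: "2 * y = x / 2 ^ N" "y > 0" using assms(3) by (auto simp: y_def)
  have "\<exists>PP''\<subseteq>PP'. (\<forall>j\<in>{1..3}. size_le TT PP'' j (a j) (min (S j) (y * E j))) \<and>
    form PP' \<le> form PP'' + 144 * (G (2 * y) / (2 * y)\<^sup>2)"
  proof (rule level_step)
    show "finite PP'" using 1 assms finite_subset by blast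
    show "subtile P i \<in> TT" if "P \<in> PP'" "i \<in> {1..4}" for P i using 1(1) that by (intro assms(2)) auto
    show "energy_le PP' j (a j) (E j)" if "j \<in> {1..3}" for j by (rule energy_le_subset[OF e[OF that] 1(1)])
    show "size_le TT PP' j (a j) (min (S j) (2 * y * E j))" if "j \<in> {1..3}" for j
      unfolding y using 1(2) that by simp
  qed (rule y)
  then obtain PP'' where 2: "PP'' \<subseteq> PP'" "\<forall>j\<in>{1..3}. size_le TT PP'' j (a j) (min (S j) (y * E j))"
    "form PP' \<le> form PP'' + 144 * (G (2 * y) / (2 * y)\<^sup>2)" by (elim exE conjE) (rule that)
  show ?case
  proof (intro exI[of _ PP''] conjI)
    show "PP'' \<subseteq> PP" using 1 2 by simp
    show "\<forall>j\<in>{1..3}. size_le TT PP'' j (a j) (min (S j) (x / 2 ^ Suc N * E j))"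
      using 2(2) unfolding y_def .
    show "form PP \<le> form PP'' + 144 * (\<Sum>p<Suc N. G (x / 2 ^ p) / (x / 2 ^ p)\<^sup>2)"
      using 1(3) 2(3) unfolding y by simp
  qed
qed

text \<open>A crude estimate of the remainder: it depends on the collection, but carries y^3 and
  vanishes as the number of levels tends to infinity.\<close>

lemma form_le_of_sizes:
  assumes "finite PP" "\<And>P i. P \<in> PP \<Longrightarrow> i \<in> {1..4} \<Longrightarrow> subtile P i \<in> TT" "PP' \<subseteq> PP" "y \<ge> 0"
    and s: "\<And>j. j \<in> {1..3} \<Longrightarrow> size_le TT PP' j (a j) (y * E j)"
  shows "form PP' \<le> y ^ 3 * ((\<Sum>P\<in>PP. len P) * (E 1 * E 2 * E 3))"
proof -
  have E0: "y * E j \<ge> 0" for j using E assms(4) by (simp add: less_imp_le)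
  have fin: "finite PP'" using assms finite_subset by blast
  have one: "a j P \<le> y * E j / wt P" if "P \<in> PP'" "j \<in> {1..3}" for P j
  proof -
    have "a j P * wt P \<le> y * E j"
      by (rule size_le_single[OF s[OF that(2)] fin that(1) E0 nn that(2) assms(2)]) (use assms(3) that in blast)
    then show ?thesis by (simp add: field_simps)
  qed
  have "form PP' \<le> (\<Sum>P\<in>PP'. len P * (y ^ 3 * (E 1 * E 2 * E 3)))"
  proof (rule sum_mono)
    fix P assume P: "P \<in> PP'"
    have "wt P * a 1 P * a 2 P * a 3 P \<le> wt P * (y * E 1 / wt P) * (y * E 2 / wt P) * (y * E 3 / wt P)"
      by (intro mult_mono one P mult_nonneg_nonneg divide_nonneg_pos) (auto simp: nn assms(4) less_imp_le[OF E] less_imp_le[OF wt_pos])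
    also have "\<dots> = (1 / (wt P)\<^sup>2) * (y ^ 3 * (E 1 * E 2 * E 3))"
      by (simp add: field_simps power2_eq_square power3_eq_cube)
    also have "\<dots> = len P * (y ^ 3 * (E 1 * E 2 * E 3))" by (simp add: wt_sq)
    finally show "wt P * a 1 P * a 2 P * a 3 P \<le> len P * (y ^ 3 * (E 1 * E 2 * E 3))" .
  qed
  also have "\<dots> \<le> (\<Sum>P\<in>PP. len P * (y ^ 3 * (E 1 * E 2 * E 3)))"
    using assms E by (intro sum_mono2) (auto simp: less_imp_le)
  also have "\<dots> = y ^ 3 * ((\<Sum>P\<in>PP. len P) * (E 1 * E 2 * E 3))"
    unfolding sum_distrib_right[symmetric] by (simp only: mult_ac)
  finally show ?thesis .
qed

lemma G_bound:
  assumes "x > 0" and \<kappa>: "\<And>j. j \<in> {1..3} \<Longrightarrow> 0 \<le> \<kappa> j \<and> \<kappa> j \<le> 1"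
  shows "G x / x\<^sup>2 \<le> (\<Prod>j\<in>{1..3}. S j powr \<kappa> j * E j powr (1 - \<kappa> j)) * x powr (1 - (\<Sum>j\<in>{1..3}. \<kappa> j))"
proof -
  have "G x \<le> (\<Prod>j\<in>{1..3}. S j powr \<kappa> j * (x * E j) powr (1 - \<kappa> j))"
    unfolding G_def using assms S E
    by (intro prod_mono conjI min_le_powr_mult) (auto simp: less_imp_le)
  also have "\<dots> = (\<Prod>j\<in>{1..3}. S j powr \<kappa> j * E j powr (1 - \<kappa> j)) * (\<Prod>j\<in>{1..3}. x powr (1 - \<kappa> j))"
    using assms(1) E by (simp add: prod.distrib[symmetric] powr_mult less_imp_le mult_ac)
  also have "(\<Prod>j\<in>{1..3}. x powr (1 - \<kappa> j)) = x powr (3 - (\<Sum>j\<in>{1..3}. \<kappa> j))"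
    using assms(1) by (simp add: powr_sum[symmetric] sum_subtractf)
  finally have "G x / x\<^sup>2 \<le> (\<Prod>j\<in>{1..3}. S j powr \<kappa> j * E j powr (1 - \<kappa> j)) * x powr (3 - (\<Sum>j\<in>{1..3}. \<kappa> j)) / x\<^sup>2"
    by (intro divide_right_mono) auto
  also have "x powr (3 - (\<Sum>j\<in>{1..3}. \<kappa> j)) = x powr (1 - (\<Sum>j\<in>{1..3}. \<kappa> j)) * x\<^sup>2"
    using assms(1) by (simp add: powr_add[symmetric] flip: powr_numeral)
  finally show ?thesis using assms(1) by simp
qed

text \<open>With exponents of sum 1 all levels have the same bound, and the sum over levels would
  diverge. Shifting the exponent of j0 by v gains the power -v of x, measured from the balanced
  level S j0 / E j0.\<close>

lemma G_bound_shift: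
  assumes "x > 0" and \<theta>: "\<And>j. j \<in> {1..3} \<Longrightarrow> 0 \<le> \<theta> j \<and> \<theta> j \<le> 1" "(\<Sum>j\<in>{1..3}. \<theta> j) = 1"
    and j0: "j0 \<in> {1..3}" "0 \<le> \<theta> j0 + v" "\<theta> j0 + v \<le> 1"
  shows "G x / x\<^sup>2 \<le> (\<Prod>j\<in>{1..3}. S j powr \<theta> j * E j powr (1 - \<theta> j)) * (S j0 / E j0 / x) powr v"
proof -
  define \<kappa> where "\<kappa> j = \<theta> j + (if j = j0 then v else 0)" for j
  have s: "(\<Sum>j\<in>{1..3}. \<kappa> j) = 1 + v" unfolding \<kappa>_def using \<theta>(2) j0(1) by (simp add: sum.distrib)
  have "S j powr \<kappa> j * E j powr (1 - \<kappa> j) = S j powr \<theta> j * E j powr (1 - \<theta> j) * (if j = j0 then (S j / E j) powr v else 1)" for j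
  proof (cases "j = j0")
    case True
    have "S j powr \<kappa> j * E j powr (1 - \<kappa> j) = S j powr (\<theta> j + v) * E j powr ((1 - \<theta> j) - v)"
      using True by (simp add: \<kappa>_def algebra_simps)
    also have "\<dots> = S j powr \<theta> j * E j powr (1 - \<theta> j) * (S j / E j) powr v"
      using S[of j] E[of j] by (simp add: powr_add powr_diff powr_divide)
    finally show ?thesis using True by simp
  qed (simp add: \<kappa>_def)
  then have "(\<Prod>j\<in>{1..3}. S j powr \<kappa> j * E j powr (1 - \<kappa> j)) =
     (\<Prod>j\<in>{1..3}. S j powr \<theta> j * E j powr (1 - \<theta> j)) * (S j0 / E j0) powr v"
    using j0(1) by (simp add: prod.distrib)
  moreover have "x powr (1 - (\<Sum>j\<in>{1..3}. \<kappa> j)) = 1 / x powr v"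
    using s by (simp add: powr_minus_divide)
  moreover have "(S j0 / E j0 / x) powr v = (S j0 / E j0) powr v / x powr v"
    using S[of j0] E[of j0] assms(1) by (simp add: powr_divide powr_mult)
  moreover have "G x / x\<^sup>2 \<le> (\<Prod>j\<in>{1..3}. S j powr \<kappa> j * E j powr (1 - \<kappa> j)) * x powr (1 - (\<Sum>j\<in>{1..3}. \<kappa> j))"
    by (rule G_bound[OF assms(1)]) (use \<theta>(1) j0 in \<open>auto simp: \<kappa>_def\<close>)
  ultimately show ?thesis by simp
qed

end

lemma two_sided_geometric:
  fixes q :: real assumes "0 < q" "q < 1"
  shows "(\<Sum>p<N. q ^ nat \<bar>int p - int M\<bar>) \<le> 2 / (1 - q)"
proof -
  have geo: "(\<Sum>p<K. q ^ p) \<le> 1 / (1 - q)" for K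
  proof -
    have "(\<Sum>p<K. q ^ p) = (1 - q ^ K) / (1 - q)" using assms by (simp add: sum_gp_strict)
    also have "\<dots> \<le> 1 / (1 - q)" using assms by (intro divide_right_mono) auto
    finally show ?thesis .
  qed
  have "(\<Sum>p<N. q ^ nat \<bar>int p - int M\<bar>) \<le> (\<Sum>p<M+N. q ^ nat \<bar>int p - int M\<bar>)"
    using assms by (intro sum_mono2) auto
  also have "\<dots> = (\<Sum>p<M. q ^ nat \<bar>int p - int M\<bar>) + (\<Sum>p\<in>{M..<M+N}. q ^ nat \<bar>int p - int M\<bar>)"
    by (subst sum.union_disjoint[symmetric]) (auto intro!: sum.cong)
  also have "(\<Sum>p<M. q ^ nat \<bar>int p - int M\<bar>) = (\<Sum>p<M. q ^ Suc p)"
    by (rule sum.reindex_bij_witness[of _ "\<lambda>p. M - 1 - p" "\<lambda>p. M - 1 - p"]) (auto simp: power_Suc[symmetric] simp del: power_Suc intro!: arg_cong[where f="\<lambda>k. q ^ k"])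
  also have "\<dots> \<le> (\<Sum>p<M. q ^ p)" using assms by (intro sum_mono) (auto intro: mult_left_le_one_le)
  also have "\<dots> \<le> 1 / (1 - q)" by (rule geo)
  also have "(\<Sum>p\<in>{M..<M+N}. q ^ nat \<bar>int p - int M\<bar>) = (\<Sum>p<N. q ^ p)"
    by (rule sum.reindex_bij_witness[of _ "\<lambda>p. M + p" "\<lambda>p. p - M"]) (auto intro!: arg_cong[where f="\<lambda>k. q ^ k"])
  also have "\<dots> \<le> 1 / (1 - q)" by (rule geo)
  finally show ?thesis by simp
qed

text \<open>144 for each level, times 2 / (1 - q) for the two-sided geometric series of ratio q =
  2^(-\<delta>).\<close>

definition bht_const :: "real \<Rightarrow> real" where
  "bht_const \<delta> = 288 / (1 - 2 powr (- \<delta>))"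

text \<open>The levels decay geometrically on both sides of S j0 / E j0, where j0 is an index whose
  exponent is away from 0 and 1. Another exponent may vanish, which admits a coefficient of unknown
  size.\<close>

theorem trilinear_size_energy:
  fixes a :: "nat \<Rightarrow> quartile \<Rightarrow> real" and S E \<theta> :: "nat \<Rightarrow> real"
  assumes finTT: "finite TT" and nn: "\<And>j P. a j P \<ge> 0" and S: "\<And>j. S j > 0" and E: "\<And>j. E j > 0"
    and fin: "finite PP" and TT: "\<And>P i. P \<in> PP \<Longrightarrow> i \<in> {1..4} \<Longrightarrow> subtile P i \<in> TT"
    and e: "\<And>j. j \<in> {1..3} \<Longrightarrow> energy_le PP j (a j) (E j)"
    and s: "\<And>j. j \<in> {1..3} \<Longrightarrow> size_le TT PP j (a j) (S j)"
    and \<theta>: "\<And>j. j \<in> {1..3} \<Longrightarrow> 0 \<le> \<theta> j \<and> \<theta> j \<le> 1" "(\<Sum>j\<in>{1..3}. \<theta> j) = 1"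
    and j0: "j0 \<in> {1..3}" "0 < \<delta>" "\<delta> \<le> \<theta> j0" "\<theta> j0 \<le> 1 - \<delta>"
  shows "(\<Sum>P\<in>PP. wt P * a 1 P * a 2 P * a 3 P) \<le>
    bht_const \<delta> * (\<Prod>j\<in>{1..3}. S j powr \<theta> j * E j powr (1 - \<theta> j))"
proof -
  interpret trilinear_sum TT a S E by unfold_locales (fact finTT nn S E)+
  define r where "r = S j0 / E j0"
  have r: "r > 0" using S E by (simp add: r_def)
  define q where "q = 2 powr (- \<delta>)"
  have q: "0 < q" "q < 1" using j0(2) by (auto simp: q_def powr_less_one)
  define B where "B = (\<Prod>j\<in>{1..3}. S j powr \<theta> j * E j powr (1 - \<theta> j))"
  have B0: "B \<ge> 0" unfolding B_def by (intro prod_nonneg) auto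
  \<comment> \<open>The iteration starts so high that the size bounds at its first level hold before
    anything is removed.\<close>
  obtain M :: nat where M: "\<forall>j\<in>{1..3}. S j \<le> r * 2 ^ M * E j"
  proof -
    obtain M :: nat where M: "2 ^ M > (\<Sum>j\<in>{1..3}. S j / (r * E j))"
      using real_arch_pow[of 2] by auto
    have "S j \<le> r * 2 ^ M * E j" if "j \<in> {1..3}" for j
    proof -
      have "S j / (r * E j) \<le> (\<Sum>j\<in>{1..3}. S j / (r * E j))"
        using that S E r by (intro member_le_sum) (auto simp: less_imp_le)
      then have "S j / (r * E j) \<le> 2 ^ M" using M by simp
      then show ?thesis using r E[of j] by (simp add: field_simps)
    qed
    then show ?thesis by (intro that) blast
  qed
  define x where "x = r * 2 ^ M"
  have x: "x > 0" using r by (simp add: x_def)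
  have s0: "size_le TT PP j (a j) (min (S j) (x * E j))" if "j \<in> {1..3}" for j
    using M that s[OF that] by (simp add: x_def min_absorb1)
  have summand: "G (x / 2 ^ p) / (x / 2 ^ p)\<^sup>2 \<le> B * q ^ nat \<bar>int p - int M\<bar>" for p
  proof -
    have xp: "x / 2 ^ p > 0" using x by simp
    \<comment> \<open>Levels above r are damped by raising the exponent of j0, levels below r by
      lowering it.\<close>
    define v where "v = (if p \<le> M then \<delta> else - \<delta>)"
    have "G (x / 2 ^ p) / (x / 2 ^ p)\<^sup>2 \<le> B * (S j0 / E j0 / (x / 2 ^ p)) powr v"
      unfolding B_def by (rule G_bound_shift[OF xp \<theta> j0(1)]) (use j0 in \<open>auto simp: v_def\<close>)
    also have "S j0 / E j0 / (x / 2 ^ p) = 2 powr (real p - real M)"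
      using r by (simp add: r_def[symmetric] x_def powr_diff powr_realpow)
    also have "(2 powr (real p - real M)) powr v = q ^ nat \<bar>int p - int M\<bar>"
      using q by (auto simp: powr_powr v_def q_def powr_realpow[symmetric] of_nat_diff nat_diff_distrib abs_if algebra_simps)
    finally show ?thesis .
  qed
  have main: "form PP \<le> (x / 2 ^ N) ^ 3 * ((\<Sum>P\<in>PP. len P) * (E 1 * E 2 * E 3)) + 144 * (B * (2 / (1 - q)))" for N
  proof -
    obtain PP' where 1: "PP' \<subseteq> PP" "\<forall>j\<in>{1..3}. size_le TT PP' j (a j) (min (S j) (x / 2 ^ N * E j))"
      "form PP \<le> form PP' + 144 * (\<Sum>p<N. G (x / 2 ^ p) / (x / 2 ^ p)\<^sup>2)"
    proof -
      have "\<exists>PP'\<subseteq>PP. (\<forall>j\<in>{1..3}. size_le TT PP' j (a j) (min (S j) (x / 2 ^ N * E j))) \<and>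
        form PP \<le> form PP' + 144 * (\<Sum>p<N. G (x / 2 ^ p) / (x / 2 ^ p)\<^sup>2)"
        by (rule level_iterate[OF fin TT x e s0])
      then show ?thesis by (elim exE conjE) (rule that)
    qed
    have "size_le TT PP' j (a j) (x / 2 ^ N * E j)" if "j \<in> {1..3}" for j
    proof -
      have "S j \<ge> 0" "x / 2 ^ N * E j \<ge> 0" using S E x by (simp_all add: less_imp_le)
      from size_le_min[OF this] bspec[OF 1(2) that] show ?thesis by blast
    qed
    then have "form PP' \<le> (x / 2 ^ N) ^ 3 * ((\<Sum>P\<in>PP. len P) * (E 1 * E 2 * E 3))"
      using x by (intro form_le_of_sizes[OF fin TT 1(1)]) auto
    moreover have "(\<Sum>p<N. G (x / 2 ^ p) / (x / 2 ^ p)\<^sup>2) \<le> B * (2 / (1 - q))"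
    proof -
      have "(\<Sum>p<N. G (x / 2 ^ p) / (x / 2 ^ p)\<^sup>2) \<le> (\<Sum>p<N. B * q ^ nat \<bar>int p - int M\<bar>)"
        by (intro sum_mono summand)
      also have "\<dots> \<le> B * (2 / (1 - q))" unfolding sum_distrib_left[symmetric]
        by (intro mult_left_mono two_sided_geometric q B0)
      finally show ?thesis .
    qed
    ultimately show ?thesis using 1(3) by linarith
  qed
  define R K where "R = (\<Sum>P\<in>PP. len P) * (E 1 * E 2 * E 3)" and "K = 144 * (B * (2 / (1 - q)))"
  have "(\<lambda>N. x * (1 / 2) ^ N) \<longlonglongrightarrow> x * 0"
    by (intro tendsto_mult tendsto_const LIMSEQ_realpow_zero) auto
  moreover have "x * (1 / 2) ^ N = x / 2 ^ N" for N by (simp add: power_divide)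
  ultimately have "(\<lambda>N. x / 2 ^ N) \<longlonglongrightarrow> 0" by (simp only: mult_zero_right)
  then have "(\<lambda>N. (x / 2 ^ N) ^ 3 * R + K) \<longlonglongrightarrow> 0 ^ 3 * R + K"
    by (intro tendsto_add tendsto_mult tendsto_power tendsto_const)
  then have "form PP \<le> 0 ^ 3 * R + K"
    by (rule LIMSEQ_le_const) (use main in \<open>simp only: R_def K_def, blast\<close>)
  then have "form PP \<le> K" by simp
  also have "K = bht_const \<delta> * B" by (simp add: bht_const_def q_def K_def)
  finally show ?thesis unfolding B_def .
qed

section \<open>Carleson estimates on lacunary trees\<close>

text \<open>Among the tiles strictly below \<open>(k, n, l)\<close> two are maximal, one over each
  half of the time interval. The inductions over scales run through this alternative.\<close>

lemma tile_le_children: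
  "tile_le p (k, n, l) \<longleftrightarrow> p = (k, n, l) \<or> tile_le p (k + 1, 2 * n, l div 2) \<or> tile_le p (k + 1, 2 * n + 1, l div 2)"
proof (cases "kk p \<le> k")
  case True
  then show ?thesis by (cases p) (auto simp: tile_le_def dsub_def fsub_def)
next
  case False
  define d where "d = nat (kk p - (k + 1))"
  have d: "nat (kk p - k) = Suc d" using False by (simp add: d_def)
  have n: "nn p div 2 ^ Suc d = n \<longleftrightarrow> nn p div 2 ^ d = 2 * n \<or> nn p div 2 ^ d = 2 * n + 1"
  proof -
    have "nn p div 2 ^ Suc d = nn p div 2 ^ d div 2" by (simp add: zdiv_zmult2_eq[symmetric] mult.commute)
    then show ?thesis by linarith
  qed
  have l: "l div 2 ^ Suc d = l div 2 div 2 ^ d" by (simp add: div_mult2_eq)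
  show ?thesis using False unfolding tile_le_def dsub_def fsub_def
    by (simp only: fst_conv snd_conv d d_def[symmetric] n l) auto
qed

lemma tile_le_children_disjoint:
  "tile_le p (k, 2 * n, l) \<Longrightarrow> \<not> tile_le p (k, 2 * n + 1, l')"
  unfolding tile_le_def dsub_def by auto

text \<open>The tiles with frequencies l and \<open>sib l\<close> over one interval cover the same
  part of the phase plane as the two tiles with frequency l div 2 over its halves;
  \<open>parallelogram\<close> is the resulting identity of squared coefficients.\<close>

definition sib :: "nat \<Rightarrow> nat" where "sib l = (if even l then l + 1 else l - 1)"

lemma sib_div2 [simp]: "sib l div 2 = l div 2"
  by (auto simp: sib_def elim: oddE evenE)

lemma sib_neq: "sib l \<noteq> l" unfolding sib_def by presburger

lemma minus_one_power_sib: "(-1) ^ sib l = - ((-1::'a::comm_ring_1) ^ l)"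
  by (auto simp: sib_def elim: oddE)

lemma sib_eqI: "l div 2 = m div 2 \<Longrightarrow> l \<noteq> m \<Longrightarrow> l = sib m"
  unfolding sib_def by presburger

lemma parallelogram:
  fixes x y :: complex
  shows "(norm ((x + (-1) ^ l * y) / sqrt 2))\<^sup>2 + (norm ((x + (-1) ^ sib l * y) / sqrt 2))\<^sup>2 = (norm x)\<^sup>2 + (norm y)\<^sup>2"
proof -
  have "(norm (x + y))\<^sup>2 + (norm (x - y))\<^sup>2 = 2 * (norm x)\<^sup>2 + 2 * (norm y)\<^sup>2"
    unfolding cmod_power2 by (simp add: power2_eq_square algebra_simps)
  then have "(norm ((x + y) / sqrt 2))\<^sup>2 + (norm ((x - y) / sqrt 2))\<^sup>2 = (norm x)\<^sup>2 + (norm y)\<^sup>2"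
    by (simp add: norm_divide power_divide)
  then show ?thesis by (cases "even l") (auto simp: minus_one_power_sib)
qed

text \<open>Induction from fine to coarse scales: the tiles of the tree and the tile at its top (together
  with the sibling of the top, unless the chosen sub-tiles are siblings) stay disjoint, so the
  parallelogram law pays for the new tile at each scale; \<open>\<delta>\<close> is the part of \<open>c\<close> that is
  generated at the scale itself.\<close>

lemma lacunary_carleson:
  fixes c \<delta> :: "tile \<Rightarrow> complex" and M :: "int \<Rightarrow> int \<Rightarrow> real" and lam :: real
  assumes fin: "finite PP" and ij: "i \<in> {1..4}" "j \<in> {1..4}" "i \<noteq> j"
    and rec: "\<And>k n l. c (k, n, l) = (c (k + 1, 2 * n, l div 2) + (-1) ^ l * c (k + 1, 2 * n + 1, l div 2)) / sqrt 2 + \<delta> (k, n, l)"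
    and \<delta>0: "\<And>R. \<delta> R \<noteq> 0 \<Longrightarrow> fsub tp R"
    and cM: "\<And>k n l. norm (c (k, n, l)) \<le> 2 powr (real_of_int k / 2) * M k n"
    and MM: "\<And>k n l. M (k + 1) (2 * n) + M (k + 1) (2 * n + 1) + 2 powr (- real_of_int k / 2) * norm (\<delta> (k, n, l)) \<le> M k n"
    and M0: "\<And>k n. M k n \<ge> 0"
    and lam: "lam \<ge> 0"
    and good: "\<And>Q k n. Q \<in> PP \<Longrightarrow> Q \<in> itree i tp \<Longrightarrow> kk tp \<le> k \<Longrightarrow> dsub (kk Q) (nn Q) k n \<Longrightarrow> M k n \<le> lam * 2 powr (- real_of_int k)"
  shows "(\<Sum>Q\<in>PP \<inter> itree i tp. (norm (c (subtile Q j)))\<^sup>2) \<le> 4 * lam * M (kk tp) (nn tp)"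
proof -
  \<comment> \<open>Sub-tiles i and j are siblings exactly if w = 0. Then the sibling of the top is
    the j sub-tile itself, which enters the sum and must not be carried along a second time.\<close>
  define w :: real where "w = (if (i - 1) div 2 = (j - 1) div 2 then 0 else 1)"
  have w01: "0 \<le> w" "w \<le> 1" by (auto simp: w_def)
  define V where "V t = (\<Sum>Q\<in>PP \<inter> itree i t. (norm (c (subtile Q j)))\<^sup>2)" for t
  define e where "e k n l = (norm (c (k, n, l)))\<^sup>2 + w * (norm (c (k, n, sib l)))\<^sup>2" for k n l
  have e_bound: "e k n l \<le> 4 * lam * M k n" if "M k n \<le> 2 * lam * 2 powr (- real_of_int k)" for k n l
  proof -
    have sq: "(norm (c (k, n, m)))\<^sup>2 \<le> 2 * lam * M k n" for m
    proof -
      have "(norm (c (k, n, m)))\<^sup>2 \<le> (2 powr (real_of_int k / 2) * M k n)\<^sup>2"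
        by (intro power_mono cM) auto
      also have "\<dots> = 2 powr (real_of_int k) * M k n * M k n"
        by (simp add: power2_eq_square powr_add[symmetric] mult_ac)
      also have "\<dots> \<le> 2 powr (real_of_int k) * M k n * (2 * lam * 2 powr (- real_of_int k))"
        using that M0 by (intro mult_left_mono) auto
      also have "\<dots> = 2 * lam * M k n" by (simp add: powr_minus field_simps)
      finally show ?thesis .
    qed
    have "w * (norm (c (k, n, sib l)))\<^sup>2 \<le> 1 * (2 * lam * M k n)"
      by (intro mult_mono w01 sq) auto
    then show ?thesis using sq[of l] by (simp add: e_def)
  qed
  \<comment> \<open>\<open>good\<close> is known only on intervals that contain a quartile of the
    tree. A half of such an interval has density at most 2 * lam even if it contains none, so the
    claim is stated with 2 * lam; the two squares in \<open>e\<close> then produce the 4.\<close>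
  have claim: "V (k, n, l) + e k n l \<le> 4 * lam * M k n"
    if "tile_le (k, n, l) tp" "\<forall>Q\<in>PP. kk Q < k + int m" "M k n \<le> 2 * lam * 2 powr (- real_of_int k)" for k n l m
    using that
  proof (induction m arbitrary: k n l)
    case 0
    have "PP \<inter> itree i (k, n, l) = {}" using 0(2) by (fastforce simp: itree_def tile_le_def dsub_def)
    then show ?case using e_bound[OF 0(3)] by (simp add: V_def)
  next
    case (Suc m)
    show ?case
    proof (cases "PP \<inter> itree i (k, n, l) = {}")
      case True
      then show ?thesis using e_bound[OF Suc.prems(3)] by (simp add: V_def)
    next
      case False
      then obtain Q0 where Q0: "Q0 \<in> PP" "tile_le (subtile Q0 i) (k, n, l)" by (auto simp: itree_def)
      have ft: "fsub tp (k, n, l)" and kt: "kk tp \<le> k" using Suc.prems(1) by (auto simp: tile_le_def fsub_def)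
      have Mk: "M k n \<le> lam * 2 powr (- real_of_int k)"
      proof (rule good[OF Q0(1) _ kt])
        show "Q0 \<in> itree i tp" using tile_le_trans[OF Q0(2) Suc.prems(1)] by (simp add: itree_def)
        show "dsub (kk Q0) (nn Q0) k n" using Q0(2) by (simp add: tile_le_def)
      qed
      define l2 where "l2 = l div 2"
      define M0' M1' where "M0' = M (k + 1) (2 * n)" and "M1' = M (k + 1) (2 * n + 1)"
      define \<beta> where "\<beta> = 2 powr (- real_of_int k / 2) * norm (\<delta> (k, n, l))"
      have MMk: "M0' + M1' + \<beta> \<le> M k n" using MM[of k n l] by (simp add: M0'_def M1'_def \<beta>_def)
      have pos: "M0' \<ge> 0" "M1' \<ge> 0" "\<beta> \<ge> 0" by (auto simp: M0'_def M1'_def \<beta>_def M0)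
      have "2 * lam * 2 powr (- real_of_int (k + 1)) = lam * 2 powr (- real_of_int k)"
        by (simp add: powr_diff powr_minus field_simps)
      then have child: "M0' \<le> 2 * lam * 2 powr (- real_of_int (k + 1))" "M1' \<le> 2 * lam * 2 powr (- real_of_int (k + 1))"
        using MMk pos Mk by linarith+
      have t0: "tile_le (k + 1, 2 * n, l2) tp" "tile_le (k + 1, 2 * n + 1, l2) tp"
        using Suc.prems(1) tile_le_children[of _ k n l] tile_le_trans tile_le_refl unfolding l2_def by blast+
      have kQ: "\<forall>Q\<in>PP. kk Q < k + 1 + int m" using Suc.prems(2) by auto
      have IH: "V (k + 1, 2 * n, l2) + e (k + 1) (2 * n) l2 \<le> 4 * lam * M0'"
        "V (k + 1, 2 * n + 1, l2) + e (k + 1) (2 * n + 1) l2 \<le> 4 * lam * M1'"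
        using Suc.IH[OF t0(1) kQ] Suc.IH[OF t0(2) kQ] child by (auto simp: M0'_def M1'_def)
      let ?T = "{Q\<in>PP. subtile Q i = (k, n, l)}"
      have split: "PP \<inter> itree i (k, n, l) = ?T \<union> (PP \<inter> itree i (k + 1, 2 * n, l2) \<union> PP \<inter> itree i (k + 1, 2 * n + 1, l2))"
        using tile_le_children[of _ k n l] by (auto simp: itree_def l2_def)
      have d1: "(PP \<inter> itree i (k + 1, 2 * n, l2)) \<inter> (PP \<inter> itree i (k + 1, 2 * n + 1, l2)) = {}"
        using tile_le_children_disjoint[of _ "k + 1" n] unfolding itree_def by blast
      have d2: "?T \<inter> (PP \<inter> itree i (k + 1, 2 * n, l2) \<union> PP \<inter> itree i (k + 1, 2 * n + 1, l2)) = {}"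
      proof -
        have "\<not> tile_le (k, n, l) (k + 1, m, l')" for m l' by (simp add: tile_le_def dsub_def)
        then show ?thesis unfolding itree_def by auto
      qed
      define X where "X = (\<Sum>Q\<in>?T. (norm (c (subtile Q j)))\<^sup>2)"
      have V: "V (k, n, l) = X + (V (k + 1, 2 * n, l2) + V (k + 1, 2 * n + 1, l2))"
        unfolding V_def X_def split using fin d1 d2 by (simp add: sum.union_disjoint)
      define c0 c1 s0 s1 where "c0 = c (k + 1, 2 * n, l2)" and "c1 = c (k + 1, 2 * n + 1, l2)"
        and "s0 = c (k + 1, 2 * n, sib l2)" and "s1 = c (k + 1, 2 * n + 1, sib l2)"
      define c' where "c' = (c0 + (-1) ^ l * c1) / sqrt 2"
      define \<delta>' where "\<delta>' = \<delta> (k, n, l)"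
      have ct: "c (k, n, l) = c' + \<delta>'" using rec[of k n l] by (simp add: c'_def c0_def c1_def l2_def \<delta>'_def)
      \<comment> \<open>At scale k only one frequency interval contains that of the top, so the
        sibling and the j sub-tile receive no source term.\<close>
      have \<delta>sib: "\<delta> (k, n, m) = 0" if "m \<noteq> l" for m
      proof (rule ccontr)
        assume "\<delta> (k, n, m) \<noteq> 0"
        then have "fsub tp (k, n, m)" by (rule \<delta>0)
        then show False using ft that by (simp add: fsub_def)
      qed
      have cs: "c (k, n, sib l) = (c0 + (-1) ^ sib l * c1) / sqrt 2"
        using rec[of k n "sib l"] \<delta>sib[OF sib_neq] by (simp add: c0_def c1_def l2_def)
      have par: "(norm c')\<^sup>2 + (norm (c (k, n, sib l)))\<^sup>2 = (norm c0)\<^sup>2 + (norm c1)\<^sup>2"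
        unfolding c'_def cs by (rule parallelogram)
      have \<delta>\<beta>: "norm \<delta>' = 2 powr (real_of_int k / 2) * \<beta>"
        by (simp add: \<beta>_def \<delta>'_def powr_minus)
      have c'M: "norm c' \<le> 2 powr (real_of_int k / 2) * (M0' + M1')"
      proof -
        have pk: "2 powr (real_of_int (k + 1) / 2) = 2 powr (real_of_int k / 2) * sqrt 2"
          by (simp add: add_divide_distrib powr_add powr_half_sqrt)
        have "norm c' \<le> (norm c0 + norm c1) / sqrt 2"
          unfolding c'_def norm_divide using norm_triangle_ineq[of c0 "(-1) ^ l * c1"]
          by (simp add: norm_mult norm_power divide_right_mono)
        also have "\<dots> \<le> (2 powr (real_of_int (k + 1) / 2) * M0' + 2 powr (real_of_int (k + 1) / 2) * M1') / sqrt 2"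
          unfolding c0_def c1_def M0'_def M1'_def by (intro divide_right_mono add_mono cM) auto
        also have "\<dots> = 2 powr (real_of_int k / 2) * (M0' + M1')"
          unfolding pk by (simp add: add_divide_distrib distrib_left)
        finally show ?thesis .
      qed
      have ct2: "(norm (c (k, n, l)))\<^sup>2 \<le> (norm c')\<^sup>2 + 4 * lam * \<beta>"
      proof -
        have "(norm (c (k, n, l)))\<^sup>2 \<le> (norm c' + norm \<delta>')\<^sup>2" unfolding ct
          by (intro power_mono norm_triangle_ineq) auto
        also have "\<dots> = (norm c')\<^sup>2 + norm \<delta>' * (2 * norm c' + norm \<delta>')" by (simp add: power2_eq_square algebra_simps)
        also have "norm \<delta>' * (2 * norm c' + norm \<delta>') \<le> norm \<delta>' * (2 * (2 powr (real_of_int k / 2) * (M0' + M1')) + norm \<delta>')"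
          using c'M by (intro mult_left_mono add_mono) auto
        also have "\<dots> = (2 powr (real_of_int k / 2))\<^sup>2 * \<beta> * (2 * (M0' + M1') + \<beta>)"
          unfolding \<delta>\<beta> by (simp add: power2_eq_square algebra_simps)
        also have "(2 powr (real_of_int k / 2))\<^sup>2 = 2 powr real_of_int k" by (simp add: power2_eq_square powr_add[symmetric])
        also have "2 powr real_of_int k * \<beta> * (2 * (M0' + M1') + \<beta>) \<le> 2 powr real_of_int k * \<beta> * (4 * (lam * 2 powr (- real_of_int k)))"
          using MMk Mk pos M0[of k n] by (intro mult_left_mono) auto
        also have "\<dots> = 4 * lam * \<beta>" by (simp add: powr_minus field_simps)
        finally show ?thesis by simp
      qed
      have X: "X \<le> (if w = 0 then (norm (c (k, n, sib l)))\<^sup>2 else (norm s0)\<^sup>2 + (norm s1)\<^sup>2)"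
      proof (cases "?T = {}")
        case True
        show ?thesis unfolding X_def True by simp
      next
        case False
        then obtain Q where Q: "Q \<in> PP" "subtile Q i = (k, n, l)" by auto
        have "Q' = Q" if "Q' \<in> ?T" for Q'
        proof -
          have "subtile Q' i = subtile Q i" using that Q(2) by simp
          moreover have "i \<ge> 1" using ij(1) by simp
          ultimately show ?thesis using subtile_inj[of i Q' Q] by simp
        qed
        then have TQ: "?T = {Q}" using Q by blast
        have XQ: "X = (norm (c (subtile Q j)))\<^sup>2" unfolding X_def TQ by simp
        define m where "m = 4 * ll Q + j - 1"
        have Qj: "subtile Q j = (k, n, m)" and l: "l = 4 * ll Q + i - 1"
          using Q(2) by (auto simp: prod_eq_iff m_def)
        have ml: "m \<noteq> l" using ij by (auto simp: m_def l)
        have m2: "m div 2 = 2 * ll Q + (j - 1) div 2" "l2 = 2 * ll Q + (i - 1) div 2"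
          using ij by (auto simp: m_def l l2_def)
        show ?thesis
        proof (cases "w = 0")
          case True
          then have "m div 2 = l div 2" using m2 by (auto simp: w_def l2_def split: if_splits)
          then have "m = sib l" using ml by (rule sib_eqI)
          then show ?thesis using True XQ Qj by simp
        next
          case False
          have "m div 2 \<noteq> l2" using False m2 by (auto simp: w_def)
          moreover have "m div 2 div 2 = l2 div 2" using m2 ij by auto
          ultimately have ms: "m div 2 = sib l2" by (intro sib_eqI) auto
          have "c (k, n, m) = (s0 + (-1) ^ m * s1) / sqrt 2"
            using rec[of k n m] \<delta>sib[OF ml] by (simp add: s0_def s1_def ms)
          then have "(norm (c (k, n, m)))\<^sup>2 \<le> (norm s0)\<^sup>2 + (norm s1)\<^sup>2"
            using parallelogram[of s0 m s1] by (metis le_add_same_cancel1 zero_le_power2)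
          then show ?thesis using False XQ Qj by simp
        qed
      qed
      \<comment> \<open>For w = 0 the new tile is the sibling of the top, and both are paid for by
        c0 and c1. For w = 1 the new tile is paid for by s0 and s1, the top and its sibling by c0
        and c1.\<close>
      have "X + e k n l \<le> e (k + 1) (2 * n) l2 + e (k + 1) (2 * n + 1) l2 + 4 * lam * \<beta>"
        using X ct2 par unfolding e_def c0_def[symmetric] c1_def[symmetric] s0_def[symmetric] s1_def[symmetric]
        by (cases "w = 0") (auto simp: w_def)
      then have "V (k, n, l) + e k n l \<le> 4 * lam * (M0' + M1' + \<beta>)"
        using IH unfolding V by (simp add: algebra_simps)
      also have "\<dots> \<le> 4 * lam * M k n" using MMk lam by (intro mult_left_mono) auto
      finally show ?thesis .
    qed
  qed
  show ?thesis
  proof (cases "PP \<inter> itree i tp = {}")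
    case True
    then show ?thesis using lam M0 by simp
  next
    case False
    then obtain Q0 where Q0: "Q0 \<in> PP" "Q0 \<in> itree i tp" by auto
    then have "dsub (kk Q0) (nn Q0) (kk tp) (nn tp)" by (simp add: itree_def tile_le_def)
    from good[OF Q0 _ this] have "M (kk tp) (nn tp) \<le> lam * 2 powr (- real_of_int (kk tp))" by simp
    then have M2: "M (kk tp) (nn tp) \<le> 2 * lam * 2 powr (- real_of_int (kk tp))"
      using lam by (smt (verit) mult_right_mono powr_ge_zero)
    define m where "m = nat (Max (kk ` PP) - kk tp) + 1"
    have "kk Q < kk tp + int m" if "Q \<in> PP" for Q
    proof -
      have "kk Q \<le> Max (kk ` PP)" using that fin by (intro Max_ge) auto
      then show ?thesis by (simp add: m_def)
    qed
    then have "V tp + e (kk tp) (nn tp) (ll tp) \<le> 4 * lam * M (kk tp) (nn tp)"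
      using claim[of "kk tp" "nn tp" "ll tp" m] M2 by simp
    moreover have "e (kk tp) (nn tp) (ll tp) \<ge> 0" using w01 by (simp add: e_def)
    ultimately show ?thesis unfolding V_def by linarith
  qed
qed

section \<open>Walsh wave packets\<close>

declare walsh.simps [simp del]

lemma walsh_0: "walsh 0 x = indicator {0..<1} x"
  by (subst walsh.simps) simp

lemma walsh_rec: "walsh l x = walsh (l div 2) (2 * x) + (-1) ^ l * walsh (l div 2) (2 * x - 1)"
proof (cases "l = 0")
  case True
  then show ?thesis by (auto simp: walsh_0 indicator_def)
next
  case False
  then show ?thesis by (subst walsh.simps) auto
qed

lemma abs_walsh_le: "\<bar>walsh l x\<bar> \<le> indicator {0..<1} x"
proof (induction l arbitrary: x rule: less_induct)
  case (less l)
  show ?case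
  proof (cases "l = 0")
    case True then show ?thesis by (simp add: walsh_0)
  next
    case False
    then have "\<bar>walsh (l div 2) (2 * x)\<bar> \<le> indicator {0..<1} (2 * x)"
      "\<bar>walsh (l div 2) (2 * x - 1)\<bar> \<le> indicator {0..<1} (2 * x - 1)"
      using less by auto
    then have "\<bar>walsh (l div 2) (2 * x)\<bar> + \<bar>walsh (l div 2) (2 * x - 1)\<bar> \<le> indicator {0..<1} x"
      by (cases "2 * x < 1") (auto simp: indicator_def split: if_splits)
    moreover have "\<bar>walsh l x\<bar> \<le> \<bar>walsh (l div 2) (2 * x)\<bar> + \<bar>walsh (l div 2) (2 * x - 1)\<bar>"
      by (subst walsh_rec) (auto intro!: abs_triangle_ineq[THEN order_trans] simp: abs_mult power_abs)
    ultimately show ?thesis by linarith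
  qed
qed

lemma walsh_measurable: "walsh l \<in> borel_measurable borel"
proof (induction l rule: less_induct)
  case (less l)
  show ?case
  proof (cases "l = 0")
    case True
    have "walsh 0 = indicator {0..<1}" by (rule ext) (rule walsh_0)
    then show ?thesis using True by simp
  next
    case False
    then have [measurable]: "walsh (l div 2) \<in> borel_measurable borel" using less by auto
    have "walsh l = (\<lambda>x. walsh (l div 2) (2 * x) + (-1) ^ l * walsh (l div 2) (2 * x - 1))"
      by (rule ext) (rule walsh_rec)
    also have "\<dots> \<in> borel_measurable borel" by measurable
    finally show ?thesis .
  qed
qed

section \<open>Dyadic intervals as sets\<close>

definition dy :: "int \<Rightarrow> int \<Rightarrow> real set" where
  "dy k n = {2 powr (- real_of_int k) * real_of_int n ..< 2 powr (- real_of_int k) * (real_of_int n + 1)}"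

lemma mem_dy: "x \<in> dy k n \<longleftrightarrow> real_of_int n \<le> 2 powr (real_of_int k) * x \<and> 2 powr (real_of_int k) * x < real_of_int n + 1"
  by (simp add: dy_def powr_minus field_simps)

lemma quartile_I_dy: "quartile_I P = dy (kk P) (nn P)"
  by (cases P) (simp add: quartile_I_def dy_def)

lemma measure_dy: "measure lebesgue (dy k n) = 2 powr (- real_of_int k)"
  by (simp add: dy_def algebra_simps)

lemma dy_sets [measurable, simp]: "dy k n \<in> sets lebesgue" "dy k n \<in> lmeasurable"
  by (auto simp: dy_def intro: bounded_set_imp_lmeasurable)

lemma dsub_iff_floor: "x \<in> dy k n \<longleftrightarrow> \<lfloor>2 powr (real_of_int k) * x\<rfloor> = n"
  by (simp add: mem_dy floor_eq_iff)

text \<open>Membership is a statement about floors, and the coarser floor is the integer quotient of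
  the finer one.\<close>

lemma dy_mem_dsub:
  assumes "x \<in> dy k n" "k' \<le> k"
  shows "x \<in> dy k' n' \<longleftrightarrow> dsub k n k' n'"
proof -
  let ?d = "nat (k - k')"
  have "2 powr (real_of_int k') * x = (2 powr (real_of_int k) * x) / real_of_int (2 ^ ?d)"
    using powr_diff_nat[OF assms(2)] by simp
  then have "\<lfloor>2 powr (real_of_int k') * x\<rfloor> = \<lfloor>2 powr (real_of_int k) * x\<rfloor> div 2 ^ ?d"
    by (simp only: floor_divide_real_eq_div zero_le_power zero_le_numeral)
  then show ?thesis using assms by (auto simp: dsub_iff_floor dsub_def)
qed

lemma dsub_dy: "dsub k n k' n' \<Longrightarrow> dy k n \<subseteq> dy k' n'"
  using dy_mem_dsub by (auto simp: dsub_def)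

lemma dy_disjoint: "k' \<le> k \<Longrightarrow> \<not> dsub k n k' n' \<Longrightarrow> dy k n \<inter> dy k' n' = {}"
  using dy_mem_dsub by auto

lemma dy_split: "dy k n = dy (k + 1) (2 * n) \<union> dy (k + 1) (2 * n + 1)" "dy (k + 1) (2 * n) \<inter> dy (k + 1) (2 * n + 1) = {}"
proof -
  have x: "2 powr real_of_int (k + 1) * x = 2 * (2 powr real_of_int k * x)" for x :: real
    by (simp add: powr_add)
  show "dy k n = dy (k + 1) (2 * n) \<union> dy (k + 1) (2 * n + 1)"
    by (intro set_eqI) (simp only: Un_iff mem_dy x, linarith)
  show "dy (k + 1) (2 * n) \<inter> dy (k + 1) (2 * n + 1) = {}"
    by (rule equals0I) (simp only: Int_iff mem_dy x, linarith)
qed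

lemma phi_eq: "phi R x = 2 powr (real_of_int (kk R) / 2) * walsh (ll R) (2 powr (real_of_int (kk R)) * x - real_of_int (nn R))"
  by (cases R) (simp add: phi_def)

lemma phi_rec:
  "phi (k, n, l) x = (phi (k + 1, 2 * n, l div 2) x + (-1) ^ l * phi (k + 1, 2 * n + 1, l div 2) x) / sqrt 2"
proof -
  have a: "2 powr (real_of_int (k + 1) / 2) = 2 powr (real_of_int k / 2) * sqrt 2"
    by (simp add: add_divide_distrib powr_add powr_half_sqrt)
  have b: "2 * (2 powr real_of_int k * x - real_of_int n) = 2 powr real_of_int (k + 1) * x - real_of_int (2 * n)"
    "2 * (2 powr real_of_int k * x - real_of_int n) - 1 = 2 powr real_of_int (k + 1) * x - real_of_int (2 * n + 1)"
    by (simp_all add: powr_add algebra_simps)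
  show ?thesis unfolding phi_eq fst_conv snd_conv a
    by (subst walsh_rec) (simp only: b, simp add: field_simps)
qed

lemma abs_phi_le: "\<bar>phi R x\<bar> \<le> 2 powr (real_of_int (kk R) / 2) * indicator (dy (kk R) (nn R)) x"
proof -
  have "\<bar>walsh (ll R) (2 powr (real_of_int (kk R)) * x - real_of_int (nn R))\<bar> \<le> indicator {0..<1} (2 powr (real_of_int (kk R)) * x - real_of_int (nn R))"
    by (rule abs_walsh_le)
  also have "\<dots> = indicator (dy (kk R) (nn R)) x" by (auto simp: indicator_def mem_dy)
  finally show ?thesis unfolding phi_eq by (simp add: abs_mult mult_left_mono)
qed

lemma phi_measurable [measurable]: "phi R \<in> borel_measurable lebesgue"
proof -
  have [measurable]: "walsh (ll R) \<in> borel_measurable borel" by (rule walsh_measurable)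
  have "phi R = (\<lambda>x. 2 powr (real_of_int (kk R) / 2) * walsh (ll R) (2 powr (real_of_int (kk R)) * x - real_of_int (nn R)))"
    by (rule ext) (rule phi_eq)
  also have "\<dots> \<in> borel_measurable borel" by measurable
  finally have "phi R \<in> borel_measurable lborel" by simp
  then show ?thesis by (rule measurable_completion)
qed

text \<open>\<open>winner\<close> is an integral with default value 0, so its additivity depends on
  integrable products; square integrability of both arguments ensures this.\<close>

definition sqint :: "(real \<Rightarrow> complex) \<Rightarrow> bool" where
  "sqint f \<longleftrightarrow> f \<in> borel_measurable lebesgue \<and> integrable lebesgue (\<lambda>x. (norm (f x))\<^sup>2)"

lemma sqint_bounded:
  assumes "f \<in> borel_measurable lebesgue" "A \<in> lmeasurable" "\<And>x. norm (f x) \<le> C * indicator A x"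
  shows "sqint f"
  unfolding sqint_def
proof
  have "integrable lebesgue (\<lambda>x. C\<^sup>2 * indicator A x :: real)"
    using assms(2) by (intro integrable_mult_right) (auto simp: fmeasurable_def)
  then show "integrable lebesgue (\<lambda>x. (norm (f x))\<^sup>2)"
  proof (rule Bochner_Integration.integrable_bound)
    show "AE x in lebesgue. norm ((norm (f x))\<^sup>2) \<le> norm (C\<^sup>2 * indicator A x :: real)"
    proof (rule AE_I2)
      fix x
      have "(norm (f x))\<^sup>2 \<le> (C * indicator A x)\<^sup>2" by (intro power_mono assms) auto
      then show "norm ((norm (f x))\<^sup>2) \<le> norm (C\<^sup>2 * indicator A x :: real)"
        by (auto simp: indicator_def)
    qed
  qed (use assms(1) in measurable)
qed (fact assms(1))

lemma sqint_integrable: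
  assumes "sqint f" "sqint g" shows "integrable lebesgue (\<lambda>x. f x * cnj (g x))"
proof -
  have [measurable]: "cnj \<in> borel_measurable borel"
    by (intro borel_measurable_continuous_onI continuous_intros)
  have [measurable]: "f \<in> borel_measurable lebesgue" "g \<in> borel_measurable lebesgue" using assms by (auto simp: sqint_def)
  have "integrable lebesgue (\<lambda>x. (norm (f x))\<^sup>2 + (norm (g x))\<^sup>2)" using assms by (auto simp: sqint_def)
  then show ?thesis
  proof (rule Bochner_Integration.integrable_bound)
    show "AE x in lebesgue. norm (f x * cnj (g x)) \<le> norm ((norm (f x))\<^sup>2 + (norm (g x))\<^sup>2)"
    proof (rule AE_I2)
      fix x
      have "2 * (norm (f x) * norm (g x)) \<le> (norm (f x))\<^sup>2 + (norm (g x))\<^sup>2"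
        using sum_squares_bound[of "norm (f x)" "norm (g x)"] by simp
      moreover have "0 \<le> norm (f x) * norm (g x)" by simp
      ultimately show "norm (f x * cnj (g x)) \<le> norm ((norm (f x))\<^sup>2 + (norm (g x))\<^sup>2)"
        unfolding norm_mult complex_mod_cnj real_norm_def by linarith
    qed
  qed measurable
qed

lemma sqint_0 [simp]: "sqint (\<lambda>x. 0)" by (simp add: sqint_def)

lemma sqint_mult: "sqint f \<Longrightarrow> sqint (\<lambda>x. c * f x)"
  by (auto simp: sqint_def norm_mult power_mult_distrib)

lemma sqint_add:
  assumes "sqint f" "sqint g" shows "sqint (\<lambda>x. f x + g x)"
proof -
  have [measurable]: "f \<in> borel_measurable lebesgue" "g \<in> borel_measurable lebesgue" using assms by (auto simp: sqint_def)
  have "integrable lebesgue (\<lambda>x. 2 * (norm (f x))\<^sup>2 + 2 * (norm (g x))\<^sup>2)" using assms by (auto simp: sqint_def)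
  then have "integrable lebesgue (\<lambda>x. (norm (f x + g x))\<^sup>2)"
  proof (rule Bochner_Integration.integrable_bound)
    show "AE x in lebesgue. norm ((norm (f x + g x))\<^sup>2) \<le> norm (2 * (norm (f x))\<^sup>2 + 2 * (norm (g x))\<^sup>2)"
    proof (rule AE_I2)
      fix x
      have "(norm (f x + g x))\<^sup>2 \<le> (norm (f x) + norm (g x))\<^sup>2" by (intro power_mono norm_triangle_ineq) auto
      then show "norm ((norm (f x + g x))\<^sup>2) \<le> norm (2 * (norm (f x))\<^sup>2 + 2 * (norm (g x))\<^sup>2)"
        using sum_squares_bound[of "norm (f x)" "norm (g x)"] by (simp add: power2_sum)
    qed
  qed measurable
  then show ?thesis by (simp add: sqint_def)
qed

lemma sqint_sum: "(\<And>i. i \<in> A \<Longrightarrow> sqint (f i)) \<Longrightarrow> sqint (\<lambda>x. \<Sum>i\<in>A. f i x)"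
  by (induction A rule: infinite_finite_induct) (auto intro: sqint_add)

section \<open>Inner products of wave packets and Bessel's inequality\<close>

definition ph :: "tile \<Rightarrow> real \<Rightarrow> complex" where "ph R = (\<lambda>x. complex_of_real (phi R x))"

lemma sqint_ph [simp]: "sqint (ph R)"
proof (rule sqint_bounded)
  show "ph R \<in> borel_measurable lebesgue" unfolding ph_def by measurable
  show "norm (ph R x) \<le> 2 powr (real_of_int (kk R) / 2) * indicator (dy (kk R) (nn R)) x" for x
    using abs_phi_le[of R x] by (simp add: ph_def)
qed simp

lemma winner_mult_left: "winner (\<lambda>x. c * f x) g = c * winner f g"
  by (simp add: winner_def mult.assoc)

lemma winner_mult_right: "winner f (\<lambda>x. c * g x) = cnj c * winner f g"
proof -
  have "winner f (\<lambda>x. c * g x) = (LINT x|lebesgue. cnj c * (f x * cnj (g x)))"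
    by (simp add: winner_def mult_ac)
  then show ?thesis by (simp add: winner_def)
qed

lemma winner_add_left: "sqint f \<Longrightarrow> sqint f' \<Longrightarrow> sqint g \<Longrightarrow> winner (\<lambda>x. f x + f' x) g = winner f g + winner f' g"
  by (simp add: winner_def distrib_right sqint_integrable)

lemma winner_add_right: "sqint f \<Longrightarrow> sqint g \<Longrightarrow> sqint g' \<Longrightarrow> winner f (\<lambda>x. g x + g' x) = winner f g + winner f g'"
  by (simp add: winner_def distrib_left sqint_integrable)

lemma winner_sum_left:
  "(\<And>i. i \<in> A \<Longrightarrow> sqint (f i)) \<Longrightarrow> sqint g \<Longrightarrow> winner (\<lambda>x. \<Sum>i\<in>A. f i x) g = (\<Sum>i\<in>A. winner (f i) g)"
proof (induction A rule: infinite_finite_induct)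
  case (insert x F)
  then show ?case by (simp add: winner_add_left sqint_sum)
qed (simp_all add: winner_def)

lemma winner_cnj: "winner g f = cnj (winner f g)"
proof -
  have "cnj (winner f g) = (LINT x|lebesgue. cnj (f x * cnj (g x)))"
    unfolding winner_def by (rule Bochner_Integration.integral_cnj[symmetric])
  then show ?thesis by (simp add: winner_def mult.commute)
qed

lemma winner_sum_right:
  assumes "\<And>i. i \<in> A \<Longrightarrow> sqint (g i)" "sqint f"
  shows "winner f (\<lambda>x. \<Sum>i\<in>A. g i x) = (\<Sum>i\<in>A. winner f (g i))"
proof -
  have "winner f (\<lambda>x. \<Sum>i\<in>A. g i x) = cnj (winner (\<lambda>x. \<Sum>i\<in>A. g i x) f)" by (rule winner_cnj)
  also have "winner (\<lambda>x. \<Sum>i\<in>A. g i x) f = (\<Sum>i\<in>A. winner (g i) f)"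
    by (rule winner_sum_left) (use assms in auto)
  also have "cnj \<dots> = (\<Sum>i\<in>A. cnj (winner (g i) f))" by (rule cnj_sum)
  also have "\<dots> = (\<Sum>i\<in>A. winner f (g i))" by (intro sum.cong refl) (rule winner_cnj[symmetric])
  finally show ?thesis .
qed

lemma winner_self: "winner f f = complex_of_real (LINT x|lebesgue. (norm (f x))\<^sup>2)"
proof -
  have "winner f f = (LINT x|lebesgue. complex_of_real ((norm (f x))\<^sup>2))"
    unfolding winner_def complex_norm_square ..
  then show ?thesis by (simp only: integral_complex_of_real)
qed

lemma ph_rec: "ph (k, n, l) x = (1 / sqrt 2) * ph (k + 1, 2 * n, l div 2) x + ((-1) ^ l / sqrt 2) * ph (k + 1, 2 * n + 1, l div 2) x"
  unfolding ph_def by (subst phi_rec) (simp add: field_simps)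

lemma winner_rec:
  assumes "sqint f"
  shows "winner f (ph (k, n, l)) = (winner f (ph (k + 1, 2 * n, l div 2)) + (-1) ^ l * winner f (ph (k + 1, 2 * n + 1, l div 2))) / sqrt 2"
proof -
  have "ph (k, n, l) = (\<lambda>x. (1 / sqrt 2) * ph (k + 1, 2 * n, l div 2) x + ((-1) ^ l / sqrt 2) * ph (k + 1, 2 * n + 1, l div 2) x)"
    by (rule ext) (rule ph_rec)
  then have "winner f (ph (k, n, l)) = cnj (1 / sqrt 2) * winner f (ph (k + 1, 2 * n, l div 2))
      + cnj ((-1) ^ l / sqrt 2) * winner f (ph (k + 1, 2 * n + 1, l div 2))"
    using assms by (simp only: winner_add_right winner_mult_right sqint_mult sqint_ph)
  moreover have "cnj (1 / sqrt 2) = 1 / sqrt 2" "cnj ((-1) ^ l / sqrt 2) = (-1) ^ l / sqrt 2" by simp_all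
  ultimately show ?thesis by (simp add: add_divide_distrib)
qed

lemma winner_ph_commute: "winner (ph P) (ph R) = winner (ph R) (ph P)"
  by (simp add: winner_def ph_def mult.commute)

text \<open>The recursion moves both tiles to scale k + 1 and halves their frequencies, hence the
  induction on l + l'. The two contributions cancel exactly when l and l' have different
  parity.\<close>

lemma winner_ph_same_scale:
  "winner (ph (k, n, l)) (ph (k, n', l')) = (if n = n' \<and> l = l' then 1 else 0)"
proof (induction "l + l'" arbitrary: k n n' l l' rule: less_induct)
  case less
  show ?case
  proof (cases "l + l' = 0")
    case True
    then have l: "l = 0" "l' = 0" by auto
    have eq: "ph (k, n, 0) x * cnj (ph (k, n', 0) x) = complex_of_real (2 powr real_of_int k * (indicator (dy k n \<inter> dy k n') x))" for x
      by (auto simp: ph_def phi_eq walsh_0 indicator_def mem_dy powr_add[symmetric] simp flip: of_real_mult)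
    have "winner (ph (k, n, 0)) (ph (k, n', 0)) = complex_of_real (2 powr real_of_int k * measure lebesgue (dy k n \<inter> dy k n'))"
      unfolding winner_def eq by (simp only: integral_complex_of_real, simp)
    also have "\<dots> = (if n = n' then 1 else 0)"
      using dy_disjoint[of k k n n'] by (auto simp: measure_dy dsub_def powr_minus)
    finally show ?thesis using l by simp
  next
    case False
    then have lt: "l div 2 + l' div 2 < l + l'" by linarith
    note IH = less[OF lt]
    have s: "complex_of_real (sqrt 2) * complex_of_real (sqrt 2) = 2" by (simp flip: of_real_mult)
    have a: "winner (ph (k + 1, m, l div 2)) (ph (k, n', l')) =
      (of_bool (m = 2 * n' \<and> l div 2 = l' div 2) + (-1) ^ l' * of_bool (m = 2 * n' + 1 \<and> l div 2 = l' div 2)) / sqrt 2" for m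
      by (subst winner_rec) (auto simp: IH)
    have "winner (ph (k, n, l)) (ph (k, n', l')) =
      (winner (ph (k + 1, 2 * n, l div 2)) (ph (k, n', l')) + (-1) ^ l * winner (ph (k + 1, 2 * n + 1, l div 2)) (ph (k, n', l'))) / sqrt 2"
      by (subst winner_ph_commute, subst winner_rec) (auto simp: winner_ph_commute)
    also have "\<dots> = of_bool (n = n' \<and> l div 2 = l' div 2) * (1 + (-1) ^ (l + l')) / 2"
      unfolding a by (auto simp: s field_simps power_add)
    also have "\<dots> = (if n = n' \<and> l = l' then 1 else 0)"
    proof (cases "even (l + l')")
      case True
      then have "l div 2 = l' div 2 \<longleftrightarrow> l = l'" by presburger
      then show ?thesis using True by auto
    next
      case False
      then show ?thesis by auto
    qed
    finally show ?thesis .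
  qed
qed

text \<open>One recursion step replaces R by the tile just below it that is still above P, at the
  cost of 1 / sqrt 2; the other one contributes 0. At equal scales orthonormality decides.\<close>

lemma norm_winner_ph:
  assumes "kk R \<le> kk P"
  shows "norm (winner (ph P) (ph R)) = (if tile_le P R then 2 powr ((real_of_int (kk R) - real_of_int (kk P)) / 2) else 0)"
  using assms
proof (induction "nat (kk P - kk R)" arbitrary: R)
  case 0
  then have "kk R = kk P" by simp
  then show ?case
    using winner_ph_same_scale[of "kk P" "nn P" "ll P" "nn R" "ll R"]
    by (cases P; cases R) (auto simp: tile_le_def dsub_def fsub_def)
next
  case (Suc d)
  obtain k n l where R: "R = (k, n, l)" by (cases R)
  let ?R0 = "(k + 1, 2 * n, l div 2)" and ?R1 = "(k + 1, 2 * n + 1, l div 2)"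
  have lt: "k < kk P" using Suc R by auto
  have IH: "norm (winner (ph P) (ph ?R0)) = (if tile_le P ?R0 then 2 powr ((real_of_int (k + 1) - real_of_int (kk P)) / 2) else 0)"
    "norm (winner (ph P) (ph ?R1)) = (if tile_le P ?R1 then 2 powr ((real_of_int (k + 1) - real_of_int (kk P)) / 2) else 0)"
    using Suc.hyps(1)[of ?R0] Suc.hyps(1)[of ?R1] Suc.hyps(2) lt R by auto
  have iff: "tile_le P R \<longleftrightarrow> tile_le P ?R0 \<or> tile_le P ?R1"
    using tile_le_children[of P k n l] lt R by auto
  have pw: "2 powr ((real_of_int (k + 1) - real_of_int (kk P)) / 2) / sqrt 2 = 2 powr ((real_of_int k - real_of_int (kk P)) / 2)"
  proof -
    have "(real_of_int (k + 1) - real_of_int (kk P)) / 2 = (real_of_int k - real_of_int (kk P)) / 2 + 1 / 2" by (simp add: field_simps)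
    then show ?thesis by (simp only: powr_add) (simp add: powr_half_sqrt)
  qed
  have wR: "winner (ph P) (ph R) = (winner (ph P) (ph ?R0) + (-1) ^ l * winner (ph P) (ph ?R1)) / sqrt 2"
    unfolding R by (rule winner_rec) simp
  consider "\<not> tile_le P ?R0" "\<not> tile_le P ?R1" | "tile_le P ?R0" "\<not> tile_le P ?R1" | "\<not> tile_le P ?R0" "tile_le P ?R1"
    using tile_le_children_disjoint[of P "k + 1" n] by blast
  then show ?case
  proof cases
    case 1
    then have "winner (ph P) (ph ?R0) = 0" "winner (ph P) (ph ?R1) = 0" using IH by auto
    then show ?thesis using 1 iff by (simp add: wR)
  next
    case 2
    then have "winner (ph P) (ph ?R1) = 0" using IH by auto
    then have "norm (winner (ph P) (ph R)) = norm (winner (ph P) (ph ?R0)) / sqrt 2"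
      by (simp add: wR norm_divide)
    then show ?thesis using 2 IH iff pw by (simp add: R)
  next
    case 3
    then have "winner (ph P) (ph ?R0) = 0" using IH by auto
    then have "norm (winner (ph P) (ph R)) = norm (winner (ph P) (ph ?R1)) / sqrt 2"
      by (simp add: wR norm_divide norm_mult norm_power)
    then show ?thesis using 3 IH iff pw by (simp add: R)
  qed
qed

lemma winner_ph_nonzero: "winner (ph P) (ph R) \<noteq> 0 \<Longrightarrow> tile_le P R \<or> tile_le R P"
proof -
  assume nz: "winner (ph P) (ph R) \<noteq> 0"
  show ?thesis
  proof (cases "kk R \<le> kk P")
    case True
    then show ?thesis using norm_winner_ph[of R P] nz by (auto split: if_splits)
  next
    case False
    then show ?thesis using norm_winner_ph[of P R] winner_ph_commute[of P R] nz by (auto split: if_splits)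
  qed
qed

lemma winner_ph_self [simp]: "winner (ph P) (ph P) = 1"
  using winner_ph_same_scale[of "kk P" "nn P" "ll P" "nn P" "ll P"] by simp

lemma bessel:
  assumes "finite D" and orth: "\<And>x y. x \<in> D \<Longrightarrow> y \<in> D \<Longrightarrow> x \<noteq> y \<Longrightarrow> winner (ph x) (ph y) = 0" and f: "sqint f"
  shows "(\<Sum>x\<in>D. (norm (winner f (ph x)))\<^sup>2) \<le> (LINT x|lebesgue. (norm (f x))\<^sup>2)"
proof -
  define c where "c x = winner f (ph x)" for x
  define s where "s = (\<lambda>y. \<Sum>x\<in>D. (- c x) * ph x y)"
  define N where "N = (\<Sum>x\<in>D. (norm (c x))\<^sup>2)"
  have s: "sqint s" unfolding s_def by (intro sqint_sum sqint_mult sqint_ph)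
  have ccN: "(\<Sum>x\<in>D. cnj (c x) * c x) = complex_of_real N"
    unfolding N_def of_real_sum complex_norm_square by (simp only: mult.commute)
  have fs: "winner f s = - complex_of_real N"
  proof -
    have "winner f s = (\<Sum>x\<in>D. winner f (\<lambda>y. - c x * ph x y))"
      unfolding s_def using f by (intro winner_sum_right sqint_mult sqint_ph)
    also have "\<dots> = (\<Sum>x\<in>D. - (cnj (c x) * c x))"
      unfolding winner_mult_right c_def[symmetric] by simp
    finally show ?thesis by (simp add: sum_negf ccN)
  qed
  have sf: "winner s f = - complex_of_real N" using fs winner_cnj[of s f] by simp
  have sp: "winner s (ph x) = - c x" if "x \<in> D" for x
  proof -
    have "winner s (ph x) = (\<Sum>y\<in>D. winner (\<lambda>z. - c y * ph y z) (ph x))"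
      unfolding s_def by (intro winner_sum_left sqint_mult sqint_ph)
    also have "\<dots> = (\<Sum>y\<in>D. - c y * winner (ph y) (ph x))" unfolding winner_mult_left ..
    also have "\<dots> = (\<Sum>y\<in>D. if y = x then - c x else 0)" using orth that by (intro sum.cong) auto
    finally show ?thesis using assms(1) that by simp
  qed
  have ss: "winner s s = complex_of_real N"
  proof -
    have "winner s s = (\<Sum>x\<in>D. winner s (\<lambda>y. - c x * ph x y))"
      using winner_sum_right[of D "\<lambda>x y. - c x * ph x y" s, OF sqint_mult[OF sqint_ph] s]
      unfolding s_def[symmetric] .
    also have "\<dots> = (\<Sum>x\<in>D. cnj (- c x) * winner s (ph x))" unfolding winner_mult_right ..
    also have "\<dots> = (\<Sum>x\<in>D. cnj (c x) * c x)" by (intro sum.cong refl) (simp add: sp)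
    finally show ?thesis by (simp add: ccN)
  qed
  have "winner (\<lambda>x. f x + s x) (\<lambda>x. f x + s x) = winner f f - complex_of_real N"
    using f s by (simp add: winner_add_left winner_add_right sqint_add fs sf ss)
  then have "complex_of_real (LINT x|lebesgue. (norm (f x + s x))\<^sup>2) = complex_of_real ((LINT x|lebesgue. (norm (f x))\<^sup>2) - N)"
    by (simp add: winner_self)
  then have "(LINT x|lebesgue. (norm (f x + s x))\<^sup>2) = (LINT x|lebesgue. (norm (f x))\<^sup>2) - N"
    by (simp only: of_real_eq_iff)
  moreover have "(LINT x|lebesgue. (norm (f x + s x))\<^sup>2) \<ge> 0" by simp
  ultimately show ?thesis by (simp add: N_def c_def)
qed

lemma antichain_orthogonal:
  "antichain j D \<Longrightarrow> x \<in> D \<Longrightarrow> y \<in> D \<Longrightarrow> x \<noteq> y \<Longrightarrow> winner (ph (subtile x j)) (ph (subtile y j)) = 0"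
proof (rule ccontr)
  assume a: "antichain j D" "x \<in> D" "y \<in> D" "x \<noteq> y" and "winner (ph (subtile x j)) (ph (subtile y j)) \<noteq> 0"
  from winner_ph_nonzero[OF this(5)] show False
    using a(1)[unfolded antichain_def, rule_format, OF a(2,3)] a(1)[unfolded antichain_def, rule_format, OF a(3,2)] a(4)
    by auto
qed

lemma bessel_antichain:
  assumes "finite D" "antichain j D" "sqint f" "j \<ge> 1"
  shows "(\<Sum>P\<in>D. (norm (winner f (ph (subtile P j))))\<^sup>2) \<le> (LINT x|lebesgue. (norm (f x))\<^sup>2)"
proof -
  have inj: "inj_on (\<lambda>P. subtile P j) D" using assms(4) by (auto simp: inj_on_def subtile_inj)
  have "(\<Sum>x\<in>(\<lambda>P. subtile P j) ` D. (norm (winner f (ph x)))\<^sup>2) \<le> (LINT x|lebesgue. (norm (f x))\<^sup>2)"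
  proof (rule bessel)
    show "winner (ph x) (ph y) = 0" if "x \<in> (\<lambda>P. subtile P j) ` D" "y \<in> (\<lambda>P. subtile P j) ` D" "x \<noteq> y" for x y
      using that antichain_orthogonal[OF assms(2)] by blast
  qed (use assms in auto)
  then show ?thesis by (simp add: sum.reindex[OF inj])
qed

section \<open>Sizes and energies of Walsh coefficients\<close>

lemma Xset_norm_le: "f \<in> Xset E \<Longrightarrow> norm (f x) \<le> indicator E x"
  by (cases "x \<in> E") (auto simp: Xset_def)

lemma Xset_sqint: "f \<in> Xset E \<Longrightarrow> E \<in> lmeasurable \<Longrightarrow> sqint f"
  by (rule sqint_bounded[of f E 1]) (auto simp: Xset_norm_le, auto simp: Xset_def)

lemma norm_winner_Xset:
  assumes f: "f \<in> Xset E" and E: "E \<in> lmeasurable"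
  shows "norm (winner f (ph R)) \<le> 2 powr (real_of_int (kk R) / 2) * measure lebesgue (E \<inter> dy (kk R) (nn R))"
proof -
  let ?w = "2 powr (real_of_int (kk R) / 2)" and ?I = "dy (kk R) (nn R)"
  have m: "E \<inter> ?I \<in> lmeasurable" using E by (intro fmeasurable.Int) auto
  have "norm (winner f (ph R)) \<le> (LINT x|lebesgue. norm (f x * cnj (ph R x)))"
    unfolding winner_def by (rule integral_norm_bound)
  also have "\<dots> \<le> (LINT x|lebesgue. ?w * indicator (E \<inter> ?I) x)"
  proof (rule integral_mono)
    show "integrable lebesgue (\<lambda>x. norm (f x * cnj (ph R x)))"
      by (intro integrable_norm sqint_integrable Xset_sqint[OF f E] sqint_ph)
    show "integrable lebesgue (\<lambda>x. ?w * indicator (E \<inter> ?I) x)"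
      using m by (intro integrable_mult_right) (auto simp: fmeasurable_def)
    show "norm (f x * cnj (ph R x)) \<le> ?w * indicator (E \<inter> ?I) x" for x
    proof -
      have "norm (f x) * norm (ph R x) \<le> indicator E x * (?w * indicator ?I x)"
        using Xset_norm_le[OF f, of x] abs_phi_le[of R x] by (intro mult_mono) (auto simp: ph_def)
      also have "\<dots> = ?w * indicator (E \<inter> ?I) x" by (simp add: indicator_def)
      finally show ?thesis by (simp add: norm_mult)
    qed
  qed
  also have "\<dots> = ?w * measure lebesgue (E \<inter> ?I)" using m by (simp add: fmeasurable_def)
  finally show ?thesis .
qed

text \<open>The packets of D live in U, so f may be cut off to U before Bessel's inequality is
  applied.\<close>

lemma bessel_local:
  assumes f: "f \<in> Xset E" and E: "E \<in> lmeasurable" and U: "U \<in> sets lebesgue"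
    and D: "finite D" "antichain j D" "j \<ge> 1" "\<And>P. P \<in> D \<Longrightarrow> dy (kk P) (nn P) \<subseteq> U"
  shows "(\<Sum>P\<in>D. (norm (winner f (ph (subtile P j))))\<^sup>2) \<le> measure lebesgue (E \<inter> U)"
proof -
  have m: "E \<inter> U \<in> lmeasurable" using E U by (rule fmeasurable_Int_fmeasurable)
  define f' where "f' x = indicator U x * f x" for x
  have fm: "f \<in> borel_measurable lebesgue" using f by (simp add: Xset_def)
  have f': "f' \<in> Xset (E \<inter> U)" unfolding Xset_def
  proof (intro CollectI conjI allI impI)
    show "f' \<in> borel_measurable lebesgue" unfolding f'_def using fm U by measurable
    show "f' x = 0" if "x \<notin> E \<inter> U" for x using f that by (auto simp: f'_def Xset_def indicator_def)
    show "norm (f' x) \<le> 1" for x using f by (auto simp: f'_def Xset_def indicator_def)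
  qed
  have sf': "sqint f'" by (rule Xset_sqint[OF f' m])
  have eq: "winner f (ph (subtile P j)) = winner f' (ph (subtile P j))" if "P \<in> D" for P
  proof -
    have "f x * cnj (ph (subtile P j) x) = f' x * cnj (ph (subtile P j) x)" for x
    proof (cases "x \<in> dy (kk P) (nn P)")
      case True
      then show ?thesis using D(4)[OF that] by (auto simp: f'_def)
    next
      case False
      then have "ph (subtile P j) x = 0" using abs_phi_le[of "subtile P j" x] by (simp add: ph_def)
      then show ?thesis by simp
    qed
    then show ?thesis by (simp only: winner_def)
  qed
  have "(\<Sum>P\<in>D. (norm (winner f (ph (subtile P j))))\<^sup>2) = (\<Sum>P\<in>D. (norm (winner f' (ph (subtile P j))))\<^sup>2)"
    using eq by (intro sum.cong) auto
  also have "\<dots> \<le> (LINT x|lebesgue. (norm (f' x))\<^sup>2)" by (rule bessel_antichain[OF D(1,2) sf' D(3)])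
  also have "\<dots> \<le> (LINT x|lebesgue. indicator (E \<inter> U) x)"
  proof (rule integral_mono)
    show "integrable lebesgue (\<lambda>x. (norm (f' x))\<^sup>2)" using sf' by (simp add: sqint_def)
    show "integrable lebesgue (indicat_real (E \<inter> U))" using m by (auto simp: fmeasurable_def)
    show "(norm (f' x))\<^sup>2 \<le> indicator (E \<inter> U) x" for x
    proof -
      have "(norm (f' x))\<^sup>2 \<le> (indicator (E \<inter> U) x)\<^sup>2" using Xset_norm_le[OF f'] by (intro power_mono) auto
      also have "(indicator (E \<inter> U) x :: real)\<^sup>2 = indicator (E \<inter> U) x" by (simp add: indicator_def)
      finally show ?thesis .
    qed
  qed
  also have "\<dots> = measure lebesgue (E \<inter> U)" using m by (simp add: fmeasurable_def)
  finally show ?thesis .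
qed

definition coef :: "(real \<Rightarrow> complex) \<Rightarrow> nat \<Rightarrow> quartile \<Rightarrow> real" where
  "coef f j P = norm (winner f (ph (subtile P j)))"

lemma coef_nonneg [simp]: "coef f j P \<ge> 0" by (simp add: coef_def)

lemma energy_coef:
  assumes "f \<in> Xset E" "E \<in> lmeasurable" "finite PP" "j \<ge> 1"
  shows "energy_le PP j (coef f j) (sqrt (measure lebesgue E))"
  unfolding energy_le_def coef_def
proof (intro allI impI)
  fix D assume "D \<subseteq> PP" "antichain j D"
  then show "(\<Sum>P\<in>D. (norm (winner f (ph (subtile P j))))\<^sup>2) \<le> (sqrt (measure lebesgue E))\<^sup>2"
    using bessel_local[OF assms(1,2), of UNIV D j] assms finite_subset by auto
qed

text \<open>Densities on the dyadic ancestors of the time intervals, up to length 2^(-k0). The lower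
  bound on the scale leaves finitely many ancestors; k0 will be the smallest scale that
  occurs.\<close>

definition dens :: "int \<Rightarrow> quartile set \<Rightarrow> real set \<Rightarrow> real \<Rightarrow> bool" where
  "dens k0 PP E lam \<longleftrightarrow> (\<forall>Q\<in>PP. \<forall>k n. k0 \<le> k \<longrightarrow> dsub (kk Q) (nn Q) k n \<longrightarrow>
     measure lebesgue (E \<inter> dy k n) \<le> lam * 2 powr (- real_of_int k))"

lemma measure_dy_split:
  assumes "E \<in> lmeasurable"
  shows "measure lebesgue (E \<inter> dy (k + 1) (2 * n)) + measure lebesgue (E \<inter> dy (k + 1) (2 * n + 1)) = measure lebesgue (E \<inter> dy k n)"
proof -
  have "E \<inter> dy k n = (E \<inter> dy (k + 1) (2 * n)) \<union> (E \<inter> dy (k + 1) (2 * n + 1))"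
    using dy_split(1)[of k n] by blast
  moreover have "(E \<inter> dy (k + 1) (2 * n)) \<inter> (E \<inter> dy (k + 1) (2 * n + 1)) = {}" using dy_split(2)[of k n] by blast
  moreover have "E \<inter> dy (k + 1) m \<in> lmeasurable" for m using assms by (intro fmeasurable.Int) auto
  ultimately show ?thesis by (simp add: measure_Un_AE[of _ lebesgue] measure_Un3)
qed

text \<open>The source-free case of \<open>lacunary_carleson\<close>. One factor stays a measure
  instead of being bounded by lam * len t; \<open>paraproduct_tree\<close> uses this gain.\<close>

lemma coef_tree:
  assumes f: "f \<in> Xset E" and E: "E \<in> lmeasurable" and fin: "finite PP"
    and ij: "i \<in> {1..4}" "j \<in> {1..4}" "i \<noteq> j" and lam: "lam \<ge> 0"
    and good: "\<And>Q k n. Q \<in> PP \<Longrightarrow> Q \<in> itree i t \<Longrightarrow> kk t \<le> k \<Longrightarrow> dsub (kk Q) (nn Q) k n \<Longrightarrow>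
      measure lebesgue (E \<inter> dy k n) \<le> lam * 2 powr (- real_of_int k)"
  shows "(\<Sum>Q\<in>PP \<inter> itree i t. (coef f j Q)\<^sup>2) \<le> 4 * lam * measure lebesgue (E \<inter> dy (kk t) (nn t))"
  unfolding coef_def
proof (rule lacunary_carleson[where c="\<lambda>R. winner f (ph R)" and M="\<lambda>k n. measure lebesgue (E \<inter> dy k n)"
      and \<delta>="\<lambda>R. 0" and tp=t and lam=lam, OF fin ij])
  show "winner f (ph (k, n, l)) = (winner f (ph (k + 1, 2 * n, l div 2)) + (-1) ^ l * winner f (ph (k + 1, 2 * n + 1, l div 2))) / sqrt 2 + 0" for k n l
    using winner_rec[OF Xset_sqint[OF f E], of k n l] by simp
  show "norm (winner f (ph (k, n, l))) \<le> 2 powr (real_of_int k / 2) * measure lebesgue (E \<inter> dy k n)" for k n l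
    using norm_winner_Xset[OF f E, of "(k, n, l)"] by simp
qed (use good lam measure_dy_split[OF E] in auto)

lemma size_coef:
  assumes "f \<in> Xset E" "E \<in> lmeasurable" "finite PP" "dens k0 PP E lam" "lam \<ge> 0"
    and TT: "\<And>t. t \<in> TT \<Longrightarrow> k0 \<le> kk t" and j: "j \<in> {1..3}"
  shows "size_le TT PP j (coef f j) (2 * lam)"
  unfolding size_le_def
proof (intro ballI)
  fix i t assume i: "i \<in> {1..4} - {j}" and t: "t \<in> TT"
  have good: "measure lebesgue (E \<inter> dy k n) \<le> lam * 2 powr (- real_of_int k)"
    if "Q \<in> PP" "kk t \<le> k" "dsub (kk Q) (nn Q) k n" for Q k n
    using assms(4) TT[OF t] that by (auto simp: dens_def)
  have "(\<Sum>P\<in>PP \<inter> itree i t. (coef f j P)\<^sup>2) \<le> 4 * lam * measure lebesgue (E \<inter> dy (kk t) (nn t))"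
    by (rule coef_tree[OF assms(1-3)]) (use i j assms(5) good in auto)
  \<comment> \<open>The density at the top is known only if the tree contains a quartile; the empty
    tree is trivial.\<close>
  also have "PP \<inter> itree i t \<noteq> {} \<Longrightarrow> \<dots> \<le> 4 * lam * (lam * len t)"
  proof -
    assume "PP \<inter> itree i t \<noteq> {}"
    then obtain Q where "Q \<in> PP" "dsub (kk Q) (nn Q) (kk t) (nn t)" by (auto simp: itree_def tile_le_def)
    then show ?thesis using good[of Q "kk t" "nn t"] assms(5) by (auto simp: len_def intro!: mult_left_mono)
  qed
  finally have "PP \<inter> itree i t \<noteq> {} \<Longrightarrow> (\<Sum>P\<in>PP \<inter> itree i t. (coef f j P)\<^sup>2) \<le> (2 * lam)\<^sup>2 * len t"
    by (simp add: power2_eq_square mult_ac)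
  then show "(\<Sum>P\<in>PP \<inter> itree i t. (coef f j P)\<^sup>2) \<le> (2 * lam)\<^sup>2 * len t"
    by (cases "PP \<inter> itree i t = {}") (auto simp: less_imp_le)
qed

section \<open>The truncated Gram matrix and duality\<close>

definition K :: "quartile \<Rightarrow> quartile \<Rightarrow> complex" where
  "K Q P = (if fsub (subtile Q 3) (subtile P 1) then winner (ph (subtile Q 3)) (ph (subtile P 1)) else 0)"

text \<open>The frequency condition makes Q_3 at least as long as P_1, and a nonzero inner product
  makes the two comparable. In particular I_P lies in I_Q.\<close>

lemma K_nonzero: assumes "K Q P \<noteq> 0" shows "tile_le (subtile P 1) (subtile Q 3)"
proof -
  have fs: "fsub (subtile Q 3) (subtile P 1)" and w: "winner (ph (subtile P 1)) (ph (subtile Q 3)) \<noteq> 0"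
    using assms winner_ph_commute by (auto simp: K_def split: if_splits)
  have "kk (subtile Q 3) \<le> kk (subtile P 1)" using fs by (simp add: fsub_def)
  from norm_winner_ph[OF this] w show ?thesis by (auto split: if_splits)
qed

text \<open>Each column of M is a complete Gram column or zero. Keeping the complete ones, the inner
  sums are the coefficients of one function h whose norm is at most that of v, and Bessel's
  inequality applies to h.\<close>

lemma contraction:
  assumes fin: "finite A" "finite B"
    and oA: "\<And>a a'. a \<in> A \<Longrightarrow> a' \<in> A \<Longrightarrow> a \<noteq> a' \<Longrightarrow> winner (ph (x a)) (ph (x a')) = 0"
    and oB: "\<And>b b'. b \<in> B \<Longrightarrow> b' \<in> B \<Longrightarrow> b \<noteq> b' \<Longrightarrow> winner (ph (y b)) (ph (y b')) = 0"
    and inj: "inj_on y B"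
    and M: "\<And>a. a \<in> A \<Longrightarrow> (\<forall>b\<in>B. M b a = winner (ph (x a)) (ph (y b))) \<or> (\<forall>b\<in>B. M b a = 0)"
  shows "(\<Sum>b\<in>B. (norm (\<Sum>a\<in>A. v a * M b a))\<^sup>2) \<le> (\<Sum>a\<in>A. (norm (v a))\<^sup>2)"
proof -
  define A1 where "A1 = {a\<in>A. \<forall>b\<in>B. M b a = winner (ph (x a)) (ph (y b))}"
  define h where "h = (\<lambda>z. \<Sum>a\<in>A1. v a * ph (x a) z)"
  have A1: "A1 \<subseteq> A" "finite A1" using fin by (auto simp: A1_def)
  have sh: "sqint h" unfolding h_def by (intro sqint_sum sqint_mult sqint_ph)
  have hy: "winner h g = (\<Sum>a\<in>A1. v a * winner (ph (x a)) g)" if "sqint g" for g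
  proof -
    have "winner h g = (\<Sum>a\<in>A1. winner (\<lambda>z. v a * ph (x a) z) g)"
      unfolding h_def by (intro winner_sum_left sqint_mult sqint_ph that)
    then show ?thesis by (simp only: winner_mult_left)
  qed
  have "(\<Sum>a\<in>A. v a * M b a) = winner h (ph (y b))" if "b \<in> B" for b
  proof -
    have "(\<Sum>a\<in>A. v a * M b a) = (\<Sum>a\<in>A1. v a * M b a)"
      using M A1 fin that by (intro sum.mono_neutral_right) (auto simp: A1_def)
    also have "\<dots> = winner h (ph (y b))" unfolding hy[OF sqint_ph]
      using that by (intro sum.cong) (auto simp: A1_def)
    finally show ?thesis .
  qed
  then have "(\<Sum>b\<in>B. (norm (\<Sum>a\<in>A. v a * M b a))\<^sup>2) = (\<Sum>b\<in>B. (norm (winner h (ph (y b))))\<^sup>2)"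
    by (intro sum.cong) auto
  also have "\<dots> = (\<Sum>t\<in>y ` B. (norm (winner h (ph t)))\<^sup>2)" by (simp add: sum.reindex[OF inj])
  also have "\<dots> \<le> (LINT z|lebesgue. (norm (h z))\<^sup>2)"
  proof (rule bessel)
    fix s t assume "s \<in> y ` B" "t \<in> y ` B" "s \<noteq> t"
    then show "winner (ph s) (ph t) = 0" using oB by blast
  qed (use fin sh in auto)
  also have "\<dots> = (\<Sum>a\<in>A1. (norm (v a))\<^sup>2)"
  proof -
    have hx: "winner h (ph (x a)) = v a" if "a \<in> A1" for a
    proof -
      have "winner h (ph (x a)) = (\<Sum>a'\<in>A1. v a' * winner (ph (x a')) (ph (x a)))" by (rule hy) simp
      also have "\<dots> = (\<Sum>a'\<in>A1. if a' = a then v a else 0)" using oA A1 that by (intro sum.cong) auto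
      finally show ?thesis using A1 that by simp
    qed
    have "winner h h = (\<Sum>a\<in>A1. v a * winner (ph (x a)) h)" by (rule hy[OF sh])
    also have "\<dots> = (\<Sum>a\<in>A1. v a * cnj (v a))"
    proof (intro sum.cong refl)
      fix a assume "a \<in> A1"
      then show "v a * winner (ph (x a)) h = v a * cnj (v a)" using hx winner_cnj[of "ph (x a)" h] by simp
    qed
    also have "\<dots> = complex_of_real (\<Sum>a\<in>A1. (norm (v a))\<^sup>2)" unfolding of_real_sum complex_norm_square ..
    finally show ?thesis unfolding winner_self of_real_eq_iff .
  qed
  also have "\<dots> \<le> (\<Sum>a\<in>A. (norm (v a))\<^sup>2)" using A1 fin by (intro sum_mono2) auto
  finally show ?thesis .
qed

text \<open>A tile of one family that meets a tile of the other antichain on one side (longer or shorter in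
  time) cannot meet another one on the other side.\<close>

lemma K_contraction_1:
  assumes fin: "finite D" "finite D'" and anti: "antichain 1 D" "antichain 3 D'"
  shows "(\<Sum>Q\<in>D'. (norm (\<Sum>P\<in>D. v P * K Q P))\<^sup>2) \<le> (\<Sum>P\<in>D. (norm (v P))\<^sup>2)"
proof (rule contraction[where x="\<lambda>P. subtile P 1" and y="\<lambda>Q. subtile Q 3"])
  fix P assume P: "P \<in> D"
  have "K Q P = winner (ph (subtile P 1)) (ph (subtile Q 3))" if Q0: "Q0 \<in> D'" "K Q0 P \<noteq> 0" and Q: "Q \<in> D'" for Q Q0
  proof (rule ccontr)
    assume ne: "K Q P \<noteq> winner (ph (subtile P 1)) (ph (subtile Q 3))"
    then have nf: "\<not> fsub (subtile Q 3) (subtile P 1)" and w: "winner (ph (subtile P 1)) (ph (subtile Q 3)) \<noteq> 0"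
      by (auto simp: K_def winner_ph_commute split: if_splits)
    have le0: "tile_le (subtile P 1) (subtile Q0 3)" by (rule K_nonzero[OF Q0(2)])
    have "tile_le (subtile Q 3) (subtile P 1)" using winner_ph_nonzero[OF w] nf by (auto simp: tile_le_def)
    then have "tile_le (subtile Q 3) (subtile Q0 3)" using le0 by (rule tile_le_trans)
    then have "Q = Q0" using anti(2) Q Q0(1) unfolding antichain_def by blast
    then show False using nf le0 by (simp add: tile_le_def)
  qed
  then show "(\<forall>b\<in>D'. K b P = winner (ph (subtile P 1)) (ph (subtile b 3))) \<or> (\<forall>b\<in>D'. K b P = 0)" by blast
qed (use fin antichain_orthogonal[OF anti(1)] antichain_orthogonal[OF anti(2)] in \<open>auto simp: inj_on_def subtile_inj\<close>)

lemma K_contraction_2: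
  assumes fin: "finite D" "finite D'" and anti: "antichain 1 D" "antichain 3 D'"
  shows "(\<Sum>P\<in>D. (norm (\<Sum>Q\<in>D'. v Q * K Q P))\<^sup>2) \<le> (\<Sum>Q\<in>D'. (norm (v Q))\<^sup>2)"
proof (rule contraction[where x="\<lambda>Q. subtile Q 3" and y="\<lambda>P. subtile P 1" and M="\<lambda>P Q. K Q P"])
  fix Q assume Q: "Q \<in> D'"
  have "K Q P = winner (ph (subtile Q 3)) (ph (subtile P 1))" if P0: "P0 \<in> D" "K Q P0 \<noteq> 0" and P: "P \<in> D" for P P0
  proof (rule ccontr)
    assume ne: "K Q P \<noteq> winner (ph (subtile Q 3)) (ph (subtile P 1))"
    then have nf: "\<not> fsub (subtile Q 3) (subtile P 1)" and w: "winner (ph (subtile Q 3)) (ph (subtile P 1)) \<noteq> 0"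
      by (auto simp: K_def split: if_splits)
    have le0: "tile_le (subtile P0 1) (subtile Q 3)" by (rule K_nonzero[OF P0(2)])
    have "tile_le (subtile Q 3) (subtile P 1)" using winner_ph_nonzero[OF w] nf by (auto simp: tile_le_def)
    then have "tile_le (subtile P0 1) (subtile P 1)" using tile_le_trans[OF le0] by blast
    then have "P0 = P" using anti(1) P P0(1) unfolding antichain_def by blast
    then show False using nf le0 by (simp add: tile_le_def)
  qed
  then show "(\<forall>b\<in>D. K Q b = winner (ph (subtile Q 3)) (ph (subtile b 1))) \<or> (\<forall>b\<in>D. K Q b = 0)" by blast
qed (use fin antichain_orthogonal[OF anti(1)] antichain_orthogonal[OF anti(2)] in \<open>auto simp: inj_on_def subtile_inj\<close>)

text \<open>Pairing the vector w with its own conjugate moves the sum to A, where the contraction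
  gives the dual coefficients d energy at most N. As the assumed bound is linear in N, this yields
  N^2 <= Bd * N.\<close>

lemma energy_dual:
  fixes \<beta> :: "quartile \<Rightarrow> complex" and k :: "quartile \<Rightarrow> quartile \<Rightarrow> complex"
  assumes fin: "finite A" "finite B"
    and contr: "\<And>D D' v. D \<subseteq> B \<Longrightarrow> antichain jB D \<Longrightarrow> D' \<subseteq> A \<Longrightarrow> antichain jA D' \<Longrightarrow>
      (\<Sum>x\<in>D'. (norm (\<Sum>y\<in>D. v y * k x y))\<^sup>2) \<le> (\<Sum>y\<in>D. (norm (v y))\<^sup>2)"
    and bound: "\<And>d N. (\<And>x. d x \<ge> 0) \<Longrightarrow> N > 0 \<Longrightarrow> energy_le A jA d N \<Longrightarrow> (\<Sum>x\<in>A. norm (\<beta> x) * d x) \<le> Bd * N"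
    and Bd: "Bd \<ge> 0"
  shows "energy_le B jB (\<lambda>y. norm (\<Sum>x\<in>A. \<beta> x * k x y)) Bd"
  unfolding energy_le_def
proof (intro allI impI)
  fix D assume D: "D \<subseteq> B" "antichain jB D"
  define w where "w y = (\<Sum>x\<in>A. \<beta> x * k x y)" for y
  define N where "N = sqrt (\<Sum>y\<in>D. (norm (w y))\<^sup>2)"
  have N2: "N\<^sup>2 = (\<Sum>y\<in>D. (norm (w y))\<^sup>2)" by (simp add: N_def sum_nonneg)
  have N0: "N \<ge> 0" by (simp add: N_def sum_nonneg)
  have "N \<le> Bd"
  proof (cases "N = 0")
    case False
    then have Np: "N > 0" using N0 by simp
    define d where "d x = norm (\<Sum>y\<in>D. cnj (w y) * k x y)" for x
    have "energy_le A jA d N" unfolding energy_le_def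
    proof (intro allI impI)
      fix D' assume D': "D' \<subseteq> A" "antichain jA D'"
      have "(\<Sum>x\<in>D'. (d x)\<^sup>2) \<le> (\<Sum>y\<in>D. (norm (cnj (w y)))\<^sup>2)"
        unfolding d_def by (rule contr[OF D D'])
      then show "(\<Sum>x\<in>D'. (d x)\<^sup>2) \<le> N\<^sup>2" by (simp add: N2)
    qed
    moreover have "d x \<ge> 0" for x by (simp add: d_def)
    ultimately have le: "(\<Sum>x\<in>A. norm (\<beta> x) * d x) \<le> Bd * N" using Np by (intro bound)
    have "complex_of_real (N\<^sup>2) = (\<Sum>y\<in>D. w y * cnj (w y))"
      unfolding N2 of_real_sum complex_norm_square ..
    also have "\<dots> = (\<Sum>y\<in>D. \<Sum>x\<in>A. \<beta> x * (cnj (w y) * k x y))"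
    proof (intro sum.cong refl)
      fix y
      have "w y * cnj (w y) = (\<Sum>x\<in>A. \<beta> x * k x y) * cnj (w y)" by (simp only: w_def)
      also have "\<dots> = (\<Sum>x\<in>A. \<beta> x * (cnj (w y) * k x y))"
        unfolding sum_distrib_right by (simp only: mult_ac)
      finally show "w y * cnj (w y) = (\<Sum>x\<in>A. \<beta> x * (cnj (w y) * k x y))" .
    qed
    also have "\<dots> = (\<Sum>x\<in>A. \<beta> x * (\<Sum>y\<in>D. cnj (w y) * k x y))"
      by (subst sum.swap) (simp add: sum_distrib_left)
    finally have "norm (complex_of_real (N\<^sup>2)) = norm (\<Sum>x\<in>A. \<beta> x * (\<Sum>y\<in>D. cnj (w y) * k x y))" by simp
    also have "\<dots> \<le> (\<Sum>x\<in>A. norm (\<beta> x) * d x)" unfolding d_def norm_mult[symmetric] by (rule norm_sum)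
    finally have "N\<^sup>2 \<le> Bd * N" using le by (simp add: norm_power)
    then show ?thesis using Np by (simp add: power2_eq_square)
  qed (simp add: Bd)
  then have "N\<^sup>2 \<le> Bd\<^sup>2" using N0 by (intro power_mono)
  then show "(\<Sum>y\<in>D. (norm (\<Sum>x\<in>A. \<beta> x * k x y))\<^sup>2) \<le> Bd\<^sup>2" by (simp add: N2 w_def)
qed

text \<open>Meant for a coefficient with size exponent 0, for which any finite size will do.\<close>

lemma size_le_exists:
  assumes "finite PP" "finite TT" shows "\<exists>S>0. size_le TT PP j a S"
proof -
  define X where "X = (\<Sum>P\<in>PP. (a P)\<^sup>2)"
  define S2 where "S2 = 1 + (\<Sum>t\<in>TT. X / len t)"
  have X0: "X \<ge> 0" by (simp add: X_def sum_nonneg)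
  have S0: "S2 > 0" unfolding S2_def using X0
    by (smt (verit) divide_nonneg_pos len_pos sum_nonneg)
  have "(\<Sum>P\<in>PP \<inter> itree i t. (a P)\<^sup>2) \<le> (sqrt S2)\<^sup>2 * len t" if "t \<in> TT" for i t
  proof -
    have "(\<Sum>P\<in>PP \<inter> itree i t. (a P)\<^sup>2) \<le> X" unfolding X_def using assms by (intro sum_mono2) auto
    also have "X = X / len t * len t" using less_imp_neq[OF len_pos[of t]] by simp
    also have "X / len t \<le> (\<Sum>t\<in>TT. X / len t)"
      using that assms X0 by (intro member_le_sum) (auto simp: less_imp_le)
    also have "\<dots> \<le> S2" by (simp add: S2_def)
    also have "S2 = (sqrt S2)\<^sup>2" using S0 by simp
    finally show ?thesis by (simp add: mult_right_mono less_imp_le)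
  qed
  then show ?thesis using S0 by (intro exI[of _ "sqrt S2"]) (auto simp: size_le_def)
qed

text \<open>Every sub-tile is a possible top; in particular single quartiles are trees, on which the
  tile-by-tile bound \<open>size_le_single\<close> rests.\<close>

definition tops :: "quartile set \<Rightarrow> tile set" where
  "tops PP = (\<lambda>(P, i). subtile P i) ` (PP \<times> {1..4})"

lemma tops_facts:
  "finite PP \<Longrightarrow> finite (tops PP)"
  "P \<in> PP \<Longrightarrow> i \<in> {1..4} \<Longrightarrow> subtile P i \<in> tops PP"
  "t \<in> tops PP \<Longrightarrow> (\<And>P. P \<in> PP \<Longrightarrow> k0 \<le> kk P) \<Longrightarrow> k0 \<le> kk t"
  unfolding tops_def by auto

lemma bht_const_pos: "0 < \<delta> \<Longrightarrow> bht_const \<delta> > 0"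
  by (simp add: bht_const_def powr_less_one)

text \<open>Of d only the energy is known. Its size exponent is 0, so its energy enters to the power
  1 and the bound is linear in N, as \<open>energy_dual\<close> demands.\<close>

lemma bilinear_bound:
  fixes f :: "nat \<Rightarrow> real \<Rightarrow> complex" and F :: "nat \<Rightarrow> real set" and lam :: "nat \<Rightarrow> real" and \<theta> :: real
  assumes fin: "finite PP" and k0: "\<And>P. P \<in> PP \<Longrightarrow> k0 \<le> kk P"
    and js: "{jd, j1, j2} = {1..3}" "j1 \<noteq> j2" "jd \<noteq> j1" "jd \<noteq> j2"
    and f: "\<And>j. j \<in> {j1, j2} \<Longrightarrow> f j \<in> Xset (F j)" "\<And>j. j \<in> {j1, j2} \<Longrightarrow> F j \<in> lmeasurable"
      "\<And>j. j \<in> {j1, j2} \<Longrightarrow> measure lebesgue (F j) > 0"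
    and d: "\<And>j. j \<in> {j1, j2} \<Longrightarrow> dens k0 PP (F j) (lam j)" "\<And>j. j \<in> {j1, j2} \<Longrightarrow> lam j > 0"
    and dd: "\<And>P. d P \<ge> 0" "energy_le PP jd d N" "N > 0"
    and \<theta>: "0 < \<delta>" "\<delta> \<le> \<theta>" "\<theta> \<le> 1 - \<delta>"
  shows "(\<Sum>P\<in>PP. wt P * (coef (f j1) j1 P * coef (f j2) j2 P * d P)) \<le>
    bht_const \<delta> * ((2 * lam j1) powr \<theta> * (2 * lam j2) powr (1 - \<theta>)
      * sqrt (measure lebesgue (F j1)) powr (1 - \<theta>) * sqrt (measure lebesgue (F j2)) powr \<theta>) * N"
proof -
  obtain S0 where S0: "S0 > 0" "size_le (tops PP) PP jd d S0"
    using size_le_exists[OF fin tops_facts(1)[OF fin]] by blast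
  have in3: "jd \<in> {1..3}" "j1 \<in> {1..3}" "j2 \<in> {1..3}" using js(1) by blast+
  have cases3: "j = jd \<or> j = j1 \<or> j = j2" if "j \<in> {1..3}" for j using js(1) that by blast
  define a where "a j = (if j = jd then d else if j \<in> {j1, j2} then coef (f j) j else (\<lambda>P. 0))" for j
  define S where "S j = (if j = jd then S0 else if j \<in> {j1, j2} then 2 * lam j else 1)" for j
  define E where "E j = (if j = jd then N else if j \<in> {j1, j2} then sqrt (measure lebesgue (F j)) else 1)" for j
  define th where "th j = (if j = j1 then \<theta> else if j = j2 then 1 - \<theta> else 0)" for j
  have p3: "(\<Prod>j\<in>{1..3}. g j) = g jd * g j1 * g j2" for g :: "nat \<Rightarrow> real"
    unfolding js(1)[symmetric] using js(2-4) by (simp add: mult_ac)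
  have s3: "(\<Sum>j\<in>{1..3}. g j) = g jd + g j1 + g j2" for g :: "nat \<Rightarrow> real"
    unfolding js(1)[symmetric] using js(2-4) by simp
  have "(\<Sum>P\<in>PP. wt P * a 1 P * a 2 P * a 3 P) \<le>
    bht_const \<delta> * (\<Prod>j\<in>{1..3}. S j powr th j * E j powr (1 - th j))"
  proof (rule trilinear_size_energy[where TT="tops PP" and ?j0.0=j1])
    show "a j P \<ge> 0" for j P using dd(1) by (auto simp: a_def)
    show "S j > 0" for j using S0 d(2) by (auto simp: S_def)
    show "E j > 0" for j using dd(3) f(3) by (auto simp: E_def)
    show "energy_le PP j (a j) (E j)" if "j \<in> {1..3}" for j
    proof (cases "j = jd")
      case True then show ?thesis using dd by (simp add: a_def E_def)
    next
      case False
      then have j: "j \<in> {j1, j2}" using cases3[OF that] by blast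
      then show ?thesis using energy_coef[OF f(1)[OF j] f(2)[OF j] fin, of j] that False by (auto simp: a_def E_def)
    qed
    show "size_le (tops PP) PP j (a j) (S j)" if "j \<in> {1..3}" for j
    proof (cases "j = jd")
      case True then show ?thesis using S0 by (simp add: a_def S_def)
    next
      case False
      then have j: "j \<in> {j1, j2}" using cases3[OF that] by blast
      have "size_le (tops PP) PP j (coef (f j) j) (2 * lam j)"
        by (rule size_coef[OF f(1)[OF j] f(2)[OF j] fin d(1)[OF j] less_imp_le[OF d(2)[OF j]] _ that])
           (rule tops_facts(3)[OF _ k0])
      then show ?thesis using j False by (simp add: a_def S_def)
    qed
    show "0 \<le> th j \<and> th j \<le> 1" for j using \<theta> by (auto simp: th_def)
    show "(\<Sum>j\<in>{1..3}. th j) = 1" unfolding s3 using js by (simp add: th_def)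
    show "j1 \<in> {1..3}" "0 < \<delta>" "\<delta> \<le> th j1" "th j1 \<le> 1 - \<delta>" using in3 \<theta> by (auto simp: th_def)
  qed (use fin tops_facts in auto)
  also have "(\<Prod>j\<in>{1..3}. S j powr th j * E j powr (1 - th j)) =
      ((2 * lam j1) powr \<theta> * (2 * lam j2) powr (1 - \<theta>)
      * sqrt (measure lebesgue (F j1)) powr (1 - \<theta>) * sqrt (measure lebesgue (F j2)) powr \<theta>) * N"
    unfolding p3 using js S0 dd(3) by (simp add: S_def E_def th_def mult_ac)
  also have "(\<Sum>P\<in>PP. wt P * a 1 P * a 2 P * a 3 P) = (\<Sum>P\<in>PP. wt P * (coef (f j1) j1 P * coef (f j2) j2 P * d P))"
  proof (rule sum.cong[OF refl])
    fix P
    have "a 1 P * a 2 P * a 3 P = (\<Prod>j\<in>{1..3}. a j P)" by (simp only: prod_three)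
    also have "\<dots> = coef (f j1) j1 P * coef (f j2) j2 P * d P" unfolding p3 using js by (simp add: a_def mult_ac)
    finally show "wt P * a 1 P * a 2 P * a 3 P = wt P * (coef (f j1) j1 P * coef (f j2) j2 P * d P)"
      by (simp add: mult.assoc)
  qed
  finally show ?thesis by (simp add: mult_ac)
qed

section \<open>Paraproducts on a single tree\<close>

lemma dy_trichotomy: "dy k n \<subseteq> dy k' n' \<or> dy k' n' \<subseteq> dy k n \<or> dy k n \<inter> dy k' n' = {}"
proof (cases "k' \<le> k")
  case True
  then show ?thesis using dsub_dy[of k n k' n'] dy_disjoint[of k' k n n'] by blast
next
  case False
  then show ?thesis using dsub_dy[of k' n' k n] dy_disjoint[of k k' n' n] by auto
qed

text \<open>Dyadic intervals are nested or disjoint: a new interval is dropped if it lies in an old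
  one, and otherwise replaces the old ones inside it.\<close>

lemma dyadic_disjoint_subfamily:
  assumes "finite (I :: (int \<times> int) set)"
  shows "\<exists>J\<subseteq>I. (\<Union>(k,n)\<in>J. dy k n) = (\<Union>(k,n)\<in>I. dy k n) \<and>
    (\<forall>x\<in>J. \<forall>y\<in>J. x \<noteq> y \<longrightarrow> dy (fst x) (snd x) \<inter> dy (fst y) (snd y) = {})"
  using assms
proof (induction I rule: finite_induct)
  case empty
  show ?case by (intro exI[of _ "{}"]) auto
next
  case (insert x I)
  let ?d = "\<lambda>x :: int \<times> int. dy (fst x) (snd x)"
  from insert.IH obtain J where J: "J \<subseteq> I" "(\<Union>x\<in>J. ?d x) = (\<Union>x\<in>I. ?d x)"
    "\<forall>x\<in>J. \<forall>y\<in>J. x \<noteq> y \<longrightarrow> ?d x \<inter> ?d y = {}" by (auto simp: case_prod_beta)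
  show ?case
  proof (cases "\<exists>y\<in>J. ?d x \<subseteq> ?d y")
    case True
    then have "(\<Union>x\<in>J. ?d x) = (\<Union>x\<in>insert x I. ?d x)" using J(2) by blast
    then show ?thesis using J by (intro exI[of _ J]) (auto simp: case_prod_beta)
  next
    case False
    let ?J = "insert x {y\<in>J. \<not> ?d y \<subseteq> ?d x}"
    have "(\<Union>x\<in>?J. ?d x) = ?d x \<union> (\<Union>x\<in>J. ?d x)" by auto
    then have U: "(\<Union>x\<in>?J. ?d x) = (\<Union>x\<in>insert x I. ?d x)" using J(2) by simp
    have new: "?d x \<inter> ?d y = {}" if "y \<in> J" "\<not> ?d y \<subseteq> ?d x" for y
      using dy_trichotomy[of "fst x" "snd x" "fst y" "snd y"] that False by blast
    then have dis: "\<forall>a\<in>?J. \<forall>b\<in>?J. a \<noteq> b \<longrightarrow> ?d a \<inter> ?d b = {}"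
    proof (intro ballI impI)
      fix a b assume ab: "a \<in> ?J" "b \<in> ?J" "a \<noteq> b"
      consider "a = x" "b \<in> J" "\<not> ?d b \<subseteq> ?d x" | "b = x" "a \<in> J" "\<not> ?d a \<subseteq> ?d x" | "a \<in> J" "b \<in> J"
        using ab by blast
      then show "?d a \<inter> ?d b = {}"
      proof cases
        case 1 then show ?thesis using new by simp
      next
        case 2 then show ?thesis using new[of a] by (simp add: Int_commute)
      next
        case 3 then show ?thesis using J(3) ab(3) by simp
      qed
    qed
    show ?thesis using J(1) U dis by (intro exI[of _ ?J]) (auto simp: case_prod_beta)
  qed
qed

text \<open>The weak-type (1,1) inequality for the dyadic maximal function, with constant 1 because
  the intervals can be made disjoint.\<close>

lemma dyadic_weak_type:
  fixes I :: "(int \<times> int) set"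
  assumes fin: "finite I" and E: "E \<in> lmeasurable" and tau: "tau \<ge> 0"
    and d: "\<And>k n. (k,n) \<in> I \<Longrightarrow> tau * 2 powr (- real_of_int k) \<le> measure lebesgue (E \<inter> dy k n)"
  shows "tau * measure lebesgue (\<Union>(k,n)\<in>I. dy k n) \<le> measure lebesgue E"
proof -
  let ?d = "\<lambda>x :: int \<times> int. dy (fst x) (snd x)"
  obtain J where J: "J \<subseteq> I" "(\<Union>(k,n)\<in>J. dy k n) = (\<Union>(k,n)\<in>I. dy k n)"
    "\<forall>x\<in>J. \<forall>y\<in>J. x \<noteq> y \<longrightarrow> ?d x \<inter> ?d y = {}"
    using dyadic_disjoint_subfamily[OF fin] by (elim exE conjE) (rule that)
  have finJ: "finite J" by (rule finite_subset[OF J(1) fin])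
  have m: "E \<inter> ?d x \<in> lmeasurable" for x using E by (intro fmeasurable.Int) auto
  have "tau * measure lebesgue (\<Union>(k,n)\<in>I. dy k n) = tau * measure lebesgue (\<Union>x\<in>J. ?d x)"
    unfolding J(2)[symmetric] by (simp add: case_prod_beta)
  also have "\<dots> \<le> tau * (\<Sum>x\<in>J. measure lebesgue (?d x))"
    using finJ tau by (intro mult_left_mono measure_UNION_le) auto
  also have "\<dots> = (\<Sum>x\<in>J. tau * 2 powr (- real_of_int (fst x)))" by (simp add: measure_dy sum_distrib_left)
  also have "\<dots> \<le> (\<Sum>x\<in>J. measure lebesgue (E \<inter> ?d x))"
    using J(1) by (intro sum_mono d) auto
  also have "\<dots> = measure lebesgue (\<Union>x\<in>J. E \<inter> ?d x)"
  proof (rule measure_UNION'[symmetric])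
    show "pairwise (\<lambda>i j. disjnt (E \<inter> ?d i) (E \<inter> ?d j)) J"
      unfolding pairwise_def disjnt_def using J(3) by blast
  qed (use finJ m in auto)
  also have "\<dots> \<le> measure lebesgue E"
    using E m finJ by (intro measure_mono_fmeasurable) (auto intro!: fmeasurableD)
  finally show ?thesis .
qed

text \<open>A factor 3 for each density class, times the factor 2 / (\<delta> * ln 2) from the bound
  \<open>Nb\<close> on the number of classes.\<close>

definition tree_const :: "real \<Rightarrow> real" where "tree_const \<delta> = 6 / (\<delta> * ln 2)"

lemma tree_const_pos: "\<delta> > 0 \<Longrightarrow> tree_const \<delta> > 0" by (simp add: tree_const_def)

text \<open>An \<open>L log L\<close> estimate: the tiles are sorted by the largest density of \<open>Em\<close> above them, and each of
  the \<open>log (1/s)\<close> classes contributes \<open>O (|Em \<inter> I|)\<close>.\<close>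

lemma paraproduct_tree:
  assumes fo: "fo \<in> Xset Eo" and Eo: "Eo \<in> lmeasurable" and fm: "fm \<in> Xset Em" and Em: "Em \<in> lmeasurable"
    and fin: "finite Ps" and js: "jo \<in> {2,3}" "jm \<in> {2,3}" and \<delta>: "0 < \<delta>" "\<delta> \<le> 1"
  shows "(\<Sum>P\<in>Ps \<inter> itree 1 R. coef fo jo P * coef fm jm P) \<le>
    tree_const \<delta> * len R * (measure lebesgue (Em \<inter> dy (kk R) (nn R)) / len R) powr (1 - \<delta>)"
proof -
  let ?I = "dy (kk R) (nn R)"
  define m where "m = measure lebesgue (Em \<inter> ?I)"
  define s where "s = m / len R"
  have EI: "Em \<inter> ?I \<in> lmeasurable" using Em by (intro fmeasurable.Int) auto
  have ml: "m \<le> len R"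
    using measure_mono_fmeasurable[of "Em \<inter> ?I" ?I lebesgue] EI by (simp add: m_def len_def measure_dy fmeasurableD)
  have m0: "m \<ge> 0" by (simp add: m_def)
  show ?thesis
  proof (cases "m = 0")
    case True
    have "coef fm jm P = 0" if "P \<in> itree 1 R" for P
    proof -
      have "dsub (kk P) (nn P) (kk R) (nn R)" using that by (simp add: itree_def tile_le_def)
      then have "dy (kk P) (nn P) \<subseteq> ?I" by (rule dsub_dy)
      then have "measure lebesgue (Em \<inter> dy (kk P) (nn P)) \<le> m" unfolding m_def
        using EI Em by (intro measure_mono_fmeasurable) (auto intro!: fmeasurableD fmeasurable.Int)
      then have "measure lebesgue (Em \<inter> dy (kk P) (nn P)) = 0" using True by (simp add: order_antisym)
      then show ?thesis using norm_winner_Xset[OF fm Em, of "subtile P jm"] by (simp add: coef_def)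
    qed
    then have "(\<Sum>P\<in>Ps \<inter> itree 1 R. coef fo jo P * coef fm jm P) = 0" by (intro sum.neutral) auto
    then show ?thesis using tree_const_pos[OF \<delta>(1)] by (simp add: less_imp_le)
  next
    case False
    then have mp: "m > 0" using m0 by simp
    have s: "0 < s" "s \<le> 1" using mp ml by (auto simp: s_def)
    \<comment> \<open>Quartiles for which every interval between I_P and I_R has density at most
      2^(-j); consecutive differences are the density classes.\<close>
    define PP where "PP j = {P\<in>Ps \<inter> itree 1 R. \<forall>k n. kk R \<le> k \<longrightarrow> dsub (kk P) (nn P) k n \<longrightarrow>
       measure lebesgue (Em \<inter> dy k n) \<le> (1 / 2) ^ j * 2 powr (- real_of_int k)}" for j :: nat
    let ?f = "\<lambda>P. coef fo jo P * coef fm jm P"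
    have finPP: "finite (PP j)" for j using fin by (simp add: PP_def)
    have PP0: "PP 0 = Ps \<inter> itree 1 R"
    proof -
      have "measure lebesgue (Em \<inter> dy k n) \<le> 2 powr (- real_of_int k)" for k n
        using measure_mono_fmeasurable[of "Em \<inter> dy k n" "dy k n" lebesgue] Em
        by (auto simp: measure_dy intro!: fmeasurableD fmeasurable.Int)
      then show ?thesis by (auto simp: PP_def)
    qed
    have mono: "PP (Suc j) \<subseteq> PP j" for j
    proof
      fix P assume P: "P \<in> PP (Suc j)"
      have "measure lebesgue (Em \<inter> dy k n) \<le> (1 / 2) ^ j * 2 powr (- real_of_int k)"
        if "kk R \<le> k" "dsub (kk P) (nn P) k n" for k n
      proof -
        have "measure lebesgue (Em \<inter> dy k n) \<le> (1 / 2) ^ Suc j * 2 powr (- real_of_int k)"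
          using P that unfolding PP_def by blast
        also have "\<dots> \<le> (1 / 2) ^ j * 2 powr (- real_of_int k)" by (intro mult_right_mono) auto
        finally show ?thesis .
      qed
      then show "P \<in> PP j" using P unfolding PP_def by blast
    qed
    \<comment> \<open>The intervals too dense for class j + 1 have a union U of measure at most
      2^(j+1) m. Bessel's inequality on U bounds the squares for \<open>fo\<close>, the Carleson
      estimate at density 2^(-j) bounds those for \<open>fm\<close> by 4 * 2^(-j) m. The powers of 2
      cancel, and sqrt 8 <= 3.\<close>
    have layer: "sum ?f (PP j - PP (Suc j)) \<le> 3 * m" for j
    proof -
      let ?D = "PP j - PP (Suc j)"
      have DI: "?D \<subseteq> itree 1 R" by (auto simp: PP_def)
      have "\<forall>P\<in>?D. \<exists>kn. kk R \<le> fst kn \<and> dsub (kk P) (nn P) (fst kn) (snd kn) \<and>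
        measure lebesgue (Em \<inter> dy (fst kn) (snd kn)) > (1 / 2) ^ Suc j * 2 powr (- real_of_int (fst kn))"
      proof
        fix P assume P: "P \<in> ?D"
        then have "\<not> (\<forall>k n. kk R \<le> k \<longrightarrow> dsub (kk P) (nn P) k n \<longrightarrow>
          measure lebesgue (Em \<inter> dy k n) \<le> (1 / 2) ^ Suc j * 2 powr (- real_of_int k))"
          unfolding PP_def by blast
        then obtain k n where "kk R \<le> k" "dsub (kk P) (nn P) k n"
          "\<not> measure lebesgue (Em \<inter> dy k n) \<le> (1 / 2) ^ Suc j * 2 powr (- real_of_int k)" by blast
        then show "\<exists>kn. kk R \<le> fst kn \<and> dsub (kk P) (nn P) (fst kn) (snd kn) \<and>
          measure lebesgue (Em \<inter> dy (fst kn) (snd kn)) > (1 / 2) ^ Suc j * 2 powr (- real_of_int (fst kn))"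
          by (intro exI[of _ "(k,n)"]) (simp only: fst_conv snd_conv not_le simp_thms)
      qed
      then obtain g where g: "\<forall>P\<in>?D. kk R \<le> fst (g P) \<and> dsub (kk P) (nn P) (fst (g P)) (snd (g P)) \<and>
        measure lebesgue (Em \<inter> dy (fst (g P)) (snd (g P))) > (1 / 2) ^ Suc j * 2 powr (- real_of_int (fst (g P)))"
        by (rule bchoice[THEN exE]) blast
      define U where "U = (\<Union>(k,n)\<in>g ` ?D. dy k n)"
      have gR: "dy (fst (g P)) (snd (g P)) \<subseteq> ?I" if "P \<in> ?D" for P
      proof -
        have "dsub (kk P) (nn P) (kk R) (nn R)" using that DI by (auto simp: itree_def tile_le_def)
        then have "dsub (fst (g P)) (snd (g P)) (kk R) (nn R)"
          by (rule dsub_mid) (use g that in \<open>auto simp: dsub_def\<close>)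
        then show ?thesis by (rule dsub_dy)
      qed
      have "(1 / 2) ^ Suc j * measure lebesgue U \<le> m" unfolding U_def m_def
      proof (rule dyadic_weak_type)
        fix k n assume "(k, n) \<in> g ` ?D"
        then obtain P where P: "P \<in> ?D" "g P = (k, n)" by auto
        have "(Em \<inter> ?I) \<inter> dy k n = Em \<inter> dy k n" using gR[OF P(1)] P(2) by auto
        then show "(1 / 2) ^ Suc j * 2 powr (- real_of_int k) \<le> measure lebesgue ((Em \<inter> ?I) \<inter> dy k n)"
          using bspec[OF g P(1)] P(2) by simp
      qed (use finPP EI in auto)
      then have mU: "measure lebesgue U \<le> 2 ^ Suc j * m" by (simp add: power_one_over field_simps)
      have Um: "U \<in> lmeasurable" unfolding U_def case_prod_beta
        using finPP by (intro fmeasurable.finite_UN) auto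
      have DU: "dy (kk P) (nn P) \<subseteq> U" if "P \<in> ?D" for P
        using dsub_dy[of "kk P" "nn P" "fst (g P)" "snd (g P)"] g that unfolding U_def by (fastforce simp: case_prod_beta)
      have anti: "antichain jo ?D"
        by (rule antichain_subset[OF itree_antichain[of 1 jo R] DI]) (use js in auto)
      have "(\<Sum>P\<in>?D. (coef fo jo P)\<^sup>2) \<le> measure lebesgue (Eo \<inter> U)" unfolding coef_def
        by (rule bessel_local[OF fo Eo _ _ anti _ DU]) (use Um finPP js in auto)
      also have "\<dots> \<le> measure lebesgue U"
        using Um Eo by (intro measure_mono_fmeasurable) (auto intro!: fmeasurableD fmeasurable.Int)
      finally have 1: "(\<Sum>P\<in>?D. (coef fo jo P)\<^sup>2) \<le> (sqrt (2 ^ Suc j * m))\<^sup>2" using mU m0 by simp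
      have "(\<Sum>P\<in>?D. (coef fm jm P)\<^sup>2) \<le> (\<Sum>P\<in>PP j \<inter> itree 1 R. (coef fm jm P)\<^sup>2)"
        using finPP DI by (intro sum_mono2) auto
      also have "\<dots> \<le> 4 * (1 / 2) ^ j * measure lebesgue (Em \<inter> ?I)"
      proof (rule coef_tree[OF fm Em finPP])
        show "measure lebesgue (Em \<inter> dy k n) \<le> (1 / 2) ^ j * 2 powr (- real_of_int k)"
          if "Q \<in> PP j" "kk R \<le> k" "dsub (kk Q) (nn Q) k n" for Q k n
          using that unfolding PP_def by blast
      qed (use js in auto)
      finally have 2: "(\<Sum>P\<in>?D. (coef fm jm P)\<^sup>2) \<le> (sqrt (4 * (1 / 2) ^ j * m))\<^sup>2" using m0 by (simp add: m_def)
      have "sum ?f ?D \<le> sqrt (2 ^ Suc j * m) * sqrt (4 * (1 / 2) ^ j * m)"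
        by (rule sum_mult_le_sqrt[OF _ _ 1 2]) (use m0 in auto)
      also have "\<dots> = sqrt (8 * m\<^sup>2)"
        by (simp add: real_sqrt_mult[symmetric] power2_eq_square power_one_over)
      also have "\<dots> \<le> sqrt ((3 * m)\<^sup>2)" by (intro real_sqrt_le_mono) (simp add: power_mult_distrib)
      also have "\<dots> = 3 * m" using m0 by (simp only: real_sqrt_abs)
      finally show ?thesis .
    qed
    have tele: "sum ?f (PP 0) \<le> real N * (3 * m) + sum ?f (PP N)" for N
    proof (induction N)
      case (Suc N)
      have "sum ?f (PP N) = sum ?f (PP N - PP (Suc N)) + sum ?f (PP (Suc N))"
        by (rule sum.subset_diff[OF mono finPP])
      then show ?case using Suc layer[of N] by (simp add: algebra_simps)
    qed simp
    obtain N0 where "(1 / 2) ^ N0 < s" using real_arch_pow_inv[of s "1 / 2"] s by auto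
    define N where "N = (LEAST N. (1 / 2) ^ N < s)"
    have N: "(1 / 2) ^ N < s" unfolding N_def by (rule LeastI[of _ N0]) fact
    have "N \<noteq> 0"
    proof
      assume "N = 0" then show False using N s by simp
    qed
    then obtain N' where N': "N = Suc N'" by (cases N) auto
    have "\<not> (1 / 2) ^ N' < s"
      using not_less_Least[of N' "\<lambda>N. (1 / 2) ^ N < s"] N' unfolding N_def by simp
    then have "2 ^ N * s \<le> 2" by (simp add: N' power_one_over field_simps)
    then have twoN: "2 ^ N \<le> 2 / s" using s by (simp add: field_simps)
    \<comment> \<open>At level N even the top interval, of density s, is too dense.\<close>
    have PPN: "PP N = {}"
    proof (rule ccontr)
      assume "PP N \<noteq> {}"
      then obtain P where P: "P \<in> PP N" by blast
      then have "dsub (kk P) (nn P) (kk R) (nn R)" by (auto simp: PP_def itree_def tile_le_def)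
      then have "m \<le> (1 / 2) ^ N * len R" using P unfolding PP_def m_def len_def by blast
      then have "s \<le> (1 / 2) ^ N" unfolding s_def by (simp add: field_simps)
      then show False using N by simp
    qed
    have Nb: "real N \<le> 2 * s powr (- \<delta>) / (\<delta> * ln 2)"
    proof -
      \<comment> \<open>The inequality t <= exp t trades the logarithm of 1 / s for a small
        power.\<close>
      have "real N * (\<delta> * ln 2) \<le> exp (real N * (\<delta> * ln 2))"
        using exp_ge_add_one_self[of "real N * (\<delta> * ln 2)"] by linarith
      also have "\<dots> = (2 ^ N) powr \<delta>"
        by (simp add: powr_def ln_realpow mult_ac)
      also have "\<dots> \<le> (2 / s) powr \<delta>" using twoN \<delta> by (intro powr_mono2) auto
      also have "\<dots> = 2 powr \<delta> * s powr (- \<delta>)" using s by (simp add: powr_divide powr_minus field_simps)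
      also have "\<dots> \<le> 2 powr 1 * s powr (- \<delta>)" using \<delta> by (intro mult_right_mono powr_mono) auto
      finally have "real N * (\<delta> * ln 2) \<le> 2 * s powr (- \<delta>)" by simp
      then show ?thesis using \<delta> by (simp add: field_simps)
    qed
    have "sum ?f (Ps \<inter> itree 1 R) \<le> real N * (3 * m)" using tele[of N] unfolding PP0 PPN by simp
    also have "\<dots> \<le> 2 * s powr (- \<delta>) / (\<delta> * ln 2) * (3 * m)" using Nb m0 by (intro mult_right_mono) auto
    also have "\<dots> = tree_const \<delta> * (m * s powr (- \<delta>))" by (simp add: tree_const_def)
    also have "m * s powr (- \<delta>) = len R * s powr (1 - \<delta>)"
      using s by (simp add: s_def powr_diff powr_minus field_simps)
    finally show ?thesis unfolding s_def m_def by (simp add: mult.assoc)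
  qed
qed

section \<open>The composed form\<close>

definition pair_coef :: "(real \<Rightarrow> complex) \<Rightarrow> (real \<Rightarrow> complex) \<Rightarrow> nat \<Rightarrow> nat \<Rightarrow> quartile \<Rightarrow> complex" where
  "pair_coef f g i j P = complex_of_real (wt P) * winner f (ph (subtile P i)) * winner g (ph (subtile P j))"

lemma norm_pair_coef: "norm (pair_coef f g i j P) = wt P * (coef f i P * coef g j P)"
  using less_imp_le[OF wt_pos[of P]] by (simp add: pair_coef_def norm_mult coef_def)

text \<open>The form that \<open>bilinear_bound\<close> takes: the 2 collects the constants of the
  two sizes, and the halved exponents come from the square roots in the energies.\<close>

definition pair_bound :: "real \<Rightarrow> real \<Rightarrow> real \<Rightarrow> real \<Rightarrow> real \<Rightarrow> real \<Rightarrow> real" where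
  "pair_bound \<delta> \<theta> l1 l2 m1 m2 = 2 * bht_const \<delta> * (l1 powr \<theta> * l2 powr (1 - \<theta>) * m1 powr ((1 - \<theta>) / 2) * m2 powr (\<theta> / 2))"

lemma pair_bound_eq:
  assumes "l1 > 0" "l2 > 0" "m1 > 0" "m2 > 0"
  shows "bht_const \<delta> * ((2 * l1) powr \<theta> * (2 * l2) powr (1 - \<theta>) * sqrt m1 powr (1 - \<theta>) * sqrt m2 powr \<theta>)
    = pair_bound \<delta> \<theta> l1 l2 m1 m2"
proof -
  have s: "sqrt m powr a = m powr (a / 2)" if "m > 0" for m a
    using that by (simp add: powr_half_sqrt[symmetric] powr_powr)
  have "(2::real) powr \<theta> * 2 powr (1 - \<theta>) = 2" by (simp add: powr_add[symmetric])
  then show ?thesis using assms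
    by (simp add: pair_bound_def s powr_mult)
qed

lemma pair_bound_pos: "\<delta> > 0 \<Longrightarrow> l1 > 0 \<Longrightarrow> l2 > 0 \<Longrightarrow> m1 > 0 \<Longrightarrow> m2 > 0 \<Longrightarrow> pair_bound \<delta> \<theta> l1 l2 m1 m2 > 0"
  using bht_const_pos by (simp add: pair_bound_def)

lemma bilinear_pair_bound:
  assumes fin: "finite PP" and k0: "\<And>P. P \<in> PP \<Longrightarrow> k0 \<le> kk P"
    and js: "{jd, j1, j2} = {1..3}" "j1 \<noteq> j2" "jd \<noteq> j1" "jd \<noteq> j2"
    and f: "f \<in> Xset F" "F \<in> lmeasurable" "measure lebesgue F > 0" "dens k0 PP F l1" "l1 > 0"
    and g: "g \<in> Xset G" "G \<in> lmeasurable" "measure lebesgue G > 0" "dens k0 PP G l2" "l2 > 0"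
    and dd: "\<And>P. d P \<ge> 0" "energy_le PP jd d N" "N > 0"
    and \<theta>: "0 < \<delta>" "\<delta> \<le> \<theta>" "\<theta> \<le> 1 - \<delta>"
  shows "(\<Sum>P\<in>PP. norm (pair_coef f g j1 j2 P) * d P) \<le>
    pair_bound \<delta> \<theta> l1 l2 (measure lebesgue F) (measure lebesgue G) * N"
proof -
  define h where "h j = (if j = j1 then f else g)" for j
  define H where "H j = (if j = j1 then F else G)" for j
  define l where "l j = (if j = j1 then l1 else l2)" for j
  have hs: "h j1 = f" "h j2 = g" "H j1 = F" "H j2 = G" "l j1 = l1" "l j2 = l2"
    using js(2) by (auto simp: h_def H_def l_def)
  have "(\<Sum>P\<in>PP. wt P * (coef (h j1) j1 P * coef (h j2) j2 P * d P)) \<le>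
    bht_const \<delta> * ((2 * l j1) powr \<theta> * (2 * l j2) powr (1 - \<theta>)
      * sqrt (measure lebesgue (H j1)) powr (1 - \<theta>) * sqrt (measure lebesgue (H j2)) powr \<theta>) * N"
  proof (rule bilinear_bound[OF fin k0 js _ _ _ _ _ dd \<theta>])
    fix j assume j: "j \<in> {j1, j2}"
    show "h j \<in> Xset (H j)" "H j \<in> lmeasurable" "measure lebesgue (H j) > 0" "dens k0 PP (H j) (l j)" "l j > 0"
      using f g by (auto simp: h_def H_def l_def)
  qed
  then show ?thesis unfolding hs norm_pair_coef pair_bound_eq[OF f(5) g(5) f(3) g(3)] by (simp add: mult.assoc)
qed

text \<open>These are the coefficients of the inner operator on the tiles P_1. Dualizing moves the
  sum to Qs, so the densities are those above the Q.\<close>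

lemma energy_outer:
  assumes fin: "finite Ps" "finite Qs" and k0: "\<And>Q. Q \<in> Qs \<Longrightarrow> k0 \<le> kk Q"
    and f: "f \<in> Xset F" "F \<in> lmeasurable" "measure lebesgue F > 0" "dens k0 Qs F l1" "l1 > 0"
    and g: "g \<in> Xset G" "G \<in> lmeasurable" "measure lebesgue G > 0" "dens k0 Qs G l2" "l2 > 0"
    and \<theta>: "0 < \<delta>" "\<delta> \<le> \<theta>" "\<theta> \<le> 1 - \<delta>"
  shows "energy_le Ps 1 (\<lambda>P. norm (\<Sum>Q\<in>Qs. pair_coef f g 1 2 Q * K Q P))
    (pair_bound \<delta> \<theta> l1 l2 (measure lebesgue F) (measure lebesgue G))"
proof (rule energy_dual[where jA=3])
  show "(\<Sum>x\<in>D'. (norm (\<Sum>y\<in>D. v y * K x y))\<^sup>2) \<le> (\<Sum>y\<in>D. (norm (v y))\<^sup>2)"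
    if "D \<subseteq> Ps" "antichain 1 D" "D' \<subseteq> Qs" "antichain 3 D'" for D D' v
    using that fin finite_subset by (intro K_contraction_1) auto
  show "(\<Sum>x\<in>Qs. norm (pair_coef f g 1 2 x) * d x) \<le> pair_bound \<delta> \<theta> l1 l2 (measure lebesgue F) (measure lebesgue G) * N"
    if "\<And>x. d x \<ge> 0" "N > 0" "energy_le Qs 3 d N" for d N
    by (rule bilinear_pair_bound[OF fin(2) k0 _ _ _ _ f g that(1,3,2) \<theta>]) auto
  show "pair_bound \<delta> \<theta> l1 l2 (measure lebesgue F) (measure lebesgue G) \<ge> 0"
    using pair_bound_pos f g \<theta> by (simp add: less_imp_le)
qed (use fin in auto)

text \<open>The transposed statement: the dual coefficients live on Qs, and their energy is governed
  by densities above the P.\<close>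

lemma energy_inner:
  assumes fin: "finite Ps" "finite Qs" and k0: "\<And>P. P \<in> Ps \<Longrightarrow> k0 \<le> kk P"
    and f: "f \<in> Xset F" "F \<in> lmeasurable" "measure lebesgue F > 0" "dens k0 Ps F l1" "l1 > 0"
    and g: "g \<in> Xset G" "G \<in> lmeasurable" "measure lebesgue G > 0" "dens k0 Ps G l2" "l2 > 0"
    and \<theta>: "0 < \<delta>" "\<delta> \<le> \<theta>" "\<theta> \<le> 1 - \<delta>"
  shows "energy_le Qs 3 (\<lambda>Q. norm (\<Sum>P\<in>Ps. pair_coef f g 2 3 P * K Q P))
    (pair_bound \<delta> \<theta> l1 l2 (measure lebesgue F) (measure lebesgue G))"
proof (rule energy_dual[where jA=1 and k="\<lambda>P Q. K Q P"])
  show "(\<Sum>x\<in>D'. (norm (\<Sum>y\<in>D. v y * K y x))\<^sup>2) \<le> (\<Sum>y\<in>D. (norm (v y))\<^sup>2)"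
    if "D \<subseteq> Qs" "antichain 3 D" "D' \<subseteq> Ps" "antichain 1 D'" for D D' v
    using that fin finite_subset by (intro K_contraction_2) auto
  show "(\<Sum>x\<in>Ps. norm (pair_coef f g 2 3 x) * d x) \<le> pair_bound \<delta> \<theta> l1 l2 (measure lebesgue F) (measure lebesgue G) * N"
    if "\<And>x. d x \<ge> 0" "N > 0" "energy_le Ps 1 d N" for d N
    by (rule bilinear_pair_bound[OF fin(1) k0 _ _ _ _ f g that(1,3,2) \<theta>]) auto
  show "pair_bound \<delta> \<theta> l1 l2 (measure lebesgue F) (measure lebesgue G) \<ge> 0"
    using pair_bound_pos f g \<theta> by (simp add: less_imp_le)
qed (use fin in auto)

definition Lam :: "quartile set \<Rightarrow> quartile set \<Rightarrow> (real \<Rightarrow> complex) \<Rightarrow> (real \<Rightarrow> complex) \<Rightarrow>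
    (real \<Rightarrow> complex) \<Rightarrow> (real \<Rightarrow> complex) \<Rightarrow> complex" where
  "Lam Ps Qs f1 f2 f3 f4 = (\<Sum>P\<in>Ps. \<Sum>Q\<in>Qs. pair_coef f1 f2 1 2 Q * pair_coef f3 f4 2 3 P * K Q P)"

text \<open>The size--energy inequality over Ps, where the energy of the third coefficient is
  supplied by the same inequality over Qs.\<close>

lemma Lam_bound_energy:
  assumes fin: "finite Ps" "finite Qs" and k0: "\<And>P. P \<in> Ps \<union> Qs \<Longrightarrow> k0 \<le> kk P"
    and f1: "f1 \<in> Xset E1" "E1 \<in> lmeasurable" "measure lebesgue E1 > 0" "dens k0 Qs E1 l1" "l1 > 0"
    and f2: "f2 \<in> Xset E2" "E2 \<in> lmeasurable" "measure lebesgue E2 > 0" "dens k0 Qs E2 l2" "l2 > 0"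
    and f3: "f3 \<in> Xset E3" "E3 \<in> lmeasurable" "measure lebesgue E3 > 0" "dens k0 Ps E3 l3" "l3 > 0"
    and f4: "f4 \<in> Xset E4" "E4 \<in> lmeasurable" "measure lebesgue E4 > 0" "dens k0 Ps E4 l4" "l4 > 0"
    and \<theta>: "0 < \<delta>" "\<delta> \<le> \<theta>" "\<theta> \<le> 1 - \<delta>" and \<eta>: "\<delta> \<le> \<eta>" "\<eta> \<le> 1 - \<delta>"
  shows "norm (Lam Ps Qs f1 f2 f3 f4) \<le>
    pair_bound \<delta> \<eta> l3 l4 (measure lebesgue E3) (measure lebesgue E4) *
    pair_bound \<delta> \<theta> l1 l2 (measure lebesgue E1) (measure lebesgue E2)"
proof -
  define a where "a P = norm (\<Sum>Q\<in>Qs. pair_coef f1 f2 1 2 Q * K Q P)" for P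
  have "Lam Ps Qs f1 f2 f3 f4 = (\<Sum>P\<in>Ps. pair_coef f3 f4 2 3 P * (\<Sum>Q\<in>Qs. pair_coef f1 f2 1 2 Q * K Q P))"
    unfolding Lam_def sum_distrib_left by (simp only: mult_ac)
  then have "norm (Lam Ps Qs f1 f2 f3 f4) \<le> (\<Sum>P\<in>Ps. norm (pair_coef f3 f4 2 3 P) * a P)"
    unfolding a_def norm_mult[symmetric] by (simp only: norm_sum)
  also have "\<dots> \<le> pair_bound \<delta> \<eta> l3 l4 (measure lebesgue E3) (measure lebesgue E4) *
    pair_bound \<delta> \<theta> l1 l2 (measure lebesgue E1) (measure lebesgue E2)"
  proof (rule bilinear_pair_bound[OF fin(1) _ _ _ _ _ f3 f4 _ _ _ \<theta>(1) \<eta>])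
    show "energy_le Ps 1 a (pair_bound \<delta> \<theta> l1 l2 (measure lebesgue E1) (measure lebesgue E2))"
      unfolding a_def by (rule energy_outer[OF fin _ f1 f2 \<theta>]) (use k0 in auto)
    show "pair_bound \<delta> \<theta> l1 l2 (measure lebesgue E1) (measure lebesgue E2) > 0"
      using pair_bound_pos f1 f2 \<theta> by simp
  qed (use k0 in \<open>auto simp: a_def\<close>)
  finally show ?thesis .
qed

section \<open>Sizes of the dual coefficients on a tree\<close>

lemma sum_dsub_split:
  fixes g :: "quartile \<Rightarrow> 'a::comm_monoid_add"
  assumes "finite A"
  shows "(\<Sum>P\<in>{P\<in>A. dsub (kk P) (nn P) k n}. g P) =
    (\<Sum>P\<in>{P\<in>A. dsub (kk P) (nn P) (k + 1) (2 * n)}. g P) + (\<Sum>P\<in>{P\<in>A. dsub (kk P) (nn P) (k + 1) (2 * n + 1)}. g P)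
    + (\<Sum>P\<in>{P\<in>A. kk P = k \<and> nn P = n}. g P)"
proof -
  let ?X = "\<lambda>k n. {P\<in>A. dsub (kk P) (nn P) k n}" and ?Y = "{P\<in>A. kk P = k \<and> nn P = n}"
  have iff: "dsub a b k n \<longleftrightarrow> (a = k \<and> b = n) \<or> dsub a b (k + 1) (2 * n) \<or> dsub a b (k + 1) (2 * n + 1)" for a b
    using tile_le_children[of "(a, b, 0)" k n 0] by (auto simp: tile_le_def fsub_def dsub_def)
  have "?X k n = (?X (k + 1) (2 * n) \<union> ?X (k + 1) (2 * n + 1)) \<union> ?Y" using iff by blast
  moreover have "?X (k + 1) (2 * n) \<inter> ?X (k + 1) (2 * n + 1) = {}"
    unfolding dsub_def by auto
  moreover have "(?X (k + 1) (2 * n) \<union> ?X (k + 1) (2 * n + 1)) \<inter> ?Y = {}"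
    unfolding dsub_def by auto
  ultimately show ?thesis using assms by (simp add: sum.union_disjoint)
qed

text \<open>The frequency index of Q_3 is 2 modulo 4, that of P_1 is 0 modulo 4. Parity excludes the
  scale differences 0 and 1, so the whole frequency interval of Q lies in that of P_1, together with
  every top below it.\<close>

lemma fsub_top_of_subtile:
  assumes "fsub (subtile Q 3) (subtile P 1)" "fsub t (subtile Q i)" "i \<in> {1..4}"
  shows "fsub t (subtile P 1)"
proof -
  define d where "d = nat (kk P - kk Q)"
  have k: "kk Q \<le> kk P" "kk t \<le> kk Q" and e: "(4 * ll Q + 2) div 2 ^ d = 4 * ll P"
    and ti: "ll t div 2 ^ nat (kk Q - kk t) = 4 * ll Q + i - 1"
    using assms(1,2) by (auto simp: fsub_def d_def)
  have "d \<noteq> 0"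
  proof
    assume "d = 0"
    then have "4 * ll Q + 2 = 4 * ll P" using e by simp
    then show False by presburger
  qed
  moreover have "d \<noteq> 1"
  proof
    assume "d = 1"
    then have "2 * ll Q + 1 = 4 * ll P" using e by simp
    then show False by presburger
  qed
  ultimately obtain d' where d': "d = d' + 2" by (metis One_nat_def Suc_1 add_2_eq_Suc' not0_implies_Suc)
  have "(4 * ll Q + i - 1) div 2 ^ d = (4 * ll Q + i - 1) div 4 div 2 ^ d'"
    by (simp add: d' div_mult2_eq[symmetric] mult.commute)
  also have "\<dots> = ll Q div 2 ^ d'" using div4[of i "ll Q"] assms(3) by simp
  also have "\<dots> = (4 * ll Q + 2) div 4 div 2 ^ d'" using div4[of 3 "ll Q"] by simp
  also have "\<dots> = 4 * ll P" unfolding e[symmetric] by (simp add: d' div_mult2_eq[symmetric] mult.commute)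
  finally have "ll t div 2 ^ nat (kk Q - kk t) div 2 ^ d = 4 * ll P" unfolding ti .
  moreover have "nat (kk P - kk t) = nat (kk Q - kk t) + d" using k by (simp add: d_def)
  ultimately show ?thesis using k by (simp add: fsub_def power_add div_mult2_eq)
qed

text \<open>On a tree with top t the truncation no longer sees the frequency of Q: it becomes a
  condition on P and t, together with nesting in time.\<close>

lemma K_tree:
  assumes "fsub t (subtile Q i)" "i \<in> {1..4}"
  shows "K Q P = (if fsub t (subtile P 1) \<and> dsub (kk P) (nn P) (kk Q) (nn Q)
    then winner (ph (subtile P 1)) (ph (subtile Q 3)) else 0)"
proof (cases "K Q P = 0")
  case False
  then have "tile_le (subtile P 1) (subtile Q 3)" by (rule K_nonzero)
  moreover have "fsub (subtile Q 3) (subtile P 1)" using False by (auto simp: K_def split: if_splits)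
  moreover have "fsub t (subtile P 1)" by (rule fsub_top_of_subtile[OF calculation(2) assms])
  ultimately show ?thesis by (simp add: K_def tile_le_def winner_ph_commute)
next
  case True
  have "winner (ph (subtile P 1)) (ph (subtile Q 3)) = 0" if "dsub (kk P) (nn P) (kk Q) (nn Q)"
  proof (rule ccontr)
    assume nz: "winner (ph (subtile P 1)) (ph (subtile Q 3)) \<noteq> 0"
    have "kk (subtile Q 3) \<le> kk (subtile P 1)" using that by (simp add: dsub_def)
    from norm_winner_ph[OF this] nz have "tile_le (subtile P 1) (subtile Q 3)" by (auto split: if_splits)
    then have "K Q P = winner (ph (subtile Q 3)) (ph (subtile P 1))" by (simp add: K_def tile_le_def)
    then show False using nz True winner_ph_commute[of "subtile P 1"] by simp
  qed
  then show ?thesis using True by simp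
qed

text \<open>The coefficients \<open>c\<close> satisfy the recursion of
  \<open>lacunary_carleson\<close> with a source: from the halves of an interval to the interval
  itself, the quartiles P over exactly this interval are added. The absolute mass M of the
  paraproduct dominates \<open>c\<close> and the sources.\<close>

lemma size_inner:
  assumes fin: "finite Ps" "finite Qs" and k0: "\<And>Q. Q \<in> Qs \<Longrightarrow> k0 \<le> kk Q"
    and tree: "\<And>R. (\<Sum>P\<in>Ps \<inter> itree 1 R. coef f 2 P * coef g 3 P) \<le>
      C * len R * (measure lebesgue (Em \<inter> dy (kk R) (nn R)) / len R) powr (1 - \<delta>)"
    and d: "dens k0 Qs Em \<rho>" and C: "C \<ge> 0" and \<delta>: "\<delta> \<le> 1"
  shows "size_le (tops Qs) Qs 3 (\<lambda>Q. norm (\<Sum>P\<in>Ps. pair_coef f g 2 3 P * K Q P)) (2 * (C * \<rho> powr (1 - \<delta>)))"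
  unfolding size_le_def
proof (intro ballI)
  fix i t assume i: "i \<in> {1..4} - {3::nat}" and t: "t \<in> tops Qs"
  have kt: "k0 \<le> kk t" by (rule tops_facts(3)[OF t k0])
  define lam where "lam = C * \<rho> powr (1 - \<delta>)"
  have lam0: "lam \<ge> 0" using C by (simp add: lam_def)
  define A where "A = {P\<in>Ps. fsub t (subtile P 1)}"
  have finA: "finite A" using fin by (simp add: A_def)
  define S where "S k n = {P\<in>A. dsub (kk P) (nn P) k n}" for k n
  define b where "b = pair_coef f g 2 3"
  define c where "c R = (\<Sum>P\<in>S (kk R) (nn R). b P * winner (ph (subtile P 1)) (ph R))" for R
  define \<delta>c where "\<delta>c R = (\<Sum>P\<in>{P\<in>A. kk P = kk R \<and> nn P = nn R}. b P * winner (ph (subtile P 1)) (ph R))" for R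
  define M where "M k n = (\<Sum>P\<in>S k n. coef f 2 P * coef g 3 P)" for k n
  have at: "(\<Sum>P\<in>Ps. pair_coef f g 2 3 P * K Q P) = c (subtile Q 3)" if "Q \<in> itree i t" for Q
  proof -
    have fs: "fsub t (subtile Q i)" using that by (simp add: itree_def tile_le_def)
    have "(\<Sum>P\<in>Ps. pair_coef f g 2 3 P * K Q P) = (\<Sum>P\<in>Ps. if fsub t (subtile P 1) \<and> dsub (kk P) (nn P) (kk Q) (nn Q)
      then b P * winner (ph (subtile P 1)) (ph (subtile Q 3)) else 0)"
      by (intro sum.cong refl) (subst K_tree[OF fs], use i in \<open>auto simp: b_def\<close>)
    also have "\<dots> = c (subtile Q 3)" unfolding c_def S_def A_def using fin
      by (simp add: sum.inter_filter[symmetric] conj_assoc)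
    finally show ?thesis .
  qed
  have good: "M k n \<le> lam * 2 powr (- real_of_int k)"
    if "Q \<in> Qs" "kk t \<le> k" "dsub (kk Q) (nn Q) k n" for Q k n
  proof -
    \<comment> \<open>The tile over (k, n) whose frequency interval contains that of t. All P in S k
      n lie in its 1-tree, where the paraproduct bound applies.\<close>
    define R where "R = (k, n, ll t div 2 ^ nat (k - kk t))"
    have tR: "fsub t R" using that by (simp add: fsub_def R_def)
    have sub: "S k n \<subseteq> Ps \<inter> itree 1 R"
    proof
      fix P assume P: "P \<in> S k n"
      then have "fsub t (subtile P 1)" "dsub (kk P) (nn P) k n" "P \<in> Ps" by (auto simp: S_def A_def)
      then show "P \<in> Ps \<inter> itree 1 R"
        using fsub_mid[OF _ tR, of "subtile P 1"] by (auto simp: itree_def tile_le_def R_def dsub_def)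
    qed
    have "M k n \<le> (\<Sum>P\<in>Ps \<inter> itree 1 R. coef f 2 P * coef g 3 P)"
      unfolding M_def using sub fin by (intro sum_mono2) auto
    also have "\<dots> \<le> C * len R * (measure lebesgue (Em \<inter> dy (kk R) (nn R)) / len R) powr (1 - \<delta>)" by (rule tree)
    also have "\<dots> \<le> C * len R * \<rho> powr (1 - \<delta>)"
    proof (intro mult_left_mono powr_mono2)
      have "measure lebesgue (Em \<inter> dy k n) \<le> \<rho> * 2 powr (- real_of_int k)"
        using d that kt unfolding dens_def by auto
      then show "measure lebesgue (Em \<inter> dy (kk R) (nn R)) / len R \<le> \<rho>"
        by (simp add: R_def len_def field_simps)
    qed (use C \<delta> in \<open>auto simp: less_imp_le\<close>)
    finally show ?thesis by (simp add: lam_def R_def len_def mult_ac)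
  qed
  have "(\<Sum>Q\<in>Qs \<inter> itree i t. (norm (c (subtile Q 3)))\<^sup>2) \<le> 4 * lam * M (kk t) (nn t)"
  proof (rule lacunary_carleson[where \<delta>=\<delta>c])
    fix k n :: int and l :: nat
    let ?w = "\<lambda>P R. winner (ph (subtile P 1)) (ph R)"
    let ?R0 = "(k + 1, 2 * n, l div 2)" and ?R1 = "(k + 1, 2 * n + 1, l div 2)"
    have wr: "?w P (k, n, l) = (?w P ?R0 + (-1) ^ l * ?w P ?R1) / sqrt 2" for P
      by (rule winner_rec) simp
    have z: "?w P (k', n', l') = 0" if "k' \<le> kk P" "\<not> dsub (kk P) (nn P) k' n'" for P k' n' l'
      using norm_winner_ph[of "(k', n', l')" "subtile P 1"] that by (auto simp: tile_le_def split: if_splits)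
    \<comment> \<open>A packet supported in one half of the interval has no coefficient on the other
      half.\<close>
    have z1: "?w P ?R1 = 0" if "P \<in> S (k + 1) (2 * n)" for P
      using that by (intro z) (auto simp: S_def dsub_def)
    have z0: "?w P ?R0 = 0" if "P \<in> S (k + 1) (2 * n + 1)" for P
      using that by (intro z) (auto simp: S_def dsub_def)
    have "c (k, n, l) = (\<Sum>P\<in>S (k + 1) (2 * n). b P * ?w P (k, n, l)) + (\<Sum>P\<in>S (k + 1) (2 * n + 1). b P * ?w P (k, n, l)) + \<delta>c (k, n, l)"
      unfolding c_def \<delta>c_def S_def fst_conv snd_conv by (rule sum_dsub_split[OF finA])
    also have "(\<Sum>P\<in>S (k + 1) (2 * n). b P * ?w P (k, n, l)) = (\<Sum>P\<in>S (k + 1) (2 * n). b P * ?w P ?R0) / sqrt 2"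
      unfolding sum_divide_distrib by (intro sum.cong refl) (simp only: wr z1 mult_zero_right add_0_right times_divide_eq_right)
    also have "(\<Sum>P\<in>S (k + 1) (2 * n + 1). b P * ?w P (k, n, l)) = (-1) ^ l * (\<Sum>P\<in>S (k + 1) (2 * n + 1). b P * ?w P ?R1) / sqrt 2"
      unfolding sum_divide_distrib sum_distrib_left by (intro sum.cong refl) (simp only: wr z0 add_0_left times_divide_eq_right mult.left_commute)
    also have "(\<Sum>P\<in>S (k + 1) (2 * n). b P * ?w P ?R0) = c ?R0" by (simp add: c_def)
    also have "(\<Sum>P\<in>S (k + 1) (2 * n + 1). b P * ?w P ?R1) = c ?R1" by (simp add: c_def)
    finally show "c (k, n, l) = (c ?R0 + (-1) ^ l * c ?R1) / sqrt 2 + \<delta>c (k, n, l)"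
      by (simp add: add_divide_distrib)
    have nw: "norm (?w P (k, n, l)) \<le> 2 powr ((real_of_int k - real_of_int (kk P)) / 2)" if "k \<le> kk P" for P
      using norm_winner_ph[of "(k, n, l)" "subtile P 1"] that by auto
    have nb: "norm (b P * ?w P (k, n, l)) \<le> 2 powr (real_of_int k / 2) * (coef f 2 P * coef g 3 P)" if "k \<le> kk P" for P
    proof -
      have "norm (b P * ?w P (k, n, l)) \<le> wt P * (coef f 2 P * coef g 3 P) * 2 powr ((real_of_int k - real_of_int (kk P)) / 2)"
        unfolding norm_mult b_def norm_pair_coef using nw[OF that] by (intro mult_left_mono) (auto simp: less_imp_le)
      also have "\<dots> = (wt P * 2 powr ((real_of_int k - real_of_int (kk P)) / 2)) * (coef f 2 P * coef g 3 P)" by simp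
      also have "wt P * 2 powr ((real_of_int k - real_of_int (kk P)) / 2) = 2 powr (real_of_int k / 2)"
        by (simp add: wt_def powr_add[symmetric] diff_divide_distrib)
      finally show ?thesis .
    qed
    show "norm (c (k, n, l)) \<le> 2 powr (real_of_int k / 2) * M k n"
    proof -
      have "norm (c (k, n, l)) \<le> (\<Sum>P\<in>S k n. norm (b P * ?w P (k, n, l)))" unfolding c_def by (simp add: norm_sum)
      also have "\<dots> \<le> (\<Sum>P\<in>S k n. 2 powr (real_of_int k / 2) * (coef f 2 P * coef g 3 P))"
        by (intro sum_mono nb) (auto simp: S_def dsub_def)
      finally show ?thesis by (simp add: M_def sum_distrib_left)
    qed
    show "M (k + 1) (2 * n) + M (k + 1) (2 * n + 1) + 2 powr (- real_of_int k / 2) * norm (\<delta>c (k, n, l)) \<le> M k n"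
    proof -
      have "norm (\<delta>c (k, n, l)) \<le> (\<Sum>P\<in>{P\<in>A. kk P = k \<and> nn P = n}. norm (b P * ?w P (k, n, l)))"
        unfolding \<delta>c_def by (simp add: norm_sum)
      also have "\<dots> \<le> (\<Sum>P\<in>{P\<in>A. kk P = k \<and> nn P = n}. 2 powr (real_of_int k / 2) * (coef f 2 P * coef g 3 P))"
        by (intro sum_mono nb) auto
      finally have "2 powr (- real_of_int k / 2) * norm (\<delta>c (k, n, l)) \<le>
        2 powr (- real_of_int k / 2) * (2 powr (real_of_int k / 2) * (\<Sum>P\<in>{P\<in>A. kk P = k \<and> nn P = n}. coef f 2 P * coef g 3 P))"
        by (intro mult_left_mono) (auto simp: sum_distrib_left)
      also have "\<dots> = (\<Sum>P\<in>{P\<in>A. kk P = k \<and> nn P = n}. coef f 2 P * coef g 3 P)"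
        by (simp add: mult.assoc[symmetric] powr_add[symmetric])
      finally show ?thesis unfolding M_def S_def by (simp add: sum_dsub_split[OF finA, of _ k n])
    qed
    show "M k n \<ge> 0" unfolding M_def by (intro sum_nonneg) auto
  next
    \<comment> \<open>The source at R comes from packets over the same interval; by orthonormality
      only P_1 = R contributes.\<close>
    fix R assume "\<delta>c R \<noteq> 0"
    then obtain P where "P \<in> {P\<in>A. kk P = kk R \<and> nn P = nn R}" "b P * winner (ph (subtile P 1)) (ph R) \<noteq> 0"
      unfolding \<delta>c_def by (rule sum.not_neutral_contains_not_neutral)
    then have P: "P \<in> A" "kk P = kk R" "nn P = nn R" "winner (ph (subtile P 1)) (ph R) \<noteq> 0" by simp_all
    then have "ll R = ll (subtile P 1)"
      using winner_ph_same_scale[of "kk P" "nn P" "ll (subtile P 1)" "nn R" "ll R"]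
      by (cases P; cases R) (auto simp: subtile_def split: if_splits)
    then have "R = subtile P 1" using P by (simp add: prod_eq_iff)
    then show "fsub t R" using P(1) by (simp add: A_def)
  next
    show "M k n \<le> lam * 2 powr (- real_of_int k)"
      if "Q \<in> Qs" "kk t \<le> k" "dsub (kk Q) (nn Q) k n" for Q k n by (rule good[OF that])
  qed (use fin i lam0 in auto)
  also have "(\<Sum>Q\<in>Qs \<inter> itree i t. (norm (c (subtile Q 3)))\<^sup>2) = (\<Sum>Q\<in>Qs \<inter> itree i t. (norm (\<Sum>P\<in>Ps. pair_coef f g 2 3 P * K Q P))\<^sup>2)"
    by (intro sum.cong refl) (simp add: at)
  finally have le: "(\<Sum>Q\<in>Qs \<inter> itree i t. (norm (\<Sum>P\<in>Ps. pair_coef f g 2 3 P * K Q P))\<^sup>2) \<le> 4 * lam * M (kk t) (nn t)" .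
  show "(\<Sum>Q\<in>Qs \<inter> itree i t. (norm (\<Sum>P\<in>Ps. pair_coef f g 2 3 P * K Q P))\<^sup>2) \<le> (2 * (C * \<rho> powr (1 - \<delta>)))\<^sup>2 * len t"
  proof (cases "Qs \<inter> itree i t = {}")
    case True
    show ?thesis unfolding True by (simp add: less_imp_le)
  next
    case False
    then obtain Q where "Q \<in> Qs" "dsub (kk Q) (nn Q) (kk t) (nn t)" by (auto simp: itree_def tile_le_def)
    then have "M (kk t) (nn t) \<le> lam * len t" using good[of Q "kk t" "nn t"] by (simp add: len_def)
    then have "4 * lam * M (kk t) (nn t) \<le> 4 * lam * (lam * len t)" using lam0 by (intro mult_left_mono) auto
    then show ?thesis using le by (simp add: lam_def[symmetric] power2_eq_square mult_ac)
  qed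
qed

text \<open>In order: the size--energy constant, the sizes of the two direct coefficients, and the
  size and the energy of the dual coefficient.\<close>

definition size_const :: "real \<Rightarrow> real" where
  "size_const \<delta> = bht_const (\<delta> / 2) * 2 powr \<delta> * (2 * tree_const \<delta>) powr (1 - \<delta>) * (2 * bht_const (1 / 2)) powr \<delta>"

lemma dens_one: assumes "E \<in> lmeasurable" shows "dens k0 PP E 1"
proof -
  have "measure lebesgue (E \<inter> dy k n) \<le> 2 powr (- real_of_int k)" for k n
    using measure_mono_fmeasurable[of "E \<inter> dy k n" "dy k n" lebesgue] assms
    by (auto simp: measure_dy intro!: fmeasurableD fmeasurable.Int)
  then show ?thesis by (simp add: dens_def)
qed

text \<open>The size exponents are \<delta>/2, \<delta>/2 and 1 - \<delta>: nearly everything rests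
  on the size of the dual coefficients, while f1 and f2 enter through their energies. The tree
  estimate gives density exponent 1 - \<delta>, and the size exponent turns it into the
  square.\<close>

lemma Lam_bound_size:
  assumes fin: "finite Ps" "finite Qs" and k0: "\<And>P. P \<in> Ps \<union> Qs \<Longrightarrow> k0 \<le> kk P"
    and f1: "f1 \<in> Xset E1" "E1 \<in> lmeasurable" "measure lebesgue E1 > 0"
    and f2: "f2 \<in> Xset E2" "E2 \<in> lmeasurable" "measure lebesgue E2 > 0"
    and f3: "f3 \<in> Xset E3" "E3 \<in> lmeasurable" "measure lebesgue E3 > 0"
    and f4: "f4 \<in> Xset E4" "E4 \<in> lmeasurable" "measure lebesgue E4 > 0"
    and Em: "Em = E3 \<or> Em = E4" "dens k0 Qs Em \<rho>" "\<rho> > 0" and \<delta>: "0 < \<delta>" "\<delta> \<le> 1"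
  shows "norm (Lam Ps Qs f1 f2 f3 f4) \<le> size_const \<delta> *
    (measure lebesgue E1 powr (1 / 2 - \<delta> / 4) * measure lebesgue E2 powr (1 / 2 - \<delta> / 4) *
     measure lebesgue E3 powr (\<delta> / 4) * measure lebesgue E4 powr (\<delta> / 4)) * \<rho> powr ((1 - \<delta>)\<^sup>2)"
proof -
  define e1 e2 e3 e4 where "e1 = measure lebesgue E1" and "e2 = measure lebesgue E2"
    and "e3 = measure lebesgue E3" and "e4 = measure lebesgue E4"
  have ep: "e1 > 0" "e2 > 0" "e3 > 0" "e4 > 0" using f1 f2 f3 f4 by (auto simp: e1_def e2_def e3_def e4_def)
  define av where "av Q = norm (\<Sum>P\<in>Ps. pair_coef f3 f4 2 3 P * K Q P)" for Q
  define S3 where "S3 = 2 * (tree_const \<delta> * \<rho> powr (1 - \<delta>))"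
  \<comment> \<open>This energy enters only to the power \<delta>, so the trivial densities 1 and
    the middle exponent 1/2 suffice.\<close>
  define N where "N = pair_bound (1 / 2) (1 / 2) 1 1 e3 e4"
  have tc: "tree_const \<delta> > 0" by (rule tree_const_pos[OF \<delta>(1)])
  have S3: "S3 > 0" using tc Em(3) by (simp add: S3_def)
  have N: "N > 0" unfolding N_def using ep by (intro pair_bound_pos) auto
  have en: "energy_le Qs 3 av N" unfolding av_def N_def e3_def e4_def
    by (rule energy_inner[OF fin _ f3 dens_one[OF f3(2)] _ f4 dens_one[OF f4(2)], of k0]) (use k0 in auto)
  have tree: "(\<Sum>P\<in>Ps \<inter> itree 1 R. coef f3 2 P * coef f4 3 P) \<le>
      tree_const \<delta> * len R * (measure lebesgue (Em \<inter> dy (kk R) (nn R)) / len R) powr (1 - \<delta>)" for R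
  proof (cases "Em = E4")
    case True
    then show ?thesis using paraproduct_tree[OF f3(1,2) f4(1,2) fin(1) _ _ \<delta>, of 2 3] by simp
  next
    case False
    then have "Em = E3" using Em(1) by simp
    then show ?thesis using paraproduct_tree[OF f4(1,2) f3(1,2) fin(1) _ _ \<delta>, of 3 2] by (simp add: mult.commute)
  qed
  have sz: "size_le (tops Qs) Qs 3 av S3" unfolding av_def S3_def
    by (rule size_inner[OF fin _ tree Em(2) less_imp_le[OF tc] \<delta>(2)]) (use k0 in auto)
  define a where "a j = (if j = 1 then coef f1 1 else if j = 2 then coef f2 2 else av)" for j :: nat
  define S where "S j = (if j = 1 \<or> j = 2 then 2 else S3)" for j :: nat
  define E where "E j = (if j = 1 then sqrt e1 else if j = 2 then sqrt e2 else N)" for j :: nat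
  define th where "th j = (if j = 1 \<or> j = 2 then \<delta> / 2 else 1 - \<delta>)" for j :: nat
  have three: "{1..3} = {1,2,3::nat}" by auto
  have tl: "k0 \<le> kk t" if "t \<in> tops Qs" for t using tops_facts(3)[OF that] k0 by auto
  have "(\<Sum>Q\<in>Qs. wt Q * a 1 Q * a 2 Q * a 3 Q) \<le>
    bht_const (\<delta> / 2) * (\<Prod>j\<in>{1..3}. S j powr th j * E j powr (1 - th j))"
  proof (rule trilinear_size_energy[where TT="tops Qs" and ?j0.0=1])
    show "a j P \<ge> 0" for j P by (auto simp: a_def av_def)
    show "S j > 0" for j using S3 by (auto simp: S_def)
    show "E j > 0" for j using ep N by (auto simp: E_def)
    show "energy_le Qs j (a j) (E j)" if "j \<in> {1..3}" for j
      using that energy_coef[OF f1(1,2) fin(2), of 1] energy_coef[OF f2(1,2) fin(2), of 2] en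
      unfolding three by (auto simp: a_def E_def e1_def e2_def)
    show "size_le (tops Qs) Qs j (a j) (S j)" if "j \<in> {1..3}" for j
      using that size_coef[OF f1(1,2) fin(2) dens_one[OF f1(2)] _ tl, of "tops Qs" 1]
        size_coef[OF f2(1,2) fin(2) dens_one[OF f2(2)] _ tl, of "tops Qs" 2] sz
      unfolding three by (auto simp: a_def S_def)
    show "0 \<le> th j \<and> th j \<le> 1" for j using \<delta> by (auto simp: th_def)
    show "(\<Sum>j\<in>{1..3}. th j) = 1" unfolding three by (simp add: th_def)
  qed (use fin tops_facts \<delta> in \<open>auto simp: th_def\<close>)
  also have "(\<Prod>j\<in>{1..3}. S j powr th j * E j powr (1 - th j)) =
    2 powr \<delta> * S3 powr (1 - \<delta>) * (e1 powr (1 / 2 - \<delta> / 4) * e2 powr (1 / 2 - \<delta> / 4)) * N powr \<delta>"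
  proof -
    have s: "sqrt m powr (1 - \<delta> / 2) = m powr (1 / 2 - \<delta> / 4)" if "m > 0" for m
      using that by (simp add: powr_half_sqrt[symmetric] powr_powr diff_divide_distrib)
    have t: "(2::real) powr (\<delta> / 2) * 2 powr (\<delta> / 2) = 2 powr \<delta>" by (simp add: powr_add[symmetric])
    have "(\<Prod>j\<in>{1..3}. S j powr th j * E j powr (1 - th j)) =
      (2 powr (\<delta> / 2) * 2 powr (\<delta> / 2)) * S3 powr (1 - \<delta>) * (sqrt e1 powr (1 - \<delta> / 2) * sqrt e2 powr (1 - \<delta> / 2)) * N powr \<delta>"
      unfolding prod_three by (simp add: S_def E_def th_def)
    then show ?thesis unfolding t s[OF ep(1)] s[OF ep(2)] .
  qed
  also have "S3 powr (1 - \<delta>) = (2 * tree_const \<delta>) powr (1 - \<delta>) * \<rho> powr ((1 - \<delta>)\<^sup>2)"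
    using tc Em(3) by (simp add: S3_def powr_mult powr_powr power2_eq_square)
  also have "N powr \<delta> = (2 * bht_const (1 / 2)) powr \<delta> * (e3 powr (\<delta> / 4) * e4 powr (\<delta> / 4))"
    using ep bht_const_pos[of "1 / 2"] by (simp add: N_def pair_bound_def powr_mult powr_powr)
  finally have main: "(\<Sum>Q\<in>Qs. wt Q * a 1 Q * a 2 Q * a 3 Q) \<le> size_const \<delta> *
    (e1 powr (1 / 2 - \<delta> / 4) * e2 powr (1 / 2 - \<delta> / 4) * e3 powr (\<delta> / 4) * e4 powr (\<delta> / 4)) * \<rho> powr ((1 - \<delta>)\<^sup>2)"
    by (simp add: size_const_def mult_ac)
  have "Lam Ps Qs f1 f2 f3 f4 = (\<Sum>Q\<in>Qs. pair_coef f1 f2 1 2 Q * (\<Sum>P\<in>Ps. pair_coef f3 f4 2 3 P * K Q P))"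
    unfolding Lam_def sum_distrib_left by (subst sum.swap) (simp only: mult_ac)
  then have "norm (Lam Ps Qs f1 f2 f3 f4) \<le> (\<Sum>Q\<in>Qs. norm (pair_coef f1 f2 1 2 Q) * av Q)"
    unfolding av_def norm_mult[symmetric] by (simp only: norm_sum)
  also have "\<dots> = (\<Sum>Q\<in>Qs. wt Q * a 1 Q * a 2 Q * a 3 Q)"
    unfolding norm_pair_coef by (simp add: a_def mult.assoc)
  finally show ?thesis using main unfolding e1_def e2_def e3_def e4_def by linarith
qed

section \<open>The form as a double sum over quartiles\<close>

lemma tile_omega_subset_iff: "tile_omega r \<subseteq> tile_omega p \<longleftrightarrow> fsub r p"
proof -
  have om: "tile_omega t = {lo t..<hi t}" for t by (cases t) (simp add: tile_omega_def lo_def hi_def)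
  show ?thesis
  proof
    assume "fsub r p"
    then show "tile_omega r \<subseteq> tile_omega p" unfolding om using fsub_lohi[of r p] by auto
  next
    assume "tile_omega r \<subseteq> tile_omega p"
    moreover have "lo r < hi r" by (simp add: lo_def hi_def)
    ultimately have le: "lo p \<le> lo r" "hi r \<le> hi p" unfolding om by (auto simp: atLeastLessThan_subset_iff)
    have "2 powr real_of_int (kk r) = hi r - lo r" "2 powr real_of_int (kk p) = hi p - lo p"
      by (simp_all add: lo_def hi_def algebra_simps)
    then have "2 powr real_of_int (kk r) \<le> 2 powr real_of_int (kk p)" using le by linarith
    then have k: "kk r \<le> kk p" by (simp add: powr_le_cancel_iff)
    define d where "d = nat (kk p - kk r)"
    have pw: "2 powr real_of_int (kk p) = 2 powr real_of_int (kk r) * 2 ^ d" unfolding d_def by (rule powr_diff_nat[OF k])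
    have "2 powr real_of_int (kk r) * (2 ^ d * real (ll p)) \<le> 2 powr real_of_int (kk r) * real (ll r)"
      "2 powr real_of_int (kk r) * (real (ll r) + 1) \<le> 2 powr real_of_int (kk r) * (2 ^ d * (real (ll p) + 1))"
      using le unfolding lo_def hi_def pw by (simp_all add: mult.assoc)
    then have "2 ^ d * real (ll p) \<le> real (ll r)" "real (ll r) + 1 \<le> 2 ^ d * (real (ll p) + 1)" by simp_all
    then have "real (2 ^ d * ll p) \<le> real (ll r)" "real (ll r + 1) \<le> real (2 ^ d * (ll p + 1))" by (simp_all add: algebra_simps)
    then have "2 ^ d * ll p \<le> ll r" "ll r + 1 \<le> 2 ^ d * (ll p + 1)" unfolding of_nat_le_iff .
    then have "ll r div 2 ^ d = ll p" by (intro div_nat_eqI) (auto simp: mult.commute)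
    then show "fsub r p" using k by (simp add: fsub_def d_def)
  qed
qed

lemma Lambda'_eq_Lam:
  assumes fin: "finite Ps" "finite Qs"
    and f: "f1 \<in> Xset E1" "E1 \<in> lmeasurable" "f2 \<in> Xset E2" "E2 \<in> lmeasurable" "f4 \<in> Xset E4" "E4 \<in> lmeasurable"
  shows "Lambda' Ps Qs f1 f2 f3 f4 = Lam Ps Qs f1 f2 f3 f4"
proof -
  have w: "measure lebesgue (quartile_I P) powr (-1/2) = wt P" for P
    by (simp add: quartile_I_dy measure_dy wt_def powr_powr)
  have B: "winner (B_walsh (subtile P 1) Qs f1 f2) (ph (subtile P 1)) = (\<Sum>Q\<in>Qs. pair_coef f1 f2 1 2 Q * K Q P)" for P
  proof -
    let ?Q = "{Q\<in>Qs. tile_omega (subtile Q 3) \<subseteq> tile_omega (subtile P 1)}"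
    have "B_walsh (subtile P 1) Qs f1 f2 = (\<lambda>x. \<Sum>Q\<in>?Q. pair_coef f1 f2 1 2 Q * ph (subtile Q 3) x)"
      unfolding B_walsh_def w pair_coef_def ph_def ..
    then have "winner (B_walsh (subtile P 1) Qs f1 f2) (ph (subtile P 1)) =
      (\<Sum>Q\<in>?Q. winner (\<lambda>x. pair_coef f1 f2 1 2 Q * ph (subtile Q 3) x) (ph (subtile P 1)))"
      by (simp only:) (intro winner_sum_left sqint_mult sqint_ph)
    also have "\<dots> = (\<Sum>Q\<in>?Q. pair_coef f1 f2 1 2 Q * K Q P)"
      by (intro sum.cong refl) (simp add: winner_mult_left K_def tile_omega_subset_iff)
    also have "\<dots> = (\<Sum>Q\<in>Qs. pair_coef f1 f2 1 2 Q * K Q P)"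
      using fin by (intro sum.mono_neutral_left) (auto simp: K_def tile_omega_subset_iff)
    finally show ?thesis .
  qed
  have s4: "sqint f4" by (rule Xset_sqint[OF f(5,6)])
  define c where "c P = complex_of_real (wt P) * (\<Sum>Q\<in>Qs. pair_coef f1 f2 1 2 Q * K Q P) * winner f3 (ph (subtile P 2))" for P
  have "Lambda' Ps Qs f1 f2 f3 f4 = (LINT x|lebesgue. (\<Sum>P\<in>Ps. c P * ph (subtile P 3) x) * f4 x)"
    unfolding Lambda'_def w ph_def[symmetric] B c_def by (simp add: ph_def)
  \<comment> \<open>The packets are real, so the integral against f4 is an inner product with f4 in
    the first slot.\<close>
  also have "\<dots> = (LINT x|lebesgue. (\<Sum>P\<in>Ps. c P * (f4 x * cnj (ph (subtile P 3) x))))"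
    by (simp add: sum_distrib_right sum_distrib_left ph_def mult_ac)
  also have "\<dots> = (\<Sum>P\<in>Ps. LINT x|lebesgue. c P * (f4 x * cnj (ph (subtile P 3) x)))"
    by (intro Bochner_Integration.integral_sum integrable_mult_right sqint_integrable s4 sqint_ph)
  also have "\<dots> = (\<Sum>P\<in>Ps. c P * winner f4 (ph (subtile P 3)))" by (simp add: winner_def)
  also have "\<dots> = Lam Ps Qs f1 f2 f3 f4"
    unfolding Lam_def
  proof (intro sum.cong refl)
    fix P
    have "c P * winner f4 (ph (subtile P 3)) = pair_coef f3 f4 2 3 P * (\<Sum>Q\<in>Qs. pair_coef f1 f2 1 2 Q * K Q P)"
      by (simp only: c_def pair_coef_def mult_ac)
    also have "\<dots> = (\<Sum>Q\<in>Qs. pair_coef f1 f2 1 2 Q * pair_coef f3 f4 2 3 P * K Q P)"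
      unfolding sum_distrib_left by (simp only: mult_ac)
    finally show "c P * winner f4 (ph (subtile P 3)) = (\<Sum>Q\<in>Qs. pair_coef f1 f2 1 2 Q * pair_coef f3 f4 2 3 P * K Q P)" .
  qed
  finally show ?thesis .
qed

section \<open>Exceptional sets\<close>

definition away :: "(int \<times> int) set \<Rightarrow> quartile set \<Rightarrow> quartile set" where
  "away I PP = {P\<in>PP. \<forall>(k,n)\<in>I. \<not> dsub (kk P) (nn P) k n}"

lemma winner_away:
  assumes f: "f \<in> Xset (E - (\<Union>(k,n)\<in>I. dy k n))" and E: "E - (\<Union>(k,n)\<in>I. dy k n) \<in> lmeasurable"
    and P: "P \<in> PP" "P \<notin> away I PP"
  shows "winner f (ph (subtile P j)) = 0"
proof -
  obtain k n where "(k,n) \<in> I" "dsub (kk P) (nn P) k n" using P by (auto simp: away_def)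
  then have "(E - (\<Union>(k,n)\<in>I. dy k n)) \<inter> dy (kk P) (nn P) = {}" using dsub_dy by blast
  then show ?thesis using norm_winner_Xset[OF f E, of "subtile P j"] by simp
qed

text \<open>For b in {3,4} the restriction passes from P to Q: if I_Q lies in a removed interval, so
  does I_P for every P with K Q P nonzero. There is no passage in the other direction.\<close>

lemma Lam_away:
  assumes fin: "finite Ps" "finite Qs" and b: "b \<in> {1..4}"
    and f: "f b \<in> Xset (E - (\<Union>(k,n)\<in>I. dy k n))" and E: "E - (\<Union>(k,n)\<in>I. dy k n) \<in> lmeasurable"
  shows "Lam Ps Qs (f 1) (f 2) (f 3) (f 4) =
    Lam (if b \<in> {3,4} then away I Ps else Ps) (away I Qs) (f 1) (f 2) (f 3) (f (4::nat))"
proof (cases "b \<in> {3,4}")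
  case True
  have z: "pair_coef (f 3) (f 4) 2 3 P = 0" if "P \<in> Ps - away I Ps" for P
    using winner_away[OF f E, of P Ps] that True by (auto simp: pair_coef_def)
  have "Lam Ps Qs (f 1) (f 2) (f 3) (f 4) = Lam (away I Ps) Qs (f 1) (f 2) (f 3) (f 4)"
    unfolding Lam_def using fin z by (intro sum.mono_neutral_right) (auto simp: away_def)
  also have "\<dots> = Lam (away I Ps) (away I Qs) (f 1) (f 2) (f 3) (f 4)"
    unfolding Lam_def
  proof (rule sum.cong[OF refl], rule sum.mono_neutral_right)
    fix P assume P: "P \<in> away I Ps"
    show "\<forall>Q\<in>Qs - away I Qs. pair_coef (f 1) (f 2) 1 2 Q * pair_coef (f 3) (f 4) 2 3 P * K Q P = 0"
    proof
    fix Q assume Q: "Q \<in> Qs - away I Qs"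
    have "K Q P = 0"
    proof (rule ccontr)
      assume "K Q P \<noteq> 0"
      then have "dsub (kk P) (nn P) (kk Q) (nn Q)" using K_nonzero[of Q P] by (simp add: tile_le_def)
      moreover obtain k n where "(k,n) \<in> I" "dsub (kk Q) (nn Q) k n" using Q by (auto simp: away_def)
      ultimately show False using P dsub_trans unfolding away_def by blast
    qed
    then show "pair_coef (f 1) (f 2) 1 2 Q * pair_coef (f 3) (f 4) 2 3 P * K Q P = 0" by simp
    qed
  qed (use fin in \<open>auto simp: away_def\<close>)
  finally show ?thesis using True by simp
next
  case False
  have bb: "b = 1 \<or> b = 2" using b False by auto
  have z: "pair_coef (f 1) (f 2) 1 2 Q = 0" if "Q \<in> Qs - away I Qs" for Q
    using winner_away[OF f E, of Q Qs] that bb by (auto simp: pair_coef_def)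
  have "Lam Ps Qs (f 1) (f 2) (f 3) (f 4) = Lam Ps (away I Qs) (f 1) (f 2) (f 3) (f 4)"
    unfolding Lam_def
    by (rule sum.cong[OF refl], rule sum.mono_neutral_right) (use fin z in \<open>auto simp: away_def\<close>)
  then show ?thesis using False by simp
qed

text \<open>I consists of the ancestors that are too dense, and the weak-type inequality bounds
  their union. The quantifier over subcollections lets one set serve Ps and Qs.\<close>

lemma exceptional_set:
  fixes E :: "nat \<Rightarrow> real set" and lam :: "nat \<Rightarrow> real"
  assumes fin: "finite PP" and J: "finite J" "\<And>j. j \<in> J \<Longrightarrow> E j \<in> lmeasurable" "\<And>j. j \<in> J \<Longrightarrow> lam j > 0"
  shows "\<exists>I. finite I \<and> measure lebesgue (\<Union>(k,n)\<in>I. dy k n) \<le> (\<Sum>j\<in>J. measure lebesgue (E j) / lam j) \<and>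
    (\<forall>j\<in>J. \<forall>PP'\<subseteq>PP. dens k0 (away I PP') (E j) (lam j))"
proof -
  define I0 where "I0 = (\<Union>P\<in>PP. (\<lambda>k. (k, nn P div 2 ^ nat (kk P - k))) ` {k0..kk P})"
  define Ij where "Ij j = {x\<in>I0. measure lebesgue (E j \<inter> dy (fst x) (snd x)) > lam j * 2 powr (- real_of_int (fst x))}" for j
  define I where "I = (\<Union>j\<in>J. Ij j)"
  have f0: "finite I0" using fin by (simp add: I0_def)
  have fj: "finite (Ij j)" for j using f0 by (simp add: Ij_def)
  have meas: "(\<Union>(k,n)\<in>Ij j. dy k n) \<in> sets lebesgue" for j
    unfolding case_prod_beta using fj by (intro sets.finite_UN) auto
  have wk: "measure lebesgue (\<Union>(k,n)\<in>Ij j. dy k n) \<le> measure lebesgue (E j) / lam j" if "j \<in> J" for j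
  proof -
    have "lam j * measure lebesgue (\<Union>(k,n)\<in>Ij j. dy k n) \<le> measure lebesgue (E j)"
      using J that by (intro dyadic_weak_type fj) (auto simp: Ij_def less_imp_le)
    then show ?thesis using J(3)[OF that] by (simp add: field_simps)
  qed
  have "(\<Union>(k,n)\<in>I. dy k n) = (\<Union>j\<in>J. \<Union>(k,n)\<in>Ij j. dy k n)" by (auto simp: I_def)
  then have "measure lebesgue (\<Union>(k,n)\<in>I. dy k n) \<le> (\<Sum>j\<in>J. measure lebesgue (\<Union>(k,n)\<in>Ij j. dy k n))"
    using measure_UNION_le[OF J(1) meas] by simp
  also have "\<dots> \<le> (\<Sum>j\<in>J. measure lebesgue (E j) / lam j)" by (intro sum_mono wk)
  finally have m: "measure lebesgue (\<Union>(k,n)\<in>I. dy k n) \<le> (\<Sum>j\<in>J. measure lebesgue (E j) / lam j)" .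
  have "dens k0 (away I PP') (E j) (lam j)" if j: "j \<in> J" and PP': "PP' \<subseteq> PP" for j PP'
    unfolding dens_def
  proof (intro ballI allI impI)
    fix Q k n assume Q: "Q \<in> away I PP'" and k: "k0 \<le> k" and d: "dsub (kk Q) (nn Q) k n"
    have QP: "Q \<in> PP" using Q PP' by (auto simp: away_def)
    have "(k,n) \<in> (\<lambda>k. (k, nn Q div 2 ^ nat (kk Q - k))) ` {k0..kk Q}" using d k by (auto simp: dsub_def)
    then have "(k,n) \<in> I0" using QP unfolding I0_def by blast
    moreover have "(k,n) \<notin> I" using Q d by (auto simp: away_def)
    then have "(k,n) \<notin> Ij j" using j by (auto simp: I_def)
    ultimately show "measure lebesgue (E j \<inter> dy k n) \<le> lam j * 2 powr (- real_of_int k)" by (simp add: Ij_def not_less)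
  qed
  then show ?thesis using m fj J(1) by (intro exI[of _ I]) (auto simp: I_def)
qed

section \<open>Restricted type\<close>

text \<open>The exponents after each density is replaced by a multiple of |E j| / |E b|: u belongs
  to the measures, w to the densities with index in J, and b pays for all of them.\<close>

definition shifted_exponent :: "(nat \<Rightarrow> real) \<Rightarrow> (nat \<Rightarrow> real) \<Rightarrow> nat set \<Rightarrow> nat \<Rightarrow> nat \<Rightarrow> real" where
  "shifted_exponent u w J b i = u i + (if i \<in> J then w i else 0) - (if i = b then sum w J else 0)"

text \<open>Null sets are treated apart: the quotients defining the densities degenerate, and by 0
  powr a = 0 the claimed bound is then 0.\<close>

lemma Lam_null:
  assumes fin: "finite Ps" "finite Qs" and f: "\<And>i. i \<in> {1..4} \<Longrightarrow> f i \<in> Xset (E i)"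
    and E: "\<And>i. i \<in> {1..4} \<Longrightarrow> E i \<in> lmeasurable"
    and i: "i \<in> {1..4}" "measure lebesgue (E i) = 0"
  shows "Lam Ps Qs (f 1) (f 2) (f 3) (f (4::nat)) = 0"
proof -
  have w: "winner (f i) (ph R) = 0" for R
  proof -
    have "measure lebesgue (E i \<inter> dy (kk R) (nn R)) \<le> measure lebesgue (E i)"
      using E[OF i(1)] by (intro measure_mono_fmeasurable) (auto intro!: fmeasurableD fmeasurable.Int)
    then have "measure lebesgue (E i \<inter> dy (kk R) (nn R)) = 0" using i(2) by (simp add: order_antisym)
    then show ?thesis using norm_winner_Xset[OF f[OF i(1)] E[OF i(1)], of R] by simp
  qed
  have "i = 1 \<or> i = 2 \<or> i = 3 \<or> i = 4" using i(1) by auto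
  then show ?thesis using w unfolding Lam_def by (elim disjE) (auto simp: pair_coef_def)
qed

lemma prod_shifted_exponent:
  fixes e :: "nat \<Rightarrow> real"
  assumes J: "J \<subseteq> {1..4}" "b \<in> {1..4}" and e: "\<And>i. i \<in> {1..4} \<Longrightarrow> e i > 0"
  shows "(\<Prod>i=1..4. e i powr u i) * (\<Prod>j\<in>J. (8 * e j / e b) powr w j) =
    (\<Prod>j\<in>J. 8 powr w j) * (\<Prod>i=1..4. e i powr shifted_exponent u w J b i)"
proof -
  have finJ: "finite J" using J(1) finite_subset by blast
  have eJ: "e j > 0" if "j \<in> J" for j using that J e by auto
  have "(\<Prod>j\<in>J. (8 * e j / e b) powr w j) = (\<Prod>j\<in>J. 8 powr w j * e j powr w j * e b powr (- w j))"
  proof (rule prod.cong[OF refl])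
    fix j assume j: "j \<in> J"
    show "(8 * e j / e b) powr w j = 8 powr w j * e j powr w j * e b powr (- w j)"
      using eJ[OF j] e[OF J(2)] by (simp add: powr_divide powr_mult powr_minus_divide)
  qed
  also have "\<dots> = (\<Prod>j\<in>J. 8 powr w j) * (\<Prod>j\<in>J. e j powr w j) * e b powr (- sum w J)"
    using e[OF J(2)] by (simp add: prod.distrib powr_sum[symmetric] sum_negf finJ)
  also have "(\<Prod>j\<in>J. e j powr w j) = (\<Prod>i=1..4. e i powr (if i \<in> J then w i else 0))"
  proof -
    have "(\<Prod>i=1..4. e i powr (if i \<in> J then w i else 0)) = (\<Prod>i=1..4. if i \<in> J then e i powr w i else 1)"
      using e by (intro prod.cong refl) (auto simp: less_imp_neq[symmetric])
    also have "\<dots> = (\<Prod>i\<in>{1..4} \<inter> J. e i powr w i)" by (simp add: prod.inter_restrict)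
    also have "{1..4} \<inter> J = J" using J(1) by blast
    finally show ?thesis by simp
  qed
  also have "e b powr (- sum w J) = (\<Prod>i=1..4. e i powr (- (if i = b then sum w J else 0)))"
  proof -
    have "(\<Prod>i=1..4. e i powr (- (if i = b then sum w J else 0))) = (\<Prod>i=1..4. if i = b then e b powr (- sum w J) else 1)"
      using e by (intro prod.cong refl) (auto simp: less_imp_neq[symmetric])
    then show ?thesis using J(2) by simp
  qed
  finally have 1: "(\<Prod>j\<in>J. (8 * e j / e b) powr w j) = (\<Prod>j\<in>J. 8 powr w j) *
    (\<Prod>i=1..4. e i powr (if i \<in> J then w i else 0)) * (\<Prod>i=1..4. e i powr (- (if i = b then sum w J else 0)))" .
  have "(\<Prod>i=1..4. e i powr shifted_exponent u w J b i) = (\<Prod>i=1..4. e i powr u i * e i powr (if i \<in> J then w i else 0) *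
     e i powr (- (if i = b then sum w J else 0)))"
    unfolding shifted_exponent_def diff_conv_add_uminus powr_add ..
  then show ?thesis unfolding 1 prod.distrib by (simp only: mult_ac)
qed

text \<open>The exceptional set is the union of the dyadic intervals on which some \<open>E j\<close>, \<open>j \<in> J\<close>, has density
  above \<open>8 |E j| / |E b|\<close>; removing it from \<open>E b\<close> trades the densities \<open>lam j\<close> for these quotients.\<close>

lemma restricted_type_of_density_bound:
  fixes u w :: "nat \<Rightarrow> real" and J :: "nat set" and b :: nat and C :: real
  assumes J: "J \<subseteq> {1..4} - {b}" "card J \<le> 4" and b: "b \<in> {1..4}" and neg: "shifted_exponent u w J b b < 0" and C: "C \<ge> 0"
    and bound: "\<And>Ps Qs k0 (f :: nat \<Rightarrow> real \<Rightarrow> complex) E lam. finite Ps \<Longrightarrow> finite Qs \<Longrightarrow> (\<And>P. P \<in> Ps \<union> Qs \<Longrightarrow> k0 \<le> kk P) \<Longrightarrow>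
      (\<And>i. i \<in> {1..4} \<Longrightarrow> f i \<in> Xset (E i) \<and> E i \<in> lmeasurable \<and> measure lebesgue (E i) > 0) \<Longrightarrow>
      (\<And>j. j \<in> J \<Longrightarrow> lam j > 0 \<and> dens k0 Qs (E j) (lam j) \<and> (b \<in> {3,4} \<longrightarrow> dens k0 Ps (E j) (lam j))) \<Longrightarrow>
      norm (Lam Ps Qs (f 1) (f 2) (f 3) (f 4)) \<le> C * ((\<Prod>i=1..4. measure lebesgue (E i) powr u i) * (\<Prod>j\<in>J. lam j powr w j))"
  shows "\<exists>C. \<forall>Ps Qs. finite Ps \<longrightarrow> finite Qs \<longrightarrow>
    restricted_type_with_const (shifted_exponent u w J b) C (Lambda' Ps Qs)"
proof (intro exI allI impI)
  fix Ps Qs :: "quartile set" assume fin: "finite Ps" "finite Qs"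
  let ?\<alpha> = "shifted_exponent u w J b" and ?C = "C * (\<Prod>j\<in>J. 8 powr w j)"
  have finJ: "finite J" using J(1) finite_subset by blast
  have C': "?C \<ge> 0" using C by (intro mult_nonneg_nonneg prod_nonneg) auto
  show "restricted_type_with_const ?\<alpha> ?C (Lambda' Ps Qs)"
    unfolding restricted_type_with_const_def
  proof (intro allI impI)
    fix E :: "nat \<Rightarrow> real set"
    assume *: "\<forall>i\<in>{1..4}. E i \<in> sets lebesgue \<and> emeasure lebesgue (E i) < \<infinity>"
    have E: "E i \<in> lmeasurable" if "i \<in> {1..4}" for i using bspec[OF * that] by (auto simp: fmeasurable_def)
    have triv: "if ?\<alpha> i < 0 then major_subset (E i) (E i) else E i = E i" if "i \<in> {1..4}" for i
      using E[OF that] by (simp add: major_subset_def fmeasurableD)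
    have LL: "Lambda' Ps Qs f1 f2 f3 f4 = Lam Ps Qs f1 f2 f3 f4"
      if "f1 \<in> Xset (E 1)" "f2 \<in> Xset (E 2)" "f4 \<in> Xset (E 4)" for f1 f2 f3 f4
      by (rule Lambda'_eq_Lam[OF fin that(1) E that(2) E that(3) E]) auto
    let ?claim = "\<lambda>E'. (\<forall>i\<in>{1..4}. if ?\<alpha> i < 0 then major_subset (E' i) (E i) else E' i = E i) \<and>
         (\<forall>f1 f2 f3 f4. f1 \<in> Xset (E' 1) \<longrightarrow> f2 \<in> Xset (E' 2) \<longrightarrow> f3 \<in> Xset (E' 3)
             \<longrightarrow> f4 \<in> Xset (E' 4) \<longrightarrow>
            norm (Lambda' Ps Qs f1 f2 f3 f4) \<le> ?C * (\<Prod>i=1..4. measure lebesgue (E i) powr ?\<alpha> i))"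
    have four: "i = 1 \<or> i = 2 \<or> i = 3 \<or> i = 4" if "i \<in> {1..4}" for i :: nat using that by auto
    show "\<exists>E'. ?claim E'"
    proof (cases "\<exists>i\<in>{1..4}. measure lebesgue (E i) = 0")
      case True
      then obtain i where i: "i \<in> {1..4}" "measure lebesgue (E i) = 0" by blast
      have "norm (Lambda' Ps Qs f1 f2 f3 f4) \<le> ?C * (\<Prod>i=1..4. measure lebesgue (E i) powr ?\<alpha> i)"
        if f: "f1 \<in> Xset (E 1)" "f2 \<in> Xset (E 2)" "f3 \<in> Xset (E 3)" "f4 \<in> Xset (E 4)" for f1 f2 f3 f4
      proof -
        define f where "f i = (if i = 1 then f1 else if i = 2 then f2 else if i = 3 then f3 else f4)" for i :: nat
        have "f i \<in> Xset (E i)" if "i \<in> {1..4}" for i using four[OF that] f by (auto simp: f_def)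
        from Lam_null[where f=f and E=E, OF fin this E i] have "Lam Ps Qs f1 f2 f3 f4 = 0" by (simp add: f_def)
        then show ?thesis using LL[OF f(1,2,4)] C' by (simp add: prod_nonneg)
      qed
      then show ?thesis using triv by (intro exI[of _ E]) blast
    next
      case False
      have ep: "measure lebesgue (E i) > 0" if "i \<in> {1..4}" for i
        using False that by (metis measure_nonneg less_eq_real_def)
      \<comment> \<open>Each of the at most four densities removes at most an eighth of
        \<open>E b\<close>, so at least half of it remains.\<close>
      define lam where "lam j = 8 * measure lebesgue (E j) / measure lebesgue (E b)" for j
      have lamp: "lam j > 0" if "j \<in> J" for j using ep that J(1) b by (auto simp: lam_def)
      obtain k0 where k0: "\<And>P. P \<in> Ps \<union> Qs \<Longrightarrow> k0 \<le> kk P"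
      proof (rule that[of "Min (kk ` (Ps \<union> Qs))"])
        fix P assume "P \<in> Ps \<union> Qs"
        then show "Min (kk ` (Ps \<union> Qs)) \<le> kk P" using fin by (intro Min_le) auto
      qed
      have EJ: "E j \<in> lmeasurable" if "j \<in> J" for j using E that J(1) by auto
      have finU: "finite (Ps \<union> Qs)" using fin by simp
      obtain I where I: "finite I" "measure lebesgue (\<Union>(k,n)\<in>I. dy k n) \<le> (\<Sum>j\<in>J. measure lebesgue (E j) / lam j)"
        "\<forall>j\<in>J. \<forall>PP'\<subseteq>Ps \<union> Qs. dens k0 (away I PP') (E j) (lam j)"
      proof -
        have "\<exists>I. finite I \<and> measure lebesgue (\<Union>(k,n)\<in>I. dy k n) \<le> (\<Sum>j\<in>J. measure lebesgue (E j) / lam j) \<and>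
          (\<forall>j\<in>J. \<forall>PP'\<subseteq>Ps \<union> Qs. dens k0 (away I PP') (E j) (lam j))"
          by (rule exceptional_set[OF finU finJ EJ lamp])
        then show ?thesis by (elim exE conjE) (rule that)
      qed
      define \<Omega> where "\<Omega> = (\<Union>(k,n)\<in>I. dy k n)"
      have \<Omega>m: "\<Omega> \<in> sets lebesgue" unfolding \<Omega>_def case_prod_beta using I(1) by (intro sets.finite_UN) auto
      have "(\<Sum>j\<in>J. measure lebesgue (E j) / lam j) = (\<Sum>j\<in>J. measure lebesgue (E b) / 8)"
      proof (rule sum.cong[OF refl])
        fix j assume "j \<in> J"
        then have "measure lebesgue (E j) > 0" using ep J(1) by auto
        then show "measure lebesgue (E j) / lam j = measure lebesgue (E b) / 8" by (simp add: lam_def)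
      qed
      also have "\<dots> \<le> 4 * (measure lebesgue (E b) / 8)"
        using J(2) by (simp only: sum_constant) (intro mult_right_mono, auto)
      finally have \<Omega>2: "measure lebesgue \<Omega> \<le> measure lebesgue (E b) / 2" using I(2) by (simp add: \<Omega>_def)
      define E' where "E' = E(b := E b - \<Omega>)"
      have Eb: "E b - \<Omega> \<in> lmeasurable" using E[OF b] \<Omega>m by (intro fmeasurable_Diff) auto
      have major: "major_subset (E b - \<Omega>) (E b)"
      proof -
        have "measure lebesgue (E b) \<le> measure lebesgue ((E b - \<Omega>) \<union> (E b \<inter> \<Omega>))"
          by (simp add: Un_Diff_Int Un_commute)
        also have "\<dots> \<le> measure lebesgue (E b - \<Omega>) + measure lebesgue (E b \<inter> \<Omega>)"
          using E[OF b] \<Omega>m by (intro measure_Un_le) (auto simp: fmeasurableD)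
        also have "measure lebesgue (E b \<inter> \<Omega>) \<le> measure lebesgue \<Omega>"
        proof (rule measure_mono_fmeasurable)
          show "\<Omega> \<in> lmeasurable" unfolding \<Omega>_def case_prod_beta using I(1) by (intro fmeasurable.finite_UN) auto
        qed (use E[OF b] \<Omega>m in \<open>auto simp: fmeasurableD\<close>)
        finally show ?thesis using \<Omega>2 Eb by (simp add: major_subset_def fmeasurableD)
      qed
      have "norm (Lambda' Ps Qs f1 f2 f3 f4) \<le> ?C * (\<Prod>i=1..4. measure lebesgue (E i) powr ?\<alpha> i)"
        if f: "f1 \<in> Xset (E' 1)" "f2 \<in> Xset (E' 2)" "f3 \<in> Xset (E' 3)" "f4 \<in> Xset (E' 4)" for f1 f2 f3 f4
      proof -
        define f where "f i = (if i = 1 then f1 else if i = 2 then f2 else if i = 3 then f3 else f4)" for i :: nat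
        have f': "f i \<in> Xset (E' i)" if "i \<in> {1..4}" for i using four[OF that] f by (auto simp: f_def)
        have sub: "E' i \<subseteq> E i" for i by (auto simp: E'_def)
        have fE: "f i \<in> Xset (E i)" if "i \<in> {1..4}" for i using f'[OF that] sub[of i] by (auto simp: Xset_def)
        have fb: "f b \<in> Xset (E b - (\<Union>(k,n)\<in>I. dy k n))" using f'[OF b] by (simp add: E'_def \<Omega>_def)
        have Eb': "E b - (\<Union>(k,n)\<in>I. dy k n) \<in> lmeasurable" using Eb by (simp add: \<Omega>_def)
        let ?P = "if b \<in> {3,4} then away I Ps else Ps"
        have "Lam Ps Qs (f 1) (f 2) (f 3) (f 4) = Lam ?P (away I Qs) (f 1) (f 2) (f 3) (f 4)"
          by (rule Lam_away[where f=f and E="E b", OF fin b fb Eb'])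
        moreover have "norm (Lam ?P (away I Qs) (f 1) (f 2) (f 3) (f 4)) \<le>
          C * ((\<Prod>i=1..4. measure lebesgue (E i) powr u i) * (\<Prod>j\<in>J. lam j powr w j))"
        proof (rule bound)
          show "finite ?P" "finite (away I Qs)" using fin by (auto simp: away_def)
          show "k0 \<le> kk P" if "P \<in> ?P \<union> away I Qs" for P
            using that by (intro k0) (auto simp: away_def split: if_splits)
          show "f i \<in> Xset (E i) \<and> E i \<in> lmeasurable \<and> measure lebesgue (E i) > 0" if "i \<in> {1..4}" for i
            using fE E ep that by blast
          show "lam j > 0 \<and> dens k0 (away I Qs) (E j) (lam j) \<and> (b \<in> {3,4} \<longrightarrow> dens k0 ?P (E j) (lam j))" if "j \<in> J" for j
            using lamp[OF that] bspec[OF I(3) that] by simp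
        qed
        moreover have "(\<Prod>i=1..4. measure lebesgue (E i) powr u i) * (\<Prod>j\<in>J. lam j powr w j) =
          (\<Prod>j\<in>J. 8 powr w j) * (\<Prod>i=1..4. measure lebesgue (E i) powr ?\<alpha> i)"
          unfolding lam_def by (rule prod_shifted_exponent) (use J b ep in auto)
        moreover have "Lambda' Ps Qs f1 f2 f3 f4 = Lam Ps Qs (f 1) (f 2) (f 3) (f 4)"
          using LL[of f1 f2 f4 f3] fE[of 1] fE[of 2] fE[of 4] by (simp add: f_def)
        ultimately show ?thesis by (simp add: mult.assoc)
      qed
      moreover have "\<forall>i\<in>{1..4}. if ?\<alpha> i < 0 then major_subset (E' i) (E i) else E' i = E i"
      proof
        fix i :: nat assume "i \<in> {1..4}"
        then show "if ?\<alpha> i < 0 then major_subset (E' i) (E i) else E' i = E i"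
          using triv[of i] major neg by (cases "i = b") (simp_all add: E'_def)
      qed
      ultimately show ?thesis by (intro exI[of _ E']) blast
    qed
  qed
qed

section \<open>The exponents of the twelve points\<close>

lemma atLeastAtMost_1_4: "{1..4} = {1,2,3,4::nat}"
  by auto

lemma prod_1_4: "(\<Prod>i=1..4::nat. g i) = g 1 * g 2 * g 3 * (g 4 :: 'a :: comm_monoid_mult)"
  unfolding atLeastAtMost_1_4 by (simp add: mult.assoc)

lemma sum_1_4: "(\<Sum>i=1..4::nat. g i) = g 1 + g 2 + g 3 + (g 4 :: 'a :: comm_monoid_add)"
  unfolding atLeastAtMost_1_4 by (simp add: add.assoc)

definition tuple4 :: "real \<Rightarrow> real \<Rightarrow> real \<Rightarrow> real \<Rightarrow> nat \<Rightarrow> real" where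
  "tuple4 a b c d i = (if i = 1 then a else if i = 2 then b else if i = 3 then c else d)"

text \<open>Densities with index outside J are replaced by the trivial bound 1. The condition on J
  reflects that densities of \<open>E 3\<close> and \<open>E 4\<close> are taken above the P, where
  the exceptional set acts only for b in {3,4}.\<close>

lemma restricted_type_energy:
  assumes \<delta>: "0 < \<delta>" and \<theta>: "\<delta> \<le> \<theta>" "\<theta> \<le> 1 - \<delta>" and \<eta>: "\<delta> \<le> \<eta>" "\<eta> \<le> 1 - \<delta>"
    and J: "J \<subseteq> {1..4} - {b}" "b \<in> {1..4}" "J \<inter> {3,4} \<noteq> {} \<Longrightarrow> b \<in> {3,4}"
    and u: "u = tuple4 ((1 - \<theta>) / 2) (\<theta> / 2) ((1 - \<eta>) / 2) (\<eta> / 2)" and w: "w = tuple4 \<theta> (1 - \<theta>) \<eta> (1 - \<eta>)"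
    and neg: "shifted_exponent u w J b b < 0"
  shows "\<exists>C. \<forall>Ps Qs. finite Ps \<longrightarrow> finite Qs \<longrightarrow>
    restricted_type_with_const (shifted_exponent u w J b) C (Lambda' Ps Qs)"
proof (rule restricted_type_of_density_bound[where C="4 * (bht_const \<delta>)\<^sup>2"])
  have "J \<subseteq> {1,2,3,4}" using J(1) by auto
  then show "card J \<le> 4" using card_mono[of "{1,2,3,4::nat}" J] by simp
next
  fix Ps Qs :: "quartile set" and k0 and f :: "nat \<Rightarrow> real \<Rightarrow> complex" and E lam
  assume fin: "finite Ps" "finite Qs" and k0: "\<And>P. P \<in> Ps \<union> Qs \<Longrightarrow> k0 \<le> kk P"
    and fE: "\<And>i. i \<in> {1..4} \<Longrightarrow> f i \<in> Xset (E i) \<and> E i \<in> lmeasurable \<and> measure lebesgue (E i) > 0"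
    and lam: "\<And>j. j \<in> J \<Longrightarrow> lam j > 0 \<and> dens k0 Qs (E j) (lam j) \<and> (b \<in> {3,4} \<longrightarrow> dens k0 Ps (E j) (lam j))"
  define l where "l j = (if j \<in> J then lam j else 1)" for j
  have lp: "l j > 0" for j using lam by (simp add: l_def)
  have dQ: "dens k0 Qs (E j) (l j)" if "j \<in> {1..4}" for j
    using lam dens_one fE[OF that] by (simp add: l_def)
  have dP: "dens k0 Ps (E j) (l j)" if "j \<in> {3,4}" for j
    using lam[of j] dens_one[of "E j"] fE[of j] J(3) that by (cases "j \<in> J") (auto simp: l_def)
  have m: "1 \<in> {1..4::nat}" "2 \<in> {1..4::nat}" "3 \<in> {1..4::nat}" "4 \<in> {1..4::nat}" by auto
  have "norm (Lam Ps Qs (f 1) (f 2) (f 3) (f 4)) \<le>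
    pair_bound \<delta> \<eta> (l 3) (l 4) (measure lebesgue (E 3)) (measure lebesgue (E 4)) *
    pair_bound \<delta> \<theta> (l 1) (l 2) (measure lebesgue (E 1)) (measure lebesgue (E 2))"
    by (rule Lam_bound_energy[OF fin k0 _ _ _ dQ lp _ _ _ dQ lp _ _ _ dP lp _ _ _ dP lp \<delta> \<theta> \<eta>])
      (use fE m in auto)
  also have "\<dots> = 4 * (bht_const \<delta>)\<^sup>2 * ((\<Prod>i=1..4. measure lebesgue (E i) powr u i) * (\<Prod>i=1..4. l i powr w i))"
    unfolding prod_1_4 u w by (simp add: pair_bound_def tuple4_def power2_eq_square)
  also have "(\<Prod>i=1..4. l i powr w i) = (\<Prod>j\<in>J. lam j powr w j)"
  proof -
    have "(\<Prod>i=1..4. l i powr w i) = (\<Prod>i=1..4. if i \<in> J then lam i powr w i else 1)"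
      by (intro prod.cong refl) (simp add: l_def)
    also have "\<dots> = (\<Prod>i\<in>{1..4} \<inter> J. lam i powr w i)" by (simp add: prod.inter_restrict)
    also have "{1..4} \<inter> J = J" using J(1) by blast
    finally show ?thesis .
  qed
  finally show "norm (Lam Ps Qs (f 1) (f 2) (f 3) (f 4)) \<le>
    4 * (bht_const \<delta>)\<^sup>2 * ((\<Prod>i=1..4. measure lebesgue (E i) powr u i) * (\<Prod>j\<in>J. lam j powr w j))" .
qed (use J neg in auto)

text \<open>The bad index is 1 or 2 although the density belongs to \<open>E 3\<close> or
  \<open>E 4\<close>: \<open>Lam_bound_size\<close> takes it above the Q, which the exceptional set
  does control.\<close>

lemma restricted_type_size:
  assumes \<delta>: "0 < \<delta>" "\<delta> \<le> 1" and b: "b \<in> {1,2}" and m: "m \<in> {3,4}"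
    and u: "u = tuple4 (1 / 2 - \<delta> / 4) (1 / 2 - \<delta> / 4) (\<delta> / 4) (\<delta> / 4)" and w: "w = (\<lambda>j. (1 - \<delta>)\<^sup>2)"
    and neg: "shifted_exponent u w {m} b b < 0"
  shows "\<exists>C. \<forall>Ps Qs. finite Ps \<longrightarrow> finite Qs \<longrightarrow>
    restricted_type_with_const (shifted_exponent u w {m} b) C (Lambda' Ps Qs)"
proof (rule restricted_type_of_density_bound[where C="size_const \<delta>"])
  have "bht_const (\<delta> / 2) > 0" "tree_const \<delta> > 0" using bht_const_pos tree_const_pos \<delta> by auto
  then show "size_const \<delta> \<ge> 0" unfolding size_const_def by (intro mult_nonneg_nonneg) (auto simp: less_imp_le)
next
  fix Ps Qs :: "quartile set" and k0 and f :: "nat \<Rightarrow> real \<Rightarrow> complex" and E lam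
  assume fin: "finite Ps" "finite Qs" and k0: "\<And>P. P \<in> Ps \<union> Qs \<Longrightarrow> k0 \<le> kk P"
    and fE: "\<And>i. i \<in> {1..4} \<Longrightarrow> f i \<in> Xset (E i) \<and> E i \<in> lmeasurable \<and> measure lebesgue (E i) > 0"
    and lam: "\<And>j. j \<in> {m} \<Longrightarrow> lam j > 0 \<and> dens k0 Qs (E j) (lam j) \<and> (b \<in> {3,4} \<longrightarrow> dens k0 Ps (E j) (lam j))"
  have "norm (Lam Ps Qs (f 1) (f 2) (f 3) (f 4)) \<le> size_const \<delta> *
    (measure lebesgue (E 1) powr (1 / 2 - \<delta> / 4) * measure lebesgue (E 2) powr (1 / 2 - \<delta> / 4) *
     measure lebesgue (E 3) powr (\<delta> / 4) * measure lebesgue (E 4) powr (\<delta> / 4)) * lam m powr ((1 - \<delta>)\<^sup>2)"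
    by (rule Lam_bound_size[OF fin k0 _ _ _ _ _ _ _ _ _ _ _ _ _ _ _ \<delta>, where Em="E m"])
      (use fE lam m in auto)
  then show "norm (Lam Ps Qs (f 1) (f 2) (f 3) (f 4)) \<le>
    size_const \<delta> * ((\<Prod>i=1..4. measure lebesgue (E i) powr u i) * (\<Prod>j\<in>{m}. lam j powr w j))"
    unfolding prod_1_4 u w by (simp add: tuple4_def mult.assoc)
qed (use b m neg in auto)

lemma tuple_dist_le:
  assumes "\<And>j. j \<in> {1..4} \<Longrightarrow> \<bar>\<alpha> j - \<beta> j\<bar> \<le> c" "c \<ge> 0"
  shows "tuple_dist \<alpha> \<beta> \<le> 2 * c"
proof -
  have "(\<Sum>j=1..4. (\<alpha> j - \<beta> j)\<^sup>2) \<le> (\<Sum>j=1..4::nat. c\<^sup>2)"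
    using assms by (intro sum_mono) (metis abs_le_square_iff abs_of_nonneg)
  also have "\<dots> = (2 * c)\<^sup>2" by (simp add: power2_eq_square)
  finally show ?thesis unfolding tuple_dist_def using assms(2) by (intro real_le_lsqrt) (auto intro: sum_nonneg)
qed

lemma admissibleI:
  assumes "\<And>i. i \<in> {1..4} \<Longrightarrow> \<alpha> i < 1" "\<alpha> 1 + \<alpha> 2 + \<alpha> 3 + \<alpha> 4 = 1" "\<And>i. i \<in> {1..4} - {b} \<Longrightarrow> \<alpha> i \<ge> 0"
  shows "admissible \<alpha>"
proof -
  have "{j\<in>{1..4::nat}. \<alpha> j < 0} \<subseteq> {b}" using assms(3) by (auto simp: not_less[symmetric])
  then have "card {j\<in>{1..4::nat}. \<alpha> j < 0} \<le> 1" using card_mono[of "{b}"] by fastforce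
  then show ?thesis using assms(1,2) unfolding admissible_def sum_1_4 by simp
qed

theorem theorem2p5:
  fixes i :: nat and \<epsilon> :: real
  assumes "i \<in> {1..12}" and "\<epsilon> > 0"
  shows "\<exists>\<alpha>. admissible \<alpha> \<and> tuple_dist \<alpha> (Apt i) < \<epsilon> \<and>
           (\<exists>C. \<forall>Ps Qs. finite Ps \<longrightarrow> finite Qs \<longrightarrow>
                 restricted_type_with_const \<alpha> C (Lambda' Ps Qs))"
proof -
  \<comment> \<open>Each coordinate will be off by at most 3 * \<delta> and the tuple by at most 6 *
    \<delta>; the bound 1/8 secures the signs of the exponents.\<close>
  define \<delta> where "\<delta> = min (1 / 8) (\<epsilon> / 10)"
  have \<delta>: "0 < \<delta>" "\<delta> \<le> 1 / 8" "\<delta> \<le> \<epsilon> / 10" using assms(2) by (auto simp: \<delta>_def)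
  \<comment> \<open>The square is abstracted so that the remaining inequalities between exponents
    are linear.\<close>
  define s where "s = \<delta>\<^sup>2"
  have sq: "s \<le> \<delta> / 8" "0 \<le> s" using \<delta> by (auto simp: s_def power2_eq_square)
  have sq1: "(1 - \<delta>)\<^sup>2 = 1 - 2 * \<delta> + s" by (simp add: s_def power2_diff)
  have conclude: "\<exists>\<alpha>. admissible \<alpha> \<and> tuple_dist \<alpha> (Apt i) < \<epsilon> \<and>
      (\<exists>C. \<forall>Ps Qs. finite Ps \<longrightarrow> finite Qs \<longrightarrow> restricted_type_with_const \<alpha> C (Lambda' Ps Qs))"
    if "\<exists>C. \<forall>Ps Qs. finite Ps \<longrightarrow> finite Qs \<longrightarrow> restricted_type_with_const \<alpha> C (Lambda' Ps Qs)"
      "admissible \<alpha>" "\<And>j. j \<in> {1..4} \<Longrightarrow> \<bar>\<alpha> j - Apt i j\<bar> \<le> 3 * \<delta>" for \<alpha>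
  proof -
    have "tuple_dist \<alpha> (Apt i) \<le> 2 * (3 * \<delta>)" using that(3) \<delta> by (intro tuple_dist_le) auto
    also have "\<dots> < \<epsilon>" using \<delta> by linarith
    finally show ?thesis using that by blast
  qed
  have energy_case: ?thesis if "\<theta> \<in> {\<delta>, 1 - \<delta>}" "\<eta> \<in> {\<delta>, 1 - \<delta>}"
      "J \<subseteq> {1..4} - {b}" "b \<in> {1..4}" "J \<inter> {3,4} \<noteq> {} \<Longrightarrow> b \<in> {3,4}"
      "\<alpha> = shifted_exponent (tuple4 ((1 - \<theta>) / 2) (\<theta> / 2) ((1 - \<eta>) / 2) (\<eta> / 2)) (tuple4 \<theta> (1 - \<theta>) \<eta> (1 - \<eta>)) J b"
      "\<alpha> b < 0" "\<And>i. i \<in> {1..4} \<Longrightarrow> \<alpha> i < 1" "\<alpha> 1 + \<alpha> 2 + \<alpha> 3 + \<alpha> 4 = 1" "\<And>i. i \<in> {1..4} - {b} \<Longrightarrow> \<alpha> i \<ge> 0"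
      "\<And>j. j \<in> {1..4} \<Longrightarrow> \<bar>\<alpha> j - Apt i j\<bar> \<le> 3 * \<delta>" for \<theta> \<eta> J b \<alpha>
  proof (rule conclude[of \<alpha>])
    show "admissible \<alpha>" by (rule admissibleI[OF that(8,9,10)])
    show "\<exists>C. \<forall>Ps Qs. finite Ps \<longrightarrow> finite Qs \<longrightarrow> restricted_type_with_const \<alpha> C (Lambda' Ps Qs)"
      unfolding that(6) by (rule restricted_type_energy[OF \<delta>(1) _ _ _ _ that(3-5) refl refl])
        (use that(1,2,6,7) \<delta> in auto)
  qed (fact that(11))
  have size_case: ?thesis if "b \<in> {1,2}" "m \<in> {3,4}"
      "\<alpha> = shifted_exponent (tuple4 (1 / 2 - \<delta> / 4) (1 / 2 - \<delta> / 4) (\<delta> / 4) (\<delta> / 4)) (\<lambda>j. (1 - \<delta>)\<^sup>2) {m} b"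
      "\<alpha> b < 0" "\<And>i. i \<in> {1..4} \<Longrightarrow> \<alpha> i < 1" "\<alpha> 1 + \<alpha> 2 + \<alpha> 3 + \<alpha> 4 = 1" "\<And>i. i \<in> {1..4} - {b} \<Longrightarrow> \<alpha> i \<ge> 0"
      "\<And>j. j \<in> {1..4} \<Longrightarrow> \<bar>\<alpha> j - Apt i j\<bar> \<le> 3 * \<delta>" for b m \<alpha>
  proof (rule conclude[of \<alpha>])
    show "admissible \<alpha>" by (rule admissibleI[OF that(5,6,7)])
    show "\<exists>C. \<forall>Ps Qs. finite Ps \<longrightarrow> finite Qs \<longrightarrow> restricted_type_with_const \<alpha> C (Lambda' Ps Qs)"
      unfolding that(3) by (rule restricted_type_size[OF \<delta>(1) _ that(1,2) refl refl])
        (use that(3,4) \<delta> in auto)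
  qed (fact that(8))
  note simps = shifted_exponent_def tuple4_def Apt_def atLeastAtMost_1_4 sq1 field_simps
  have "i \<in> {1,2,3,4,5,6,7,8,9,10,11,12}" using assms(1) by (auto simp: numeral_eq_Suc le_Suc_eq)
  then consider "i = 1" | "i = 2" | "i = 3" | "i = 4" | "i = 5" | "i = 6" | "i = 7" | "i = 8"
    | "i = 9" | "i = 10" | "i = 11" | "i = 12" by auto
  then show ?thesis
  proof cases
    \<comment> \<open>In the limit, \<theta> = 1 - \<delta> gives density exponent 1 to
      \<open>E 1\<close>, and \<theta> = \<delta> gives it to \<open>E 2\<close>; \<eta> decides
      likewise between \<open>E 3\<close> and \<open>E 4\<close>. J selects the densities that are
      traded against the bad index.\<close>
    case 1
    show ?thesis by (rule energy_case[of "1 - \<delta>" "1 - \<delta>" "{1,2,3}" 4, OF _ _ _ _ _ refl]) (use \<delta> 1 in \<open>auto simp: simps\<close>)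
  next
    case 2
    show ?thesis by (rule energy_case[of \<delta> "1 - \<delta>" "{1,2,3}" 4, OF _ _ _ _ _ refl]) (use \<delta> 2 in \<open>auto simp: simps\<close>)
  next
    case 3
    show ?thesis by (rule energy_case[of \<delta> \<delta> "{1,2,4}" 3, OF _ _ _ _ _ refl]) (use \<delta> 3 in \<open>auto simp: simps\<close>)
  next
    case 4
    show ?thesis by (rule energy_case[of "1 - \<delta>" \<delta> "{1,2,4}" 3, OF _ _ _ _ _ refl]) (use \<delta> 4 in \<open>auto simp: simps\<close>)
  next
    case 5
    show ?thesis by (rule energy_case[of "1 - \<delta>" "1 - \<delta>" "{1}" 2, OF _ _ _ _ _ refl]) (use \<delta> 5 in \<open>auto simp: simps\<close>)
  next
    case 6
    show ?thesis by (rule energy_case[of "1 - \<delta>" \<delta> "{1}" 2, OF _ _ _ _ _ refl]) (use \<delta> 6 in \<open>auto simp: simps\<close>)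
  next
    case 7
    \<comment> \<open>In the limit the exponents are 1/2, 1/2, 0, 0 with one unit moved from the bad
      index to m.\<close>
    show ?thesis by (rule size_case[of 2 4, OF _ _ refl]) (use \<delta> sq 7 in \<open>auto simp: simps\<close>)
  next
    case 8
    show ?thesis by (rule size_case[of 2 3, OF _ _ refl]) (use \<delta> sq 8 in \<open>auto simp: simps\<close>)
  next
    case 9
    show ?thesis by (rule energy_case[of \<delta> "1 - \<delta>" "{2}" 1, OF _ _ _ _ _ refl]) (use \<delta> 9 in \<open>auto simp: simps\<close>)
  next
    case 10
    show ?thesis by (rule energy_case[of \<delta> \<delta> "{2}" 1, OF _ _ _ _ _ refl]) (use \<delta> 10 in \<open>auto simp: simps\<close>)
  next
    case 11
    show ?thesis by (rule size_case[of 1 3, OF _ _ refl]) (use \<delta> sq 11 in \<open>auto simp: simps\<close>)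
  next
    case 12
    show ?thesis by (rule size_case[of 1 4, OF _ _ refl]) (use \<delta> sq 12 in \<open>auto simp: simps\<close>)
  qed
qed

end
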